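(* Let $V(z;t)$, $t\in[-t_0,t_0]$, $t_0>0$, be a one-parameter family of real analytic functions such that (a) $V(z;t)$ is analytic on $\Omega\times[-t_0,t_0]$ for some domain $\Omega\supset\mathbb R$; (b) $\lim_{|x|\to\infty}\min\{V(x;t):|t|\le t_0\}/\log|x|=\infty$; (c) $V(z;0)$ is regular. Let $t_1>0$ be such that for $t\in[-t_1,t_1]$, $V(z;t)$ is regular with a $t$-independent number of support intervals whose end-points are real analytic in $t$. Then the free energy $F(t)=\lim_{N\to\infty}-N^{-2}\ln Z_N(t)$ of $V(z;t)$ is analytic on $[-t_1,t_1]$.
   Context: $Z_N(t)=\int_{\mathbb R^N}\prod_{j<k}(z_j-z_k)^2e^{-N\sum_jV(z_j;t)}dz$; the limit exists and equals $I_{V}(\nu_{eq})=\min\{-\iint\log|x-y|d\nu d\nu+\int V(\cdot;t)d\nu\}$ over probability measures. Regularity: the equilibrium measure has support $\bigcup_{i=1}^q[a_i,b_i]$, density $\frac1{2\pi i}h(x)\sqrt{R_+(x)}$ with $R(z)=\prod_i(z-a_i)(z-b_i)$, $h$ real analytic, and $V$ is regular if $h>0$ on the support and $\int\log|x-y|d\nu_{eq}(y)-V(x)/2<l$ strictly off the support, $l$ being the constant value of the left side on the support. *)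

theory Defs
  imports "HOL-Probability.Probability" "HOL-Complex_Analysis.Complex_Analysis"
begin

text \<open>Joint holomorphy of a function of two complex variables on an open set D of C^2,
  in Osgood's sense: jointly continuous and holomorphic in each variable separately.\<close>
definition holo2 :: "(complex \<Rightarrow> complex \<Rightarrow> complex) \<Rightarrow> (complex \<times> complex) set \<Rightarrow> bool" where
  "holo2 W D \<longleftrightarrow> open D \<and> continuous_on D (\<lambda>p. W (fst p) (snd p)) \<and>
     (\<forall>p\<in>D. (\<lambda>z. W z (snd p)) field_differentiable at (fst p) \<and>
             (\<lambda>w. W (fst p) w) field_differentiable at (snd p))"

definition real_analytic_on :: "(real \<Rightarrow> real) \<Rightarrow> real set \<Rightarrow> bool" where
  "real_analytic_on f A \<longleftrightarrow> (\<exists>U G. open U \<and> complex_of_real ` A \<subseteq> U \<and> G holomorphic_on U \<and>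
      (\<forall>x\<in>A. G (complex_of_real x) = complex_of_real (f x)))"

definition log_kernel :: "(real \<Rightarrow> real) \<Rightarrow> real \<times> real \<Rightarrow> ereal" where
  "log_kernel Q p = (if fst p = snd p then \<infinity>
       else ereal (- ln \<bar>fst p - snd p\<bar> + (Q (fst p) + Q (snd p)) / 2))"

text \<open>I_Q(nu) = - double integral of log|x-y| + integral of Q, written as the double integral
  of the kernel (positive part minus negative part).\<close>
definition energy :: "(real \<Rightarrow> real) \<Rightarrow> real measure \<Rightarrow> ereal" where
  "energy Q \<nu> = enn2ereal (\<integral>\<^sup>+ p. e2ennreal (log_kernel Q p) \<partial>(\<nu> \<Otimes>\<^sub>M \<nu>))
              - enn2ereal (\<integral>\<^sup>+ p. e2ennreal (- log_kernel Q p) \<partial>(\<nu> \<Otimes>\<^sub>M \<nu>))"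

definition prob_borel :: "real measure \<Rightarrow> bool" where
  "prob_borel \<nu> \<longleftrightarrow> prob_space \<nu> \<and> sets \<nu> = sets borel"

definition is_eq_measure :: "(real \<Rightarrow> real) \<Rightarrow> real measure \<Rightarrow> bool" where
  "is_eq_measure Q \<mu> \<longleftrightarrow> prob_borel \<mu> \<and> energy Q \<mu> < \<infinity> \<and>
     (\<forall>\<nu>. prob_borel \<nu> \<longrightarrow> energy Q \<mu> \<le> energy Q \<nu>)"

definition regular_with :: "(real \<Rightarrow> real) \<Rightarrow> nat \<Rightarrow> (nat \<Rightarrow> real) \<Rightarrow> (nat \<Rightarrow> real) \<Rightarrow> bool" where
  "regular_with Q q a b \<longleftrightarrow> q \<ge> 1 \<and> (\<forall>i<q. a i < b i) \<and> (\<forall>i. Suc i < q \<longrightarrow> b i < a (Suc i)) \<and>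
     (\<exists>\<mu> h l. is_eq_measure Q \<mu> \<and>
        real_analytic_on h (\<Union>i<q. {a i..b i}) \<and>
        (\<forall>x\<in>(\<Union>i<q. {a i..b i}). h x > 0) \<and>
        \<mu> = density lborel (\<lambda>x. ennreal (indicator (\<Union>i<q. {a i..b i}) x * h x *
              sqrt \<bar>\<Prod>i<q. (x - a i) * (x - b i)\<bar> / (2 * pi))) \<and>
        (\<forall>x\<in>(\<Union>i<q. {a i..b i}). (\<integral>y. ln \<bar>x - y\<bar> \<partial>\<mu>) - Q x / 2 = l) \<and>
        (\<forall>x. x \<notin> (\<Union>i<q. {a i..b i}) \<longrightarrow> (\<integral>y. ln \<bar>x - y\<bar> \<partial>\<mu>) - Q x / 2 < l))"

definition regular :: "(real \<Rightarrow> real) \<Rightarrow> bool" where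
  "regular Q \<longleftrightarrow> (\<exists>q a b. regular_with Q q a b)"

definition partition_fn :: "(real \<Rightarrow> real \<Rightarrow> real) \<Rightarrow> nat \<Rightarrow> real \<Rightarrow> real" where
  "partition_fn V N t = (\<integral>z. (\<Prod>j<N. \<Prod>k\<in>{j<..<N}. (z j - z k)^2) *
        exp (- real N * (\<Sum>j<N. V (z j) t)) \<partial>(PiM {..<N} (\<lambda>_. lborel)))"

end

theory Submission
  imports Defs
begin

text \<open>Write nu t for the equilibrium measure of V t. The limit F exists and equals the minimal energy I: the
  integrand of the partition function is exp of minus the energy of a point configuration; smearing each
  point uniformly over a short interval turns a configuration into a competitor of nu t (lower bound of the
  energy), and Jensen's inequality under the product of copies of nu t gives the matching estimate.

  For analyticity, testing minimality for V t' with nu t gives F t' - F t \<le> (integral of V t' - V t against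
  nu t). Exchanging t and t' shows that F is differentiable with derivative the integral of the t-derivative
  of V against nu t, so it is enough that this integral is analytic in t. Minimality under the deformations
  x + eps Re (c / (z - x)) gives the loop equation for the Stieltjes transform g of nu t, which says that
  (V' - 2 g)^2 continues analytically across the support. As its boundary values there are h^2 R,
  the quotient H = (V' - 2 g) / sqrt R continues as well, and Cauchy's formula expresses
  H by V' and R alone, on a contour around the support; inserting this into a second contour integral
  expresses integrals against nu t by V and the end points a i t, b i t, which depend analytically on t.\<close>

section \<open>Energies of compactly supported laws\<close>

text \<open>How \<open>h\<close> varies with t is unknown; only V and the end points are analytic in
  t. The integrals against nu t must therefore be freed of \<open>h\<close>, which is the purpose of
  the second contour. One pair of rectangles serves all support intervals at once, since V is
  analytic near the whole real line and H continues over the gaps as well as over the cuts. For the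
  boundary values of V' - 2 g only an imaginary part is computed, as a Poisson integral. Its square
  is real on the axis, so wherever the density is positive the real part must tend to zero. In the
  energy bound, smearing costs a close pair a fixed amount that is not small, but is a small
  fraction of the large energy of that pair. Hence the errors are kept proportional to pair energies
  and divided out at the end. Self-energies stay linear in N because the width is fixed before N.
  The parameter interval is closed and may be all of \<open>{-t0..t0}\<close>, so real derivatives
  are taken from inside; F is then recovered as a primitive of a function holomorphic on a convex
  complex neighbourhood.\<close>

text \<open>Since ln 0 = 0, this differs from the extended-real kernel on the diagonal.\<close>
definition pair_energy :: "(real \<Rightarrow> real) \<Rightarrow> real \<times> real \<Rightarrow> real" where
  "pair_energy Q p = - ln \<bar>fst p - snd p\<bar> + (Q (fst p) + Q (snd p)) / 2"

text \<open>Integrability makes the positive and the negative part finite, so the difference in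
  \<open>energy\<close> is not of the form \<open>\<infinity> - \<infinity>\<close>; the diagonal,
  where the two kernels disagree, is a null set.\<close>

lemma energy_eq_integral:
  assumes int: "integrable (\<nu> \<Otimes>\<^sub>M \<nu>) (pair_energy Q)"
    and diag: "AE p in \<nu> \<Otimes>\<^sub>M \<nu>. fst p \<noteq> snd p"
  shows "energy Q \<nu> = ereal (\<integral>p. pair_energy Q p \<partial>(\<nu> \<Otimes>\<^sub>M \<nu>))"
proof -
  let ?M = "\<nu> \<Otimes>\<^sub>M \<nu>"
  have fin: "(\<integral>\<^sup>+p. ennreal (pair_energy Q p) \<partial>?M) < \<infinity>" "(\<integral>\<^sup>+p. ennreal (- pair_energy Q p) \<partial>?M) < \<infinity>"
    using int by (auto simp: real_integrable_def less_top)
  have 1: "(\<integral>\<^sup>+ p. e2ennreal (log_kernel Q p) \<partial>?M) = (\<integral>\<^sup>+p. ennreal (pair_energy Q p) \<partial>?M)"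
    using diag by (intro nn_integral_cong_AE) (auto simp: log_kernel_def pair_energy_def)
  have 2: "(\<integral>\<^sup>+ p. e2ennreal (- log_kernel Q p) \<partial>?M) = (\<integral>\<^sup>+p. ennreal (- pair_energy Q p) \<partial>?M)"
    using diag by (intro nn_integral_cong_AE) (auto simp: log_kernel_def pair_energy_def)
  have e: "enn2ereal x = ereal (enn2real x)" if "x < \<infinity>" for x
    using that by (cases x) auto
  show ?thesis
    unfolding energy_def 1 2 using int fin
    by (simp add: real_lebesgue_integral_def e)
qed

text \<open>A majorant integrable at zero: \<open>ln v \<le> v - 1\<close> at
  \<open>v = u powr (-1/2)\<close> controls the singularity by a power with an elementary integral.
  The summand \<open>u\<close> covers \<open>u \<ge> 1\<close>.\<close>

lemma abs_ln_le_powr: "\<bar>ln u\<bar> \<le> 2 * u powr (-1/2) + u" if "u > 0" for u :: real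
proof (cases "u \<ge> 1")
  case True
  then show ?thesis using ln_le_minus_one[of u] that by (auto intro: add_increasing)
next
  case False
  have "ln (u powr (-1/2)) \<le> u powr (-1/2)"
    using ln_le_minus_one[of "u powr (-1/2)"] that by simp
  moreover have "ln (u powr (-1/2)) = - ln u / 2" using that by (simp add: ln_powr)
  moreover have "ln u < 0" using False that by simp
  ultimately show ?thesis using that by (simp add: abs_if)
qed

lemma nn_integral_abs_ln_finite:
  "(\<integral>\<^sup>+u. ennreal (indicator {-a..a} u * \<bar>ln \<bar>u\<bar>\<bar>) \<partial>lborel) < \<infinity>"
proof (cases "a \<ge> 0")
  case True
  let ?f = "\<lambda>u. 2 * u powr (-1/2) + u :: real"
  let ?g = "\<lambda>u. ennreal (indicator {0..a} u * ?f u)"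
  have "((\<lambda>u. 2 * u powr (-1/2)) has_integral (2 * (a powr (-1/2+1) / (-1/2+1)))) {0..a}"
    by (intro has_integral_mult_right has_integral_powr_from_0) (use True in auto)
  moreover have "((\<lambda>u. u) has_integral ((a\<^sup>2 - 0\<^sup>2)/2)) {0..a}"
    using True by (intro ident_has_integral)
  ultimately have "(?f has_integral (2 * (a powr (-1/2+1) / (-1/2+1)) + ((a\<^sup>2 - 0\<^sup>2)/2))) {0..a}"
    by (rule has_integral_add)
  from nn_integral_has_integral_lebesgue[OF _ this]
  have fin: "(\<integral>\<^sup>+u. ?g u \<partial>lborel) < \<infinity>" by auto
  have "(\<integral>\<^sup>+u. ?g u \<partial>lborel) = (\<integral>\<^sup>+u. ?g (0 + (-1) * u) \<partial>lborel)"
    by (subst nn_integral_real_affine[where c="-1" and t=0]) auto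
  with fin have fin2: "(\<integral>\<^sup>+u. ?g (- u) \<partial>lborel) < \<infinity>" by simp
  have "(\<integral>\<^sup>+u. ennreal (indicator {-a..a} u * \<bar>ln \<bar>u\<bar>\<bar>) \<partial>lborel) \<le> (\<integral>\<^sup>+u. ?g u + ?g (-u) \<partial>lborel)"
  proof (intro nn_integral_mono)
    fix u :: real
    consider "u = 0" | "u > 0" | "u < 0" by linarith
    then show "ennreal (indicator {-a..a} u * \<bar>ln \<bar>u\<bar>\<bar>) \<le> ?g u + ?g (-u)"
    proof cases
      case 1 then show ?thesis by simp
    next
      case 2
      then show ?thesis using abs_ln_le_powr[of u]
        by (auto simp: indicator_def ennreal_leI)
    next
      case 3
      then show ?thesis using abs_ln_le_powr[of "-u"]
        by (auto simp: indicator_def ennreal_leI)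
    qed
  qed
  also have "\<dots> = (\<integral>\<^sup>+u. ?g u \<partial>lborel) + (\<integral>\<^sup>+u. ?g (-u) \<partial>lborel)"
    by (intro nn_integral_add) auto
  also have "\<dots> < \<infinity>" using fin fin2 by simp
  finally show ?thesis .
qed simp

text \<open>A bounded density with bounded support makes logarithmic energies finite. Both kinds of
  measure compared later are of this form: smeared configurations and equilibrium measures of
  regular potentials.\<close>

locale compact_law = prob_space \<nu> for \<nu> :: "real measure" +
  fixes p :: "real \<Rightarrow> real" and C A :: real
  assumes p_meas [measurable]: "p \<in> borel_measurable borel"
    and p_nonneg: "\<And>x. 0 \<le> p x" and p_le: "\<And>x. p x \<le> C"
    and p_out: "\<And>x. A < \<bar>x\<bar> \<Longrightarrow> p x = 0"
    and law: "\<nu> = density lborel (\<lambda>x. ennreal (p x))"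
begin

lemma sets_law [simp, measurable_cong]: "sets \<nu> = sets borel"
  by (simp add: law)

lemma space_law [simp]: "space \<nu> = UNIV"
  by (simp add: law)

lemma prob_borel_law: "prob_borel \<nu>"
  by (simp add: prob_borel_def prob_space_axioms)

lemma C_nonneg: "0 \<le> C"
  using p_nonneg[of 0] p_le[of 0] by linarith

lemma AE_bounded: "AE x in \<nu>. \<bar>x\<bar> \<le> A"
  unfolding law by (subst AE_density) (auto simp: not_less[symmetric] p_out intro!: AE_I2)

sublocale pair: pair_prob_space \<nu> \<nu> ..

sublocale pair: pair_sigma_finite \<nu> \<nu> ..

lemma sets_pair [measurable_cong]: "sets (\<nu> \<Otimes>\<^sub>M \<nu>) = sets (borel \<Otimes>\<^sub>M borel)"
  by (intro sets_pair_measure_cong) auto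

lemma AE_point_neq: "AE y in \<nu>. x \<noteq> y"
proof -
  have "AE y in lborel. x \<noteq> y" using AE_lborel_singleton[of x] by eventually_elim auto
  then show ?thesis unfolding law by (subst AE_density) auto
qed

lemma AE_off_diagonal: "AE q in \<nu> \<Otimes>\<^sub>M \<nu>. fst q \<noteq> snd q"
proof (rule pair.AE_pair_measure)
  show "{q \<in> space (\<nu> \<Otimes>\<^sub>M \<nu>). fst q \<noteq> snd q} \<in> sets (\<nu> \<Otimes>\<^sub>M \<nu>)" by measurable
qed (auto simp: AE_point_neq)

lemma AE_pair_bounded: "AE q in \<nu> \<Otimes>\<^sub>M \<nu>. \<bar>fst q\<bar> \<le> A \<and> \<bar>snd q\<bar> \<le> A"
proof (rule pair.AE_pair_measure)
  show "{q \<in> space (\<nu> \<Otimes>\<^sub>M \<nu>). \<bar>fst q\<bar> \<le> A \<and> \<bar>snd q\<bar> \<le> A} \<in> sets (\<nu> \<Otimes>\<^sub>M \<nu>)" by measurable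
  show "AE x in \<nu>. AE y in \<nu>. \<bar>fst (x, y)\<bar> \<le> A \<and> \<bar>snd (x, y)\<bar> \<le> A"
    using AE_bounded
  proof eventually_elim
    case (elim x)
    show ?case using AE_bounded by eventually_elim (use elim in auto)
  qed
qed

lemma integrable_pair_bounded:
  assumes [measurable]: "f \<in> borel_measurable (borel \<Otimes>\<^sub>M borel)"
    and "\<And>x y. \<bar>x\<bar> \<le> A \<Longrightarrow> \<bar>y\<bar> \<le> A \<Longrightarrow> norm (f (x, y)) \<le> B"
  shows "integrable (\<nu> \<Otimes>\<^sub>M \<nu>) (f :: _ \<Rightarrow> 'b::{banach, second_countable_topology})"
proof (rule pair.P.integrable_const_bound[where B=B])
  show "AE q in \<nu> \<Otimes>\<^sub>M \<nu>. norm (f q) \<le> B" using AE_pair_bounded by eventually_elim (use assms(2) in auto)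
qed measurable

lemma integrable_bounded:
  assumes [measurable]: "f \<in> borel_measurable borel"
    and "\<And>x. \<bar>x\<bar> \<le> A \<Longrightarrow> norm (f x) \<le> B"
  shows "integrable \<nu> (f :: _ \<Rightarrow> 'b::{banach, second_countable_topology})"
proof (rule integrable_const_bound[where B=B])
  show "AE q in \<nu>. norm (f q) \<le> B" using AE_bounded by eventually_elim (use assms(2) in auto)
qed measurable

text \<open>For \<open>x\<close> in the support the differences \<open>x - y\<close> stay in
  \<open>{-(2*A)..2*A}\<close> and the density is at most \<open>C\<close>, so the inner integral is
  bounded by a constant that does not depend on \<open>x\<close>.\<close>

lemma integrable_ln: "integrable (\<nu> \<Otimes>\<^sub>M \<nu>) (\<lambda>q. ln \<bar>fst q - snd q\<bar>)"
proof -
  define K where "K = (\<integral>\<^sup>+u. ennreal (indicator {-(2*A)..2*A} u * \<bar>ln \<bar>u\<bar>\<bar>) \<partial>lborel)"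
  have K: "K < \<infinity>" unfolding K_def by (rule nn_integral_abs_ln_finite)
  have inner: "(\<integral>\<^sup>+y. ennreal \<bar>ln \<bar>x - y\<bar>\<bar> \<partial>\<nu>) \<le> ennreal C * K" if "\<bar>x\<bar> \<le> A" for x
  proof -
    have "(\<integral>\<^sup>+y. ennreal \<bar>ln \<bar>x - y\<bar>\<bar> \<partial>\<nu>) = (\<integral>\<^sup>+y. ennreal (p y) * ennreal \<bar>ln \<bar>x - y\<bar>\<bar> \<partial>lborel)"
      unfolding law by (subst nn_integral_density) auto
    also have "\<dots> \<le> (\<integral>\<^sup>+y. ennreal C * ennreal (indicator {-(2*A)..2*A} (x - y) * \<bar>ln \<bar>x - y\<bar>\<bar>) \<partial>lborel)"
    proof (intro nn_integral_mono)
      fix y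
      show "ennreal (p y) * ennreal \<bar>ln \<bar>x - y\<bar>\<bar> \<le> ennreal C * ennreal (indicator {-(2*A)..2*A} (x - y) * \<bar>ln \<bar>x - y\<bar>\<bar>)"
      proof (cases "\<bar>y\<bar> \<le> A")
        case True
        then have "x - y \<in> {-(2*A)..2*A}" using that by auto
        then show ?thesis using p_le[of y] by (auto intro!: mult_right_mono ennreal_leI)
      qed (simp add: p_out)
    qed
    also have "\<dots> = ennreal C * (\<integral>\<^sup>+y. ennreal (indicator {-(2*A)..2*A} (x - y) * \<bar>ln \<bar>x - y\<bar>\<bar>) \<partial>lborel)"
      by (intro nn_integral_cmult) auto
    also have "(\<integral>\<^sup>+y. ennreal (indicator {-(2*A)..2*A} (x - y) * \<bar>ln \<bar>x - y\<bar>\<bar>) \<partial>lborel) = K"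
      unfolding K_def by (subst (2) nn_integral_real_affine[where c="-1" and t=x]) auto
    finally show ?thesis .
  qed
  have "(\<integral>\<^sup>+q. ennreal (norm (ln \<bar>fst q - snd q\<bar>)) \<partial>(\<nu> \<Otimes>\<^sub>M \<nu>))
      = (\<integral>\<^sup>+x. \<integral>\<^sup>+y. ennreal \<bar>ln \<bar>x - y\<bar>\<bar> \<partial>\<nu> \<partial>\<nu>)"
    using nn_integral_fst[of "\<lambda>q. ennreal \<bar>ln \<bar>fst q - snd q\<bar>\<bar>" \<nu>] by simp
  also have "\<dots> \<le> (\<integral>\<^sup>+x. ennreal C * K \<partial>\<nu>)"
    by (intro nn_integral_mono_AE) (use AE_bounded inner in \<open>auto elim!: eventually_mono\<close>)
  also have "\<dots> < \<infinity>" using K by (simp add: emeasure_space_1[simplified] ennreal_mult_less_top)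
  finally show ?thesis
    by (intro integrableI_bounded) auto
qed

lemma integrable_pair_energy:
  assumes "continuous_on UNIV Q"
  shows "integrable (\<nu> \<Otimes>\<^sub>M \<nu>) (pair_energy Q)"
proof -
  have [measurable]: "Q \<in> borel_measurable borel" using assms by (rule borel_measurable_continuous_onI)
  obtain B where B: "\<And>x. \<bar>x\<bar> \<le> A \<Longrightarrow> \<bar>Q x\<bar> \<le> B"
  proof -
    have "compact (Q ` {-A..A})" using assms by (intro compact_continuous_image) (auto intro: continuous_on_subset)
    then obtain B where "\<forall>x\<in>Q ` {-A..A}. norm x \<le> B" by (meson bounded_iff compact_imp_bounded)
    then show ?thesis by (intro that[of B]) (simp add: abs_le_iff)
  qed
  have "integrable (\<nu> \<Otimes>\<^sub>M \<nu>) (\<lambda>q. (Q (fst q) + Q (snd q)) / 2)"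
  proof (rule integrable_pair_bounded[where B="B"])
    fix x y assume "\<bar>x\<bar> \<le> A" "\<bar>y\<bar> \<le> A"
    then show "norm ((Q (fst (x, y)) + Q (snd (x, y))) / 2) \<le> B" using B[of x] B[of y] by auto
  qed auto
  then have "integrable (\<nu> \<Otimes>\<^sub>M \<nu>) (\<lambda>q. - ln \<bar>fst q - snd q\<bar> + (Q (fst q) + Q (snd q)) / 2)"
    using integrable_ln by auto
  then show ?thesis by (simp add: pair_energy_def[abs_def])
qed

lemma energy_law:
  assumes "continuous_on UNIV Q"
  shows "energy Q \<nu> = ereal (\<integral>q. pair_energy Q q \<partial>(\<nu> \<Otimes>\<^sub>M \<nu>))"
  by (intro energy_eq_integral integrable_pair_energy AE_off_diagonal assms)

end

section \<open>Lower bound for the energy of configurations\<close>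

definition smear :: "real \<Rightarrow> real \<Rightarrow> real \<Rightarrow> real" where
  "smear \<eta> a x = indicator {a..a+\<eta>} x / \<eta>"

definition smear2 :: "real \<Rightarrow> real \<Rightarrow> real \<Rightarrow> real \<times> real \<Rightarrow> real" where
  "smear2 \<eta> a b q = smear \<eta> a (fst q) * smear \<eta> b (snd q)"

lemma smear_measurable [measurable]: "smear \<eta> a \<in> borel_measurable borel"
  unfolding smear_def by measurable

lemma smear2_measurable [measurable]: "smear2 \<eta> a b \<in> borel_measurable (borel \<Otimes>\<^sub>M borel)"
  unfolding smear2_def by measurable

lemma smear_nonneg: "\<eta> > 0 \<Longrightarrow> 0 \<le> smear \<eta> a x"
  by (simp add: smear_def)

lemma smear2_nonneg: "\<eta> > 0 \<Longrightarrow> 0 \<le> smear2 \<eta> a b q"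
  by (simp add: smear2_def smear_nonneg)

lemma smear2_eq_0: "\<not> (fst q \<in> {a..a+\<eta>} \<and> snd q \<in> {b..b+\<eta>}) \<Longrightarrow> smear2 \<eta> a b q = 0"
  by (auto simp: smear2_def smear_def)

lemma nn_integral_smear: "\<eta> > 0 \<Longrightarrow> (\<integral>\<^sup>+x. ennreal (smear \<eta> a x) \<partial>lborel) = 1"
proof -
  assume \<eta>: "\<eta> > 0"
  have "(\<integral>\<^sup>+x. ennreal (smear \<eta> a x) \<partial>lborel) = (\<integral>\<^sup>+x. ennreal (1/\<eta>) * indicator {a..a+\<eta>} x \<partial>lborel)"
    by (intro nn_integral_cong) (auto simp: smear_def indicator_def)
  also have "\<dots> = ennreal (1/\<eta>) * ennreal \<eta>"
    using \<eta> by (subst nn_integral_cmult) auto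
  also have "\<dots> = 1" using \<eta> by (simp flip: ennreal_mult)
  finally show ?thesis .
qed

lemma
  assumes \<eta>: "\<eta> > 0"
  shows integrable_smear2: "integrable (lborel \<Otimes>\<^sub>M lborel) (smear2 \<eta> a b)"
    and integral_smear2: "(\<integral>q. smear2 \<eta> a b q \<partial>(lborel \<Otimes>\<^sub>M lborel)) = 1"
proof -
  have "(\<integral>\<^sup>+q. ennreal (smear2 \<eta> a b q) \<partial>(lborel \<Otimes>\<^sub>M lborel))
      = (\<integral>\<^sup>+x. \<integral>\<^sup>+y. ennreal (smear2 \<eta> a b (x, y)) \<partial>lborel \<partial>lborel)"
    by (subst lborel.nn_integral_fst) auto
  also have "\<dots> = (\<integral>\<^sup>+x. ennreal (smear \<eta> a x) * (\<integral>\<^sup>+y. ennreal (smear \<eta> b y) \<partial>lborel) \<partial>lborel)"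
    by (subst nn_integral_cmult[symmetric])
       (auto simp: smear2_def ennreal_mult smear_nonneg[OF \<eta>] intro!: nn_integral_cong)
  also have "\<dots> = ennreal 1" by (simp add: nn_integral_smear[OF \<eta>])
  finally have nn: "(\<integral>\<^sup>+q. ennreal (smear2 \<eta> a b q) \<partial>(lborel \<Otimes>\<^sub>M lborel)) = ennreal 1" .
  show "integrable (lborel \<Otimes>\<^sub>M lborel) (smear2 \<eta> a b)"
    by (rule integrableI_nn_integral_finite[OF _ _ nn]) (auto simp: smear2_nonneg[OF \<eta>])
  show "(\<integral>q. smear2 \<eta> a b q \<partial>(lborel \<Otimes>\<^sub>M lborel)) = 1"
    by (rule integral_eq_nn_integral[THEN trans]) (auto simp: nn smear2_nonneg[OF \<eta>])
qed

lemma integrable_smear2_bounded: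
  assumes \<eta>: "\<eta> > 0" and [measurable]: "f \<in> borel_measurable (borel \<Otimes>\<^sub>M borel)"
    and B: "\<And>x y. x \<in> {a..a+\<eta>} \<Longrightarrow> y \<in> {b..b+\<eta>} \<Longrightarrow> \<bar>f (x, y)\<bar> \<le> B"
  shows "integrable (lborel \<Otimes>\<^sub>M lborel) (\<lambda>q. smear2 \<eta> a b q * f q)"
proof (rule Bochner_Integration.integrable_bound[of _ "\<lambda>q. B * smear2 \<eta> a b q"])
  show "AE q in lborel \<Otimes>\<^sub>M lborel. norm (smear2 \<eta> a b q * f q) \<le> norm (B * smear2 \<eta> a b q)"
  proof (rule AE_I2)
    fix q :: "real \<times> real"
    show "norm (smear2 \<eta> a b q * f q) \<le> norm (B * smear2 \<eta> a b q)"
    proof (cases "fst q \<in> {a..a+\<eta>} \<and> snd q \<in> {b..b+\<eta>}")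
      case True
      then have "\<bar>f q\<bar> \<le> \<bar>B\<bar>" using B[of "fst q" "snd q"] by auto
      then show ?thesis using mult_right_mono[of "\<bar>f q\<bar>" "\<bar>B\<bar>" "\<bar>smear2 \<eta> a b q\<bar>"] by (simp add: abs_mult mult.commute)
    qed (simp add: smear2_eq_0)
  qed
qed (use integrable_smear2[OF \<eta>] in auto)

lemma integral_smear2_le:
  assumes \<eta>: "\<eta> > 0" and "integrable (lborel \<Otimes>\<^sub>M lborel) (\<lambda>q. smear2 \<eta> a b q * f q)"
    and B: "\<And>x y. x \<in> {a..a+\<eta>} \<Longrightarrow> y \<in> {b..b+\<eta>} \<Longrightarrow> f (x, y) \<le> B"
  shows "(\<integral>q. smear2 \<eta> a b q * f q \<partial>(lborel \<Otimes>\<^sub>M lborel)) \<le> B"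
proof -
  have "(\<integral>q. smear2 \<eta> a b q * f q \<partial>(lborel \<Otimes>\<^sub>M lborel)) \<le> (\<integral>q. smear2 \<eta> a b q * B \<partial>(lborel \<Otimes>\<^sub>M lborel))"
  proof (rule integral_mono)
    fix q :: "real \<times> real"
    show "smear2 \<eta> a b q * f q \<le> smear2 \<eta> a b q * B"
    proof (cases "fst q \<in> {a..a+\<eta>} \<and> snd q \<in> {b..b+\<eta>}")
      case True
      then show ?thesis using B[of "fst q" "snd q"] by (auto intro!: mult_left_mono smear2_nonneg[OF \<eta>])
    qed (simp add: smear2_eq_0)
  qed (use assms(2) integrable_smear2[OF \<eta>] in auto)
  then show ?thesis by (simp add: integral_smear2[OF \<eta>])
qed

text \<open>Equals 2. It bounds the positive part of the energy between two smears of width one;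
  rescaling reduces every width to this case.\<close>

definition ln_const :: real where
  "ln_const = enn2real (\<integral>\<^sup>+u. ennreal (indicator {-1..1} u * \<bar>ln \<bar>u\<bar>\<bar>) \<partial>lborel)"

text \<open>Under \<open>y = x + \<eta> * u\<close> the Jacobian cancels the height
  \<open>1/\<eta>\<close> of the smear, and the positive part of \<open>- ln \<bar>u\<bar>\<close>
  vanishes for \<open>\<bar>u\<bar> > 1\<close>. Hence one bound for all \<open>x\<close>,
  \<open>b\<close> and \<open>\<eta>\<close>.\<close>

lemma nn_integral_smear_ln_le:
  assumes \<eta>: "\<eta> > 0"
  shows "(\<integral>\<^sup>+y. ennreal (smear \<eta> b y * max 0 (- ln (\<bar>x - y\<bar> / \<eta>))) \<partial>lborel) \<le> ennreal ln_const"
proof -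
  have "(\<integral>\<^sup>+y. ennreal (smear \<eta> b y * max 0 (- ln (\<bar>x - y\<bar> / \<eta>))) \<partial>lborel)
     = ennreal \<eta> * (\<integral>\<^sup>+u. ennreal (smear \<eta> b (x + \<eta> * u) * max 0 (- ln (\<bar>x - (x + \<eta> * u)\<bar> / \<eta>))) \<partial>lborel)"
    by (subst nn_integral_real_affine[where c=\<eta> and t=x]) (use \<eta> in auto)
  also have "\<dots> = (\<integral>\<^sup>+u. ennreal \<eta> * ennreal (smear \<eta> b (x + \<eta> * u) * max 0 (- ln (\<bar>x - (x + \<eta> * u)\<bar> / \<eta>))) \<partial>lborel)"
    by (intro nn_integral_cmult[symmetric]) measurable
  also have "\<dots> \<le> (\<integral>\<^sup>+u. ennreal (indicator {-1..1} u * \<bar>ln \<bar>u\<bar>\<bar>) \<partial>lborel)"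
  proof (intro nn_integral_mono)
    fix u :: real
    have "\<eta> * (smear \<eta> b (x + \<eta> * u) * max 0 (- ln (\<bar>x - (x + \<eta> * u)\<bar> / \<eta>))) \<le> max 0 (- ln \<bar>u\<bar>)"
      using \<eta> by (auto simp: smear_def indicator_def abs_mult)
    also have "\<dots> \<le> indicator {-1..1} u * \<bar>ln \<bar>u\<bar>\<bar>"
      by (cases "\<bar>u\<bar> \<le> 1") (auto simp: indicator_def)
    finally show "ennreal \<eta> * ennreal (smear \<eta> b (x + \<eta> * u) * max 0 (- ln (\<bar>x - (x + \<eta> * u)\<bar> / \<eta>)))
      \<le> ennreal (indicator {-1..1} u * \<bar>ln \<bar>u\<bar>\<bar>)"
      using \<eta> by (simp add: ennreal_mult'[symmetric] ennreal_leI)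
  qed
  also have "\<dots> = ennreal ln_const"
    unfolding ln_const_def using nn_integral_abs_ln_finite[of 1] by simp
  finally show ?thesis .
qed

text \<open>Write \<open>- ln \<bar>x - y\<bar>\<close> as
  \<open>- ln \<eta> - ln (\<bar>x - y\<bar> / \<eta>)\<close>. Dropping the negative part of the
  second term leaves the scale-free integral bounded by \<open>ln_const\<close>. The case
  \<open>a = b\<close> is the self-energy of a smeared point.\<close>

lemma
  assumes \<eta>: "\<eta> > 0"
  shows integrable_smear2_ln: "integrable (lborel \<Otimes>\<^sub>M lborel) (\<lambda>q. smear2 \<eta> a b q * - ln \<bar>fst q - snd q\<bar>)" (is ?I)
    and integral_smear2_ln_le: "(\<integral>q. smear2 \<eta> a b q * - ln \<bar>fst q - snd q\<bar> \<partial>(lborel \<Otimes>\<^sub>M lborel)) \<le> ln_const - ln \<eta>" (is ?L)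
proof -
  let ?h = "\<lambda>q. smear2 \<eta> a b q * max 0 (- ln (\<bar>fst q - snd q\<bar> / \<eta>))"
  have "(\<integral>\<^sup>+q. ennreal (?h q) \<partial>(lborel \<Otimes>\<^sub>M lborel)) = (\<integral>\<^sup>+x. \<integral>\<^sup>+y. ennreal (?h (x, y)) \<partial>lborel \<partial>lborel)"
    by (subst lborel.nn_integral_fst) auto
  also have "\<dots> = (\<integral>\<^sup>+x. ennreal (smear \<eta> a x) * (\<integral>\<^sup>+y. ennreal (smear \<eta> b y * max 0 (- ln (\<bar>x - y\<bar> / \<eta>))) \<partial>lborel) \<partial>lborel)"
    by (subst nn_integral_cmult[symmetric])
       (auto simp: smear2_def ennreal_mult' smear_nonneg[OF \<eta>] mult.assoc intro!: nn_integral_cong)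
  also have "\<dots> \<le> (\<integral>\<^sup>+x. ennreal (smear \<eta> a x) * ennreal ln_const \<partial>lborel)"
    by (intro nn_integral_mono mult_left_mono nn_integral_smear_ln_le \<eta>) auto
  also have "\<dots> = ennreal ln_const"
    by (subst nn_integral_multc) (auto simp: nn_integral_smear[OF \<eta>])
  finally have nn: "(\<integral>\<^sup>+q. ennreal (?h q) \<partial>(lborel \<Otimes>\<^sub>M lborel)) \<le> ennreal ln_const" .
  have h0: "0 \<le> ?h q" for q by (simp add: smear2_nonneg[OF \<eta>])
  have hint: "integrable (lborel \<Otimes>\<^sub>M lborel) ?h"
    proof (rule integrableI_bounded)
    have "(\<integral>\<^sup>+q. ennreal (norm (?h q)) \<partial>(lborel \<Otimes>\<^sub>M lborel)) \<le> ennreal ln_const"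
      using nn h0 by simp
    then show "(\<integral>\<^sup>+q. ennreal (norm (?h q)) \<partial>(lborel \<Otimes>\<^sub>M lborel)) < \<infinity>"
      by (rule le_less_trans) simp
  qed measurable
  have c0: "0 \<le> ln_const" by (simp add: ln_const_def)
  have hle: "(\<integral>q. ?h q \<partial>(lborel \<Otimes>\<^sub>M lborel)) \<le> ln_const"
  proof -
    have "ennreal (\<integral>q. ?h q \<partial>(lborel \<Otimes>\<^sub>M lborel)) \<le> ennreal ln_const"
      by (subst nn_integral_eq_integral[symmetric]) (use hint h0 nn in auto)
    then show ?thesis using c0 by simp
  qed
  \<comment> \<open>Bounds what \<open>?h\<close> leaves over: the shift by
    \<open>ln \<eta>\<close>, and the logarithm at the largest possible distance between points of
    the two smears.\<close>
  define K where "K = \<bar>ln \<eta>\<bar> + \<bar>ln (\<bar>a - b\<bar> + \<eta>)\<bar>"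
  show ?I
  proof (rule Bochner_Integration.integrable_bound)
    show "integrable (lborel \<Otimes>\<^sub>M lborel) (\<lambda>q. ?h q + K * smear2 \<eta> a b q)"
      using hint integrable_smear2[OF \<eta>] by auto
    show "AE q in lborel \<Otimes>\<^sub>M lborel. norm (smear2 \<eta> a b q * - ln \<bar>fst q - snd q\<bar>) \<le> norm (?h q + K * smear2 \<eta> a b q)"
    proof (rule AE_I2)
      fix q :: "real \<times> real"
      show "norm (smear2 \<eta> a b q * - ln \<bar>fst q - snd q\<bar>) \<le> norm (?h q + K * smear2 \<eta> a b q)"
      proof (cases "fst q \<in> {a..a+\<eta>} \<and> snd q \<in> {b..b+\<eta>}")
        case True
        have "\<bar>ln \<bar>fst q - snd q\<bar>\<bar> \<le> max 0 (- ln (\<bar>fst q - snd q\<bar> / \<eta>)) + K"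
        proof (cases "fst q = snd q")
          case False
          then have "ln \<bar>fst q - snd q\<bar> \<le> ln (\<bar>a - b\<bar> + \<eta>)"
            using True \<eta> by (intro ln_mono) auto
          moreover have "ln (\<bar>fst q - snd q\<bar> / \<eta>) = ln \<bar>fst q - snd q\<bar> - ln \<eta>"
            using False \<eta> by (simp add: ln_div)
          ultimately show ?thesis unfolding K_def by linarith
        qed (simp add: K_def)
        then have "smear2 \<eta> a b q * \<bar>ln \<bar>fst q - snd q\<bar>\<bar> \<le> smear2 \<eta> a b q * (max 0 (- ln (\<bar>fst q - snd q\<bar> / \<eta>)) + K)"
          by (intro mult_left_mono smear2_nonneg[OF \<eta>])
        also have "\<dots> = ?h q + K * smear2 \<eta> a b q" by (simp add: algebra_simps)
        finally show ?thesis using smear2_nonneg[OF \<eta>, of a b q] by (simp add: abs_mult)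
      qed (simp add: smear2_eq_0)
    qed
  qed auto
  \<comment> \<open>The indicator term repairs the diagonal, where \<open>ln 0 = 0\<close> would
    violate the pointwise bound for \<open>\<eta> > 1\<close>. It vanishes almost everywhere and is
    removed again below.\<close>
  have "(\<integral>q. smear2 \<eta> a b q * - ln \<bar>fst q - snd q\<bar> \<partial>(lborel \<Otimes>\<^sub>M lborel))
     \<le> (\<integral>q. ?h q + - ln \<eta> * smear2 \<eta> a b q + smear2 \<eta> a b q * (indicator {q. fst q = snd q} q * ln \<eta>) \<partial>(lborel \<Otimes>\<^sub>M lborel))"
  proof (rule integral_mono)
    show "integrable (lborel \<Otimes>\<^sub>M lborel) (\<lambda>q. ?h q + - ln \<eta> * smear2 \<eta> a b q + smear2 \<eta> a b q * (indicator {q. fst q = snd q} q * ln \<eta>))"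
    proof (intro Bochner_Integration.integrable_add integrable_mult_right hint integrable_smear2 \<eta> integrable_smear2_bounded[where B="\<bar>ln \<eta>\<bar>"])
      have "{q::real\<times>real. fst q = snd q} \<in> sets (borel \<Otimes>\<^sub>M borel)"
        unfolding borel_prod by (intro borel_closed closed_Collect_eq continuous_intros)
      then show "(\<lambda>q::real\<times>real. indicator {q. fst q = snd q} q * ln \<eta>) \<in> borel_measurable (borel \<Otimes>\<^sub>M borel)"
        by (intro borel_measurable_times borel_measurable_indicator borel_measurable_const)
    qed (auto simp: indicator_def)
    fix q :: "real \<times> real"
    show "smear2 \<eta> a b q * - ln \<bar>fst q - snd q\<bar> \<le> ?h q + - ln \<eta> * smear2 \<eta> a b q + smear2 \<eta> a b q * (indicator {q. fst q = snd q} q * ln \<eta>)"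
    proof (cases "fst q = snd q")
      case False
      then have "- ln \<bar>fst q - snd q\<bar> \<le> max 0 (- ln (\<bar>fst q - snd q\<bar> / \<eta>)) - ln \<eta>"
        using \<eta> by (simp add: ln_div)
      then have "smear2 \<eta> a b q * - ln \<bar>fst q - snd q\<bar> \<le> smear2 \<eta> a b q * (max 0 (- ln (\<bar>fst q - snd q\<bar> / \<eta>)) - ln \<eta>)"
        by (intro mult_left_mono smear2_nonneg[OF \<eta>])
      also have "\<dots> = ?h q - ln \<eta> * smear2 \<eta> a b q" by (simp add: algebra_simps)
      finally show ?thesis using False by simp
    qed simp
  qed fact
  also have "\<dots> = (\<integral>q. ?h q + - ln \<eta> * smear2 \<eta> a b q \<partial>(lborel \<Otimes>\<^sub>M lborel))"
  proof (rule integral_cong_AE)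
    have "AE q in lborel \<Otimes>\<^sub>M lborel. fst q \<noteq> (snd q :: real)"
    proof (rule lborel_pair.AE_pair_measure)
      show "AE x in lborel. AE y in lborel. fst (x, y) \<noteq> snd (x, y :: real)"
      proof (rule AE_I2)
        fix x :: real
        show "AE y in lborel. fst (x, y) \<noteq> snd (x, y)"
          using AE_lborel_singleton[of x] by eventually_elim auto
      qed
    qed measurable
    then show "AE q in lborel \<Otimes>\<^sub>M lborel. ?h q + - ln \<eta> * smear2 \<eta> a b q + smear2 \<eta> a b q * (indicator {q. fst q = snd q} q * ln \<eta>)
        = ?h q + - ln \<eta> * smear2 \<eta> a b q" by eventually_elim auto
    have [measurable]: "{q::real\<times>real. fst q = snd q} \<in> sets (borel \<Otimes>\<^sub>M borel)"
      unfolding borel_prod by (intro borel_closed closed_Collect_eq continuous_intros)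
    show "(\<lambda>q. ?h q + - ln \<eta> * smear2 \<eta> a b q + smear2 \<eta> a b q * (indicator {q. fst q = snd q} q * ln \<eta>)) \<in> borel_measurable (lborel \<Otimes>\<^sub>M lborel)"
      by measurable
  qed measurable
  also have "\<dots> \<le> ln_const - ln \<eta>"
    using hle hint integrable_smear2[OF \<eta>] by (simp add: integral_smear2[OF \<eta>])
  finally show ?L .
qed

text \<open>Pairs at distance at least \<open>M * \<eta>\<close> hardly notice the smearing. For
  closer pairs the loss is the constant \<open>ln_const + ln M\<close>, which is at most the
  fraction \<open>\<epsilon>\<close> of \<open>- ln \<bar>a - b\<bar>\<close> once
  \<open>\<eta>\<close> is small. This is the origin of the error term proportional to the
  logarithm.\<close>

lemma smear2_ln_le_perturbed:
  assumes \<epsilon>: "\<epsilon> > (0::real)"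
  shows "\<exists>\<delta>>0. \<forall>\<eta>. 0 < \<eta> \<and> \<eta> < \<delta> \<longrightarrow> (\<forall>a b. a \<noteq> b \<longrightarrow>
    (\<integral>q. smear2 \<eta> a b q * - ln \<bar>fst q - snd q\<bar> \<partial>(lborel \<Otimes>\<^sub>M lborel)) \<le> - ln \<bar>a - b\<bar> + \<epsilon> + \<epsilon> * max 0 (- ln \<bar>a - b\<bar>))"
proof -
  \<comment> \<open>\<open>M \<ge> 2\<close> puts \<open>1/M\<close> into the range of the lower
    bound for \<open>ln (1 - x)\<close>; the resulting error for distant pairs is
    \<open>2/M\<close>.\<close>
  define M where "M = max 2 (2/\<epsilon>)"
  have M: "M \<ge> 2" "2 / M \<le> \<epsilon>" using \<epsilon> by (auto simp: M_def field_simps max_def)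
  have c0: "0 \<le> ln_const" by (simp add: ln_const_def)
  \<comment> \<open>Chosen so that \<open>\<bar>a - b\<bar> < M * \<eta>\<close> with
    \<open>\<eta> < \<delta>\<close> gives
    \<open>ln_const + ln M \<le> \<epsilon> * - ln \<bar>a - b\<bar>\<close>.\<close>
  define \<delta> where "\<delta> = exp (- (ln_const + ln M) / \<epsilon>) / M"
  have \<delta>: "\<delta> > 0" using M by (simp add: \<delta>_def)
  show ?thesis
  proof (intro exI[of _ \<delta>] conjI \<delta> allI impI)
    fix \<eta> a b :: real assume \<eta>: "0 < \<eta> \<and> \<eta> < \<delta>" and ab: "a \<noteq> b"
    let ?L = "\<integral>q. smear2 \<eta> a b q * - ln \<bar>fst q - snd q\<bar> \<partial>(lborel \<Otimes>\<^sub>M lborel)"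
    show "?L \<le> - ln \<bar>a - b\<bar> + \<epsilon> + \<epsilon> * max 0 (- ln \<bar>a - b\<bar>)"
    proof (cases "\<bar>a - b\<bar> \<ge> M * \<eta>")
      case True
      have "?L \<le> - ln \<bar>a - b\<bar> + 2 / M"
      proof (rule integral_smear2_le)
        fix x y assume xy: "x \<in> {a..a+\<eta>}" "y \<in> {b..b+\<eta>}"
        have "\<bar>a - b\<bar> * (1 - 1/M) \<le> \<bar>x - y\<bar>"
        proof -
          have "\<eta> \<le> \<bar>a - b\<bar> / M" using True M by (simp add: field_simps)
          then have "\<bar>a - b\<bar> * (1 - 1/M) \<le> \<bar>a - b\<bar> - \<eta>" by (simp add: algebra_simps)
          also have "\<dots> \<le> \<bar>x - y\<bar>" using xy by auto
          finally show ?thesis .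
        qed
        moreover have "0 < \<bar>a - b\<bar> * (1 - 1/M)" using ab M by (auto intro!: mult_pos_pos simp: field_simps)
        ultimately have "ln (\<bar>a - b\<bar> * (1 - 1/M)) \<le> ln \<bar>x - y\<bar>" by (intro ln_mono) auto
        moreover have "ln (\<bar>a - b\<bar> * (1 - 1/M)) = ln \<bar>a - b\<bar> + ln (1 - 1/M)"
          using ab M by (intro ln_mult_pos) (auto simp: field_simps)
        moreover have "- (1/M) - 2 * (1/M)\<^sup>2 \<le> ln (1 - 1/M)"
          by (rule ln_one_minus_pos_lower_bound) (use M in \<open>auto simp: field_simps\<close>)
        moreover have "2 * (1/M)\<^sup>2 \<le> 1/M" using M by (auto simp: power2_eq_square field_simps)
        ultimately show "- ln \<bar>fst (x, y) - snd (x, y)\<bar> \<le> - ln \<bar>a - b\<bar> + 2 / M" by simp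
      qed (use \<eta> integrable_smear2_ln in auto)
      also have "\<dots> \<le> - ln \<bar>a - b\<bar> + \<epsilon> + \<epsilon> * max 0 (- ln \<bar>a - b\<bar>)"
        using M \<epsilon> by (simp add: add_increasing2)
      finally show ?thesis .
    next
      case False
      have "M * \<eta> < exp (- (ln_const + ln M) / \<epsilon>)" using \<eta> M by (simp add: \<delta>_def field_simps)
      then have "\<bar>a - b\<bar> < exp (- (ln_const + ln M) / \<epsilon>)" using False by simp
      then have "ln \<bar>a - b\<bar> < - (ln_const + ln M) / \<epsilon>" using ab by (metis ln_exp ln_less_cancel_iff exp_gt_zero zero_less_abs_iff right_minus_eq)
      then have 1: "ln_const + ln M \<le> \<epsilon> * - ln \<bar>a - b\<bar>" using \<epsilon> by (simp add: field_simps)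
      have "ln M \<ge> 0" using M by simp
      then have "\<epsilon> * - ln \<bar>a - b\<bar> \<ge> 0" using 1 c0 by linarith
      then have 2: "- ln \<bar>a - b\<bar> \<ge> 0" using \<epsilon> by (simp add: zero_le_mult_iff mult_le_0_iff)
      have "ln \<bar>a - b\<bar> \<le> ln (M * \<eta>)" using False ab by (intro ln_mono) auto
      also have "\<dots> = ln M + ln \<eta>" using M \<eta> by (intro ln_mult_pos) auto
      finally have "?L \<le> ln_const + ln M - ln \<bar>a - b\<bar>" using integral_smear2_ln_le[of \<eta> a b] \<eta> by linarith
      then show ?thesis using 1 2 \<epsilon> by simp
    qed
  qed
qed

lemma (in compact_law) integral_pair:
  assumes [measurable]: "f \<in> borel_measurable (borel \<Otimes>\<^sub>M borel)"
  shows "(\<integral>q. f q \<partial>(\<nu> \<Otimes>\<^sub>M \<nu>)) = (\<integral>q. p (fst q) * p (snd q) * (f q :: real) \<partial>(lborel \<Otimes>\<^sub>M lborel))"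
proof -
  have "\<nu> \<Otimes>\<^sub>M \<nu> = density (lborel \<Otimes>\<^sub>M lborel) (\<lambda>(x, y). ennreal (p x) * ennreal (p y))"
    unfolding law using sigma_finite_measure_axioms
    by (intro pair_measure_density) (auto simp: law sigma_finite_lborel)
  also have "\<dots> = density (lborel \<Otimes>\<^sub>M lborel) (\<lambda>q. ennreal (p (fst q) * p (snd q)))"
    by (intro density_cong) (auto simp: ennreal_mult p_nonneg)
  finally show ?thesis
    by (simp add: integral_density p_nonneg)
qed

lemma sum_offdiag:
  assumes "finite A"
  shows "(\<Sum>j\<in>A. \<Sum>k\<in>A. f j k) = (\<Sum>j\<in>A. \<Sum>k\<in>A-{j}. f j k) + (\<Sum>j\<in>A. f j j :: real)"
  by (subst sum.distrib[symmetric], rule sum.cong) (auto simp: sum.remove[OF assms])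

lemma compact_law_smeared:
  assumes A: "finite A" "A \<noteq> {}" and R: "\<forall>j\<in>A. \<bar>z j\<bar> \<le> R" and \<eta>: "0 < \<eta>" "\<eta> \<le> 1"
  shows "compact_law (density lborel (\<lambda>x. ennreal ((\<Sum>j\<in>A. smear \<eta> (z j) x) / card A)))
     (\<lambda>x. (\<Sum>j\<in>A. smear \<eta> (z j) x) / card A) (1/\<eta>) (R + 1)"
proof -
  have n: "real (card A) > 0" using A by (simp add: card_gt_0_iff)
  show ?thesis
  proof (intro compact_law.intro compact_law_axioms.intro prob_spaceI)
    have "(\<integral>\<^sup>+x. ennreal ((\<Sum>j\<in>A. smear \<eta> (z j) x) / card A) \<partial>lborel)
       = (\<integral>\<^sup>+x. (\<Sum>j\<in>A. ennreal (1 / card A) * ennreal (smear \<eta> (z j) x)) \<partial>lborel)"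
      using n smear_nonneg[OF \<eta>(1)]
      by (intro nn_integral_cong) (simp add: sum_divide_distrib flip: ennreal_mult' sum_ennreal)
    also have "\<dots> = (\<Sum>j\<in>A. ennreal (1 / card A) * (\<integral>\<^sup>+x. ennreal (smear \<eta> (z j) x) \<partial>lborel))"
      by (simp add: nn_integral_sum nn_integral_cmult)
    also have "\<dots> = ennreal (card A) * ennreal (1 / card A)"
      by (simp add: nn_integral_smear[OF \<eta>(1)] ennreal_of_nat_eq_real_of_nat)
    also have "\<dots> = 1" using n by (simp flip: ennreal_mult)
    finally show "emeasure (density lborel (\<lambda>x. ennreal ((\<Sum>j\<in>A. smear \<eta> (z j) x) / card A)))
      (space (density lborel (\<lambda>x. ennreal ((\<Sum>j\<in>A. smear \<eta> (z j) x) / card A)))) = 1"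
      by (simp add: emeasure_density)
    show "(\<lambda>x. (\<Sum>j\<in>A. smear \<eta> (z j) x) / card A) \<in> borel_measurable borel" by measurable
    show "0 \<le> (\<Sum>j\<in>A. smear \<eta> (z j) x) / card A" for x
      by (intro divide_nonneg_nonneg sum_nonneg smear_nonneg \<eta>) auto
    show "(\<Sum>j\<in>A. smear \<eta> (z j) x) / card A \<le> 1/\<eta>" for x
    proof -
      have "(\<Sum>j\<in>A. smear \<eta> (z j) x) \<le> (\<Sum>j\<in>A. 1/\<eta>)"
        by (intro sum_mono) (use \<eta> in \<open>auto simp: smear_def indicator_def\<close>)
      then show ?thesis using n by (simp add: field_simps)
    qed
    show "(\<Sum>j\<in>A. smear \<eta> (z j) x) / card A = 0" if "R + 1 < \<bar>x\<bar>" for x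
    proof -
      have "smear \<eta> (z j) x = 0" if "j \<in> A" for j
        using R[rule_format, OF that] \<open>R + 1 < \<bar>x\<bar>\<close> \<eta> by (auto simp: smear_def indicator_def)
      then show ?thesis by simp
    qed
  qed simp
qed

lemma continuous_bounded_abs:
  fixes Q :: "real \<Rightarrow> real"
  assumes "continuous_on UNIV Q"
  shows "\<exists>B\<ge>0. \<forall>x. \<bar>x\<bar> \<le> R \<longrightarrow> \<bar>Q x\<bar> \<le> B"
proof -
  have "compact (Q ` {-R..R})"
    by (intro compact_continuous_image continuous_on_subset[OF assms]) auto
  then have "bounded (Q ` {-R..R})" by (rule compact_imp_bounded)
  then obtain B where B: "\<forall>x\<in>Q ` {-R..R}. norm x \<le> B" unfolding bounded_iff by blast
  have "\<bar>Q x\<bar> \<le> max 0 B" if "\<bar>x\<bar> \<le> R" for x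
  proof -
    have "x \<in> {-R..R}" using that by auto
    then have "norm (Q x) \<le> B" using B by blast
    then show ?thesis by simp
  qed
  then show ?thesis by (intro exI[of _ "max 0 B"]) auto
qed

text \<open>The smeared empirical measure has energy at least \<open>I\<close>. Its diagonal terms
  cost at most \<open>K\<close> per point, because \<open>\<eta>\<close> is fixed before the
  configuration. The losses of close pairs are fractions of their energies, so the sum of pair
  energies appears with a factor \<open>1 + \<kappa>\<close>.\<close>

lemma discrete_energy_compact:
  assumes Q: "continuous_on UNIV Q" and R: "R \<ge> 0" and \<epsilon>: "\<epsilon> > 0"
    and min: "\<And>\<nu>. prob_borel \<nu> \<Longrightarrow> ereal I \<le> energy Q \<nu>"
  shows "\<exists>K\<ge>0. \<forall>A z. finite A \<longrightarrow> inj_on z A \<longrightarrow> (\<forall>j\<in>A. \<bar>z j\<bar> \<le> R) \<longrightarrow>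
    real (card A)^2 * (I - \<epsilon>) - K * real (card A) \<le> (\<Sum>j\<in>A. \<Sum>k\<in>A-{j}. pair_energy Q (z j, z (k :: nat)))"
proof -
  have [measurable]: "Q \<in> borel_measurable borel" using Q by (rule borel_measurable_continuous_onI)
  obtain B where B: "B \<ge> 0" "\<And>x. \<bar>x\<bar> \<le> R + 1 \<Longrightarrow> \<bar>Q x\<bar> \<le> B"
    using continuous_bounded_abs[OF Q, of "R + 1"] by blast
  \<comment> \<open>With this constant \<open>pair_energy Q + C'\<close> dominates the positive part
    of the logarithm, so that the logarithmic loss of a close pair becomes a multiple of its
    energy.\<close>
  define C' where "C' = ln (2 * R + 1) + B"
  have C': "C' \<ge> 0" using R B by (simp add: C'_def)
  have pe: "max 0 (- ln \<bar>x - y\<bar>) \<le> pair_energy Q (x, y) + C'" if "x \<noteq> y" "\<bar>x\<bar> \<le> R" "\<bar>y\<bar> \<le> R" for x y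
  proof -
    have "ln \<bar>x - y\<bar> \<le> ln (2 * R + 1)" using that by (intro ln_mono) auto
    moreover have "0 \<le> ln (2 * R + 1)" using R by simp
    moreover have "\<bar>Q x\<bar> \<le> B" "\<bar>Q y\<bar> \<le> B" using that by (auto intro!: B)
    then have "- (B + B) / 2 \<le> (Q x + Q y) / 2" by (intro divide_right_mono) auto
    moreover have "max 0 (- L) \<le> - L + q + (LR + B)" if "L \<le> LR" "0 \<le> LR" "- (B + B) / 2 \<le> q" for L LR q
      using that by (auto simp: max_def)
    ultimately show ?thesis unfolding pair_energy_def C'_def fst_conv snd_conv by blast
  qed
  \<comment> \<open>Splits \<open>\<epsilon>\<close> between the additive loss
    \<open>\<kappa> * (2 + C')\<close> per pair and the loss \<open>\<kappa> * \<bar>I\<bar>\<close>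
    from dividing by \<open>1 + \<kappa>\<close>.\<close>
  define \<kappa> where "\<kappa> = \<epsilon> / (C' + 2 + \<bar>I\<bar>)"
  have \<kappa>: "\<kappa> > 0" using \<epsilon> C' by (simp add: \<kappa>_def add_nonneg_pos add_pos_nonneg)
  have \<kappa>\<epsilon>: "\<kappa> * (C' + 2 + \<bar>I\<bar>) = \<epsilon>" using C' by (simp add: \<kappa>_def add_nonneg_pos add_pos_nonneg)
  obtain \<delta>1 where \<delta>1: "\<delta>1 > 0" "\<And>\<eta> a b. 0 < \<eta> \<Longrightarrow> \<eta> < \<delta>1 \<Longrightarrow> a \<noteq> b \<Longrightarrow>
    (\<integral>q. smear2 \<eta> a b q * - ln \<bar>fst q - snd q\<bar> \<partial>(lborel \<Otimes>\<^sub>M lborel)) \<le> - ln \<bar>a - b\<bar> + \<kappa> + \<kappa> * max 0 (- ln \<bar>a - b\<bar>)"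
    using smear2_ln_le_perturbed[OF \<kappa>] by blast
  have "uniformly_continuous_on {-(R+1)..R+1} Q"
    by (intro compact_uniformly_continuous continuous_on_subset[OF Q]) auto
  then obtain \<delta>2 where \<delta>2: "\<delta>2 > 0" "\<And>x y. \<bar>x\<bar> \<le> R+1 \<Longrightarrow> \<bar>y\<bar> \<le> R+1 \<Longrightarrow> \<bar>x - y\<bar> < \<delta>2 \<Longrightarrow> \<bar>Q x - Q y\<bar> < \<kappa>"
    unfolding uniformly_continuous_on_def using \<kappa> by (auto simp: dist_real_def abs_le_iff)
  define \<eta> where "\<eta> = min 1 (min \<delta>1 \<delta>2) / 2"
  have \<eta>: "\<eta> > 0" "\<eta> \<le> 1" "\<eta> < \<delta>1" "\<eta> < \<delta>2" using \<delta>1 \<delta>2 by (auto simp: \<eta>_def)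
  define K where "K = \<bar>ln_const - ln \<eta>\<bar> + B + \<kappa>"
  have K: "K \<ge> 0" using B \<kappa> by (simp add: K_def)
  have Qs: "Q x \<le> Q a + \<kappa>" if "\<bar>a\<bar> \<le> R" "x \<in> {a..a+\<eta>}" for x a
  proof -
    have "\<bar>x\<bar> \<le> R + 1" "\<bar>a\<bar> \<le> R + 1" "\<bar>x - a\<bar> < \<delta>2" using that \<eta> by auto
    then show ?thesis using \<delta>2(2)[of x a] by linarith
  qed
  define e where "e a b = (\<integral>q. smear2 \<eta> a b q * pair_energy Q q \<partial>(lborel \<Otimes>\<^sub>M lborel))" for a b
  have int_Q: "integrable (lborel \<Otimes>\<^sub>M lborel) (\<lambda>q. smear2 \<eta> a b q * ((Q (fst q) + Q (snd q)) / 2))" if ab: "\<bar>a\<bar> \<le> R" "\<bar>b\<bar> \<le> R" for a b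
  proof (rule integrable_smear2_bounded[where B=B])
    fix x y assume "x \<in> {a..a+\<eta>}" "y \<in> {b..b+\<eta>}"
    then have "\<bar>Q x\<bar> \<le> B" "\<bar>Q y\<bar> \<le> B" using ab \<eta> by (auto intro!: B)
    then show "\<bar>(Q (fst (x, y)) + Q (snd (x, y))) / 2\<bar> \<le> B" by auto
  qed (use \<eta> in auto)
  have split: "smear2 \<eta> a b q * pair_energy Q q = smear2 \<eta> a b q * - ln \<bar>fst q - snd q\<bar> + smear2 \<eta> a b q * ((Q (fst q) + Q (snd q)) / 2)" for a b q
    by (simp add: pair_energy_def algebra_simps)
  have int_e: "integrable (lborel \<Otimes>\<^sub>M lborel) (\<lambda>q. smear2 \<eta> a b q * pair_energy Q q)" if ab: "\<bar>a\<bar> \<le> R" "\<bar>b\<bar> \<le> R" for a b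
    unfolding split using int_Q[OF ab] integrable_smear2_ln[OF \<eta>(1)] by (intro Bochner_Integration.integrable_add) auto
  have e_eq: "e a b \<le> (\<integral>q. smear2 \<eta> a b q * - ln \<bar>fst q - snd q\<bar> \<partial>(lborel \<Otimes>\<^sub>M lborel)) + (Q a + Q b) / 2 + \<kappa>"
    if ab: "\<bar>a\<bar> \<le> R" "\<bar>b\<bar> \<le> R" for a b
  proof -
    have "(\<integral>q. smear2 \<eta> a b q * ((Q (fst q) + Q (snd q)) / 2) \<partial>(lborel \<Otimes>\<^sub>M lborel)) \<le> (Q a + Q b) / 2 + \<kappa>"
    proof (rule integral_smear2_le[OF \<eta>(1) int_Q[OF ab]])
      fix x y assume "x \<in> {a..a+\<eta>}" "y \<in> {b..b+\<eta>}"
      then have "Q x \<le> Q a + \<kappa>" "Q y \<le> Q b + \<kappa>" using ab by (auto intro!: Qs)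
      then show "(Q (fst (x, y)) + Q (snd (x, y))) / 2 \<le> (Q a + Q b) / 2 + \<kappa>"
        unfolding fst_conv snd_conv by (simp add: field_simps)
    qed
    moreover have "e a b = (\<integral>q. smear2 \<eta> a b q * - ln \<bar>fst q - snd q\<bar> \<partial>(lborel \<Otimes>\<^sub>M lborel)) + (\<integral>q. smear2 \<eta> a b q * ((Q (fst q) + Q (snd q)) / 2) \<partial>(lborel \<Otimes>\<^sub>M lborel))"
      unfolding e_def split using int_Q[OF ab] integrable_smear2_ln[OF \<eta>(1)]
      by (intro Bochner_Integration.integral_add) auto
    ultimately show ?thesis by linarith
  qed
  have e_diag: "e a a \<le> K" if a: "\<bar>a\<bar> \<le> R" for a
  proof -
    have "Q a \<le> B" using B(2)[of a] a by auto
    then show ?thesis using e_eq[OF a a] integral_smear2_ln_le[OF \<eta>(1), of a a] by (simp add: K_def)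
  qed
  have e_off: "e a b \<le> (1 + \<kappa>) * pair_energy Q (a, b) + \<kappa> * (2 + C')" if ab: "\<bar>a\<bar> \<le> R" "\<bar>b\<bar> \<le> R" "a \<noteq> b" for a b
  proof -
    have "e a b \<le> - ln \<bar>a - b\<bar> + \<kappa> + \<kappa> * max 0 (- ln \<bar>a - b\<bar>) + (Q a + Q b) / 2 + \<kappa>"
      using e_eq[OF ab(1,2)] \<delta>1(2)[OF \<eta>(1,3) ab(3)] by linarith
    also have "\<dots> \<le> - ln \<bar>a - b\<bar> + \<kappa> + \<kappa> * (pair_energy Q (a, b) + C') + (Q a + Q b) / 2 + \<kappa>"
      using pe[OF ab(3,1,2)] \<kappa> by (simp add: mult_left_mono)
    also have "\<dots> = (1 + \<kappa>) * pair_energy Q (a, b) + \<kappa> * (2 + C')"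
      by (simp add: pair_energy_def algebra_simps add_divide_distrib)
    finally show ?thesis .
  qed
  show ?thesis
  proof (intro exI[of _ K] conjI K allI impI)
    fix A and z :: "nat \<Rightarrow> real"
    assume A: "finite A" and inj: "inj_on z A" and zR: "\<forall>j\<in>A. \<bar>z j\<bar> \<le> R"
    let ?S = "\<Sum>j\<in>A. \<Sum>k\<in>A-{j}. pair_energy Q (z j, z k)"
    let ?n = "real (card A)"
    show "?n^2 * (I - \<epsilon>) - K * ?n \<le> ?S"
    proof (cases "A = {}")
      case False
      let ?p = "\<lambda>x. (\<Sum>j\<in>A. smear \<eta> (z j) x) / card A"
      let ?\<nu> = "density lborel (\<lambda>x. ennreal (?p x))"
      interpret cl: compact_law ?\<nu> ?p "1/\<eta>" "R + 1"
        by (rule compact_law_smeared) (use A False zR \<eta> in auto)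
      have n: "?n \<ge> 1" using A False by (simp add: Suc_leI card_gt_0_iff)
      have "I \<le> (\<integral>q. pair_energy Q q \<partial>(?\<nu> \<Otimes>\<^sub>M ?\<nu>))"
        using min[OF cl.prob_borel_law] cl.energy_law[OF Q] by simp
      also have "\<dots> = (\<integral>q. ?p (fst q) * ?p (snd q) * pair_energy Q q \<partial>(lborel \<Otimes>\<^sub>M lborel))"
        by (intro cl.integral_pair) (simp add: pair_energy_def[abs_def])
      also have "\<dots> = (\<integral>q. (\<Sum>j\<in>A. \<Sum>k\<in>A. smear2 \<eta> (z j) (z k) q * pair_energy Q q) / ?n^2 \<partial>(lborel \<Otimes>\<^sub>M lborel))"
      proof (intro Bochner_Integration.integral_cong refl)
        fix q :: "real \<times> real"
        have "(\<Sum>j\<in>A. smear \<eta> (z j) (fst q)) * (\<Sum>k\<in>A. smear \<eta> (z k) (snd q)) * pair_energy Q q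
          = (\<Sum>j\<in>A. \<Sum>k\<in>A. smear2 \<eta> (z j) (z k) q * pair_energy Q q)"
          by (subst sum_product) (simp only: sum_distrib_right smear2_def)
        then show "?p (fst q) * ?p (snd q) * pair_energy Q q
          = (\<Sum>j\<in>A. \<Sum>k\<in>A. smear2 \<eta> (z j) (z k) q * pair_energy Q q) / ?n^2"
          by (simp add: power2_eq_square)
      qed
      also have "\<dots> = (\<Sum>j\<in>A. \<Sum>k\<in>A. e (z j) (z k)) / ?n^2"
        unfolding e_def using zR by (simp add: int_e)
      finally have "I * ?n^2 \<le> (\<Sum>j\<in>A. \<Sum>k\<in>A. e (z j) (z k))"
        using n by (simp add: field_simps)
      also have "\<dots> = (\<Sum>j\<in>A. \<Sum>k\<in>A-{j}. e (z j) (z k)) + (\<Sum>j\<in>A. e (z j) (z j))"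
        by (rule sum_offdiag[OF A])
      also have "\<dots> \<le> (\<Sum>j\<in>A. \<Sum>k\<in>A-{j}. (1 + \<kappa>) * pair_energy Q (z j, z k) + \<kappa> * (2 + C')) + (\<Sum>j\<in>A. K)"
        using zR inj by (intro add_mono sum_mono e_off e_diag) (auto dest: inj_onD)
      also have "\<dots> = (1 + \<kappa>) * ?S + ?n * (?n - 1) * (\<kappa> * (2 + C')) + ?n * K"
        using n A False
        by (simp add: sum.distrib sum_distrib_left card_Diff_singleton of_nat_diff Suc_leI card_gt_0_iff)
      also have "\<dots> \<le> (1 + \<kappa>) * ?S + ?n^2 * (\<kappa> * (2 + C')) + ?n * K"
        using n \<kappa> C' by (auto intro!: mult_right_mono simp: power2_eq_square)
      finally have main: "?n^2 * (I - \<kappa> * (2 + C')) - ?n * K \<le> (1 + \<kappa>) * ?S" by (simp add: algebra_simps)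
      have "(1 + \<kappa>) * (?n^2 * (I - \<epsilon>) - K * ?n) \<le> ?n^2 * (I - \<kappa> * (2 + C')) - ?n * K"
      proof -
        have "\<kappa> * I \<le> \<kappa> * \<bar>I\<bar>" using \<kappa> by (intro mult_left_mono) auto
        then have "\<kappa> * (I - \<epsilon>) \<le> \<kappa> * \<bar>I\<bar>" using mult_pos_pos[OF \<kappa> \<epsilon>] by (simp add: algebra_simps)
        then have "(1 + \<kappa>) * (I - \<epsilon>) \<le> I - \<kappa> * (2 + C')"
          using \<kappa>\<epsilon> by (simp add: algebra_simps)
        then have "?n^2 * ((1 + \<kappa>) * (I - \<epsilon>)) \<le> ?n^2 * (I - \<kappa> * (2 + C'))" by (intro mult_left_mono) auto
        moreover have "?n * K \<le> (1 + \<kappa>) * (K * ?n)" using \<kappa> K n by (simp add: algebra_simps)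
        ultimately show ?thesis by (simp add: algebra_simps)
      qed
      then have "(1 + \<kappa>) * (?n^2 * (I - \<epsilon>) - K * ?n) \<le> (1 + \<kappa>) * ?S" using main by linarith
      then show ?thesis using \<kappa> by (simp add: mult_le_cancel_left)
    qed simp
  qed
qed

section \<open>The limit of the free energy\<close>

text \<open>Of the three logarithms of growth, two are spent on the interaction through
  \<open>ln (1 + x^2)\<close>; the third makes \<open>reduced\<close> tend to infinity and so
  confines the particles.\<close>

locale log_gas =
  fixes Q :: "real \<Rightarrow> real"
  assumes Q_cont: "continuous_on UNIV Q"
    and Q_growth: "\<exists>R\<ge>1. \<forall>x. R \<le> \<bar>x\<bar> \<longrightarrow> 3 * ln \<bar>x\<bar> \<le> Q x"
begin

lemma Q_measurable [measurable]: "Q \<in> borel_measurable borel"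
  using Q_cont by (rule borel_measurable_continuous_onI)

text \<open>The one-point potential that is left when the repulsion of a pair is divided between its
  points by \<open>(x - y)^2 \<le> (1 + x^2) * (1 + y^2)\<close>.\<close>

definition reduced :: "real \<Rightarrow> real" where
  "reduced x = Q x - ln (1 + x^2)"

lemma reduced_large: "\<exists>R\<ge>0. \<forall>x. R \<le> \<bar>x\<bar> \<longrightarrow> T \<le> reduced x"
proof -
  obtain R where R: "R \<ge> 1" "\<And>x. R \<le> \<bar>x\<bar> \<Longrightarrow> 3 * ln \<bar>x\<bar> \<le> Q x" using Q_growth by blast
  show ?thesis
  proof (intro exI[of _ "max R (exp (T + ln 2))"] conjI allI impI)
    fix x assume x: "max R (exp (T + ln 2)) \<le> \<bar>x\<bar>"
    then have 1: "\<bar>x\<bar> \<ge> 1" using R by linarith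
    then have "1 \<le> x^2" using abs_le_square_iff[of 1 x] by simp
    then have "ln (1 + x^2) \<le> ln (2 * \<bar>x\<bar>^2)" by (intro ln_mono) (auto simp: add_pos_nonneg)
    also have "\<dots> = ln 2 + ln (\<bar>x\<bar>^2)" using 1 by (intro ln_mult_pos) auto
    also have "ln (\<bar>x\<bar>^2) = 2 * ln \<bar>x\<bar>" using 1 by (subst ln_realpow) auto
    finally have "ln \<bar>x\<bar> - ln 2 \<le> reduced x" using R(2)[of x] x by (simp add: reduced_def)
    moreover have "ln (exp (T + ln 2)) \<le> ln \<bar>x\<bar>" using x 1 by (intro ln_mono) auto
    ultimately show "T \<le> reduced x" by simp
  qed (use R in auto)
qed

lemma reduced_bounded_below: "\<exists>m\<ge>0. \<forall>x. - m \<le> reduced x"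
proof -
  obtain R where R: "R \<ge> 0" "\<And>x. R \<le> \<bar>x\<bar> \<Longrightarrow> 0 \<le> reduced x" using reduced_large[of 0] by blast
  have "continuous_on UNIV reduced" unfolding reduced_def[abs_def]
    by (intro continuous_intros Q_cont) (auto simp: add_nonneg_eq_0_iff)
  then obtain B where B: "B \<ge> 0" "\<And>x. \<bar>x\<bar> \<le> R \<Longrightarrow> \<bar>reduced x\<bar> \<le> B" using continuous_bounded_abs by blast
  have "- B \<le> reduced x" for x
    using B(1) B(2)[of x] R(2)[of x] by (cases "\<bar>x\<bar> \<le> R") auto
  then show ?thesis using B by blast
qed

lemma pair_energy_ge_reduced:
  assumes "x \<noteq> y"
  shows "(reduced x + reduced y) / 2 \<le> pair_energy Q (x, y)"
proof -
  have "(1 + x^2) * (1 + y^2) - (x - y)^2 = (1 + x * y)^2" by (simp add: power2_eq_square algebra_simps)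
  then have "\<bar>x - y\<bar>^2 \<le> (1 + x^2) * (1 + y^2)" by (metis diff_ge_0_iff_ge power2_abs zero_le_power2)
  then have "ln (\<bar>x - y\<bar>^2) \<le> ln ((1 + x^2) * (1 + y^2))" using assms by (intro ln_mono) (auto simp: add_pos_nonneg)
  also have "\<dots> = ln (1 + x^2) + ln (1 + y^2)" by (intro ln_mult_pos) (auto simp: add_pos_nonneg)
  also have "ln (\<bar>x - y\<bar>^2) = 2 * ln \<bar>x - y\<bar>" using assms by (subst ln_realpow) auto
  finally show ?thesis by (simp add: pair_energy_def reduced_def field_simps)
qed

definition config_energy :: "nat \<Rightarrow> (nat \<Rightarrow> real) \<Rightarrow> real" where
  "config_energy N z = (\<Sum>j<N. \<Sum>k\<in>{..<N}-{j}. pair_energy Q (z j, z k))"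

text \<open>Pairs with a point outside a large interval cost more than the minimal energy, so only the
  points inside matter.\<close>
lemma config_energy_lower:
  assumes \<epsilon>: "\<epsilon> > 0" and min: "\<And>\<nu>. prob_borel \<nu> \<Longrightarrow> ereal I \<le> energy Q \<nu>"
  shows "\<exists>K. \<forall>N z. inj_on z {..<N} \<longrightarrow> real N^2 * (I - \<epsilon>) - K * real N \<le> config_energy N z"
proof -
  obtain m where m: "m \<ge> 0" "\<And>x. - m \<le> reduced x" using reduced_bounded_below by blast
  \<comment> \<open>The price charged for a pair with a far point. It exceeds \<open>I\<close>, so
    that the coefficient \<open>I - \<epsilon> - M\<close> below is nonpositive.\<close>
  define M where "M = \<bar>I\<bar> + 1"
  \<comment> \<open>The extra \<open>m\<close> compensates a possibly negative value of
    \<open>reduced\<close> at the other point of the pair.\<close>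
  obtain R where R: "R \<ge> 0" "\<And>x. R \<le> \<bar>x\<bar> \<Longrightarrow> 2 * M + m \<le> reduced x" using reduced_large by blast
  have far: "M \<le> pair_energy Q (x, y)" if "x \<noteq> y" "\<not> (\<bar>x\<bar> \<le> R \<and> \<bar>y\<bar> \<le> R)" for x y
    using pair_energy_ge_reduced[OF that(1)] m(2)[of x] m(2)[of y] R(2)[of x] R(2)[of y] that(2)
    by (cases "\<bar>x\<bar> \<le> R") (auto simp: field_simps)
  obtain K where K: "K \<ge> 0" "\<And>A (z :: nat \<Rightarrow> real). finite A \<Longrightarrow> inj_on z A \<Longrightarrow> (\<forall>j\<in>A. \<bar>z j\<bar> \<le> R) \<Longrightarrow>
    real (card A)^2 * (I - \<epsilon>) - K * real (card A) \<le> (\<Sum>j\<in>A. \<Sum>k\<in>A-{j}. pair_energy Q (z j, z k))"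
    using discrete_energy_compact[OF Q_cont R(1) \<epsilon> min] by blast
  show ?thesis
  proof (intro exI[of _ "K + M"] allI impI)
    fix N and z :: "nat \<Rightarrow> real" assume inj: "inj_on z {..<N}"
    define A where "A = {j\<in>{..<N}. \<bar>z j\<bar> \<le> R}"
    define n where "n = real (card A)"
    have A: "finite A" "A \<subseteq> {..<N}" by (auto simp: A_def)
    have nN: "0 \<le> n" "n \<le> N" using card_mono[OF _ A(2)] by (auto simp: n_def)
    have sumconst: "(\<Sum>j\<in>B. \<Sum>k\<in>B-{j}. f j k - M) = (\<Sum>j\<in>B. \<Sum>k\<in>B-{j}. f j k) - M * (real (card B)^2 - real (card B))"
      if "finite B" for B :: "nat set" and f
    proof (cases "B = {}")
      case False
      then have "real (card B - Suc 0) = real (card B) - 1" using that by (simp add: of_nat_diff Suc_leI card_gt_0_iff)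
      then show ?thesis using that by (simp add: sum_subtractf sum.distrib card_Diff_singleton power2_eq_square algebra_simps)
    qed simp
    \<comment> \<open>After subtraction of \<open>M\<close> every term with an index outside
      \<open>A\<close> is nonnegative, so the index set may grow to all pairs.\<close>
    have "(\<Sum>j\<in>A. \<Sum>k\<in>A-{j}. pair_energy Q (z j, z k) - M) \<le> (\<Sum>j\<in>A. \<Sum>k\<in>{..<N}-{j}. pair_energy Q (z j, z k) - M)"
    proof (intro sum_mono sum_mono2)
      fix j k assume jk: "j \<in> A" "k \<in> {..<N} - {j} - (A - {j})"
      then have "z j \<noteq> z k" using inj A(2) by (auto dest!: inj_onD)
      then show "0 \<le> pair_energy Q (z j, z k) - M" using far[of "z j" "z k"] jk by (auto simp: A_def)
    qed (use A in auto)
    also have "\<dots> \<le> (\<Sum>j<N. \<Sum>k\<in>{..<N}-{j}. pair_energy Q (z j, z k) - M)"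
    proof (intro sum_mono2 sum_nonneg)
      fix j k assume jk: "j \<in> {..<N} - A" "k \<in> {..<N} - {j}"
      then have "z j \<noteq> z k" using inj by (auto dest!: inj_onD)
      then show "0 \<le> pair_energy Q (z j, z k) - M" using far[of "z j" "z k"] jk by (auto simp: A_def)
    qed (use A in auto)
    finally have 1: "(\<Sum>j\<in>A. \<Sum>k\<in>A-{j}. pair_energy Q (z j, z k)) - M * (n^2 - n) \<le> config_energy N z - M * (real N^2 - N)"
      unfolding config_energy_def n_def by (simp add: sumconst A)
    have "n^2 * (I - \<epsilon>) - K * n \<le> (\<Sum>j\<in>A. \<Sum>k\<in>A-{j}. pair_energy Q (z j, z k))"
      unfolding n_def using K(2)[OF A(1) inj_on_subset[OF inj A(2)]] by (auto simp: A_def)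
    then have 2: "n^2 * (I - \<epsilon> - M) + M * real N^2 - M * N + M * n - K * n \<le> config_energy N z"
      using 1 by (simp add: algebra_simps)
    \<comment> \<open>The coefficient is nonpositive, so passing from \<open>n\<close> to the larger
      \<open>N\<close> can only lower the bound.\<close>
    have "(real N)^2 * (I - \<epsilon> - M) \<le> n^2 * (I - \<epsilon> - M)"
      using nN \<epsilon> by (intro mult_right_mono_neg power_mono) (auto simp: M_def)
    moreover have "K * n \<le> K * N" using nN K by (intro mult_left_mono) auto
    moreover have "0 \<le> M * n" using nN by (simp add: M_def)
    ultimately show "real N^2 * (I - \<epsilon>) - (K + M) * real N \<le> config_energy N z"
      using 2 by (simp add: algebra_simps)
  qed
qed

lemma integrable_exp_neg: "integrable lborel (\<lambda>x. exp (- Q x))"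
proof -
  obtain m where m: "m \<ge> 0" "\<And>x. - m \<le> reduced x" using reduced_bounded_below by blast
  have "integrable lborel (\<lambda>x. exp m * inverse (1 + x^2) :: real)"
    using integrable_inverse_1_plus_square by (simp add: set_integrable_def einterval_def)
  then show ?thesis
  proof (rule Bochner_Integration.integrable_bound)
    show "AE x in lborel. norm (exp (- Q x)) \<le> norm (exp m * inverse (1 + x\<^sup>2))"
    proof (rule AE_I2)
      fix x :: real
      have p: "1 + x^2 > 0" by (simp add: add_pos_nonneg)
      have "- Q x \<le> m - ln (1 + x^2)" using m(2)[of x] by (simp add: reduced_def)
      then have "exp (- Q x) \<le> exp (m - ln (1 + x^2))" by simp
      also have "\<dots> = exp m * inverse (1 + x^2)" using p by (simp add: exp_diff field_simps)
      finally show "norm (exp (- Q x)) \<le> norm (exp m * inverse (1 + x\<^sup>2))" using p by simp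
    qed
  qed measurable
qed

definition weight :: "nat \<Rightarrow> (nat \<Rightarrow> real) \<Rightarrow> real" where
  "weight N z = (\<Prod>j<N. \<Prod>k\<in>{j<..<N}. (z j - z k)^2) * exp (- real N * (\<Sum>j<N. Q (z j)))"

lemma sum_symmetric_offdiag:
  assumes "\<And>j k. f j k = f k j"
  shows "(\<Sum>j<(N::nat). \<Sum>k\<in>{..<N}-{j}. f j k) = (\<Sum>j<N. \<Sum>k\<in>{j<..<N}. 2 * f j k :: real)"
proof (induction N)
  case (Suc N)
  have 1: "(\<Sum>k\<in>{..<Suc N}-{j}. f j k) = (\<Sum>k\<in>{..<N}-{j}. f j k) + f j N" if "j < N" for j
  proof -
    have "{..<Suc N} - {j} = insert N ({..<N} - {j})" using that by auto
    then show ?thesis by simp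
  qed
  have 2: "(\<Sum>k\<in>{j<..<Suc N}. f j k) = (\<Sum>k\<in>{j<..<N}. f j k) + f j N" if "j < N" for j
  proof -
    have "{j<..<Suc N} = insert N {j<..<N}" using that by auto
    then show ?thesis by simp
  qed
  have 3: "{..<Suc N} - {N} = {..<N}" "{N<..<Suc N} = {}" by auto
  show ?case using Suc.IH assms[of N]
    by (simp add: 1 2 3 sum.distrib flip: sum_distrib_left)
qed simp

text \<open>The ordered pairs use up \<open>N - 1\<close> of the \<open>N\<close> copies of the sum
  of \<open>Q\<close>. The remaining copy supplies an integrable factor \<open>exp (- Q)\<close> in
  each variable. On configurations that are not injective \<open>ln 0 = 0\<close> would give a wrong
  value.\<close>

lemma weight_eq:
  assumes inj: "inj_on z {..<N}"
  shows "weight N z = exp (- config_energy N z - (\<Sum>j<N. Q (z j)))"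
proof -
  have "(\<Prod>j<N. \<Prod>k\<in>{j<..<N}. (z j - z k)^2) = (\<Prod>j<N. \<Prod>k\<in>{j<..<N}. exp (2 * ln \<bar>z j - z k\<bar>))"
  proof (intro prod.cong refl)
    fix j k assume "j \<in> {..<N}" "k \<in> {j<..<N}"
    then have "z j \<noteq> z k" using inj by (auto dest!: inj_onD)
    then have "exp (2 * ln \<bar>z j - z k\<bar>) = \<bar>z j - z k\<bar>^2" by (simp add: exp_of_nat_mult[of 2, simplified])
    then show "(z j - z k)^2 = exp (2 * ln \<bar>z j - z k\<bar>)" by simp
  qed
  also have "\<dots> = exp (\<Sum>j<N. \<Sum>k\<in>{j<..<N}. 2 * ln \<bar>z j - z k\<bar>)" by (simp add: exp_sum)
  also have "(\<Sum>j<N. \<Sum>k\<in>{j<..<N}. 2 * ln \<bar>z j - z k\<bar>) = (\<Sum>j<N. \<Sum>k\<in>{..<N}-{j}. ln \<bar>z j - z k\<bar>)"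
    by (rule sum_symmetric_offdiag[symmetric]) (simp add: abs_minus_commute)
  finally have 1: "weight N z = exp ((\<Sum>j<N. \<Sum>k\<in>{..<N}-{j}. ln \<bar>z j - z k\<bar>) - real N * (\<Sum>j<N. Q (z j)))"
    unfolding weight_def by (simp add: mult_exp_exp)
  have row: "(\<Sum>k\<in>{..<N}-{j}. Q (z k)) = (\<Sum>k<N. Q (z k)) - Q (z j)" if "j < N" for j
    using that by (subst sum_diff1) auto
  have "(\<Sum>j<N. \<Sum>k\<in>{..<N}-{j}. (Q (z j) + Q (z k)) / 2) = (real N - 1) * (\<Sum>j<N. Q (z j))"
  proof -
    have row2: "(\<Sum>k\<in>{..<N}-{j}. (Q (z j) + Q (z k)) / 2) = ((real N - 2) * Q (z j) + (\<Sum>k<N. Q (z k))) / 2" if "j < N" for j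
    proof -
      have "real (card ({..<N} - {j})) = real N - 1" using that by (simp add: card_Diff_singleton of_nat_diff Suc_leI)
      then show ?thesis
        by (simp only: sum_divide_distrib[symmetric] sum.distrib sum_constant row[OF that]) (simp add: field_simps)
    qed
    have "(\<Sum>j<N. \<Sum>k\<in>{..<N}-{j}. (Q (z j) + Q (z k)) / 2) = (\<Sum>j<N. ((real N - 2) * Q (z j) + (\<Sum>k<N. Q (z k))) / 2)"
      by (intro sum.cong refl row2) simp
    also have "\<dots> = (real N - 1) * (\<Sum>j<N. Q (z j))"
      by (simp add: sum_divide_distrib[symmetric] sum.distrib sum_subtractf sum_distrib_left[symmetric] algebra_simps add_divide_distrib diff_divide_distrib)
    finally show ?thesis .
  qed
  then have "config_energy N z = (real N - 1) * (\<Sum>j<N. Q (z j)) - (\<Sum>j<N. \<Sum>k\<in>{..<N}-{j}. ln \<bar>z j - z k\<bar>)"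
    unfolding config_energy_def pair_energy_def by (simp add: sum_subtractf sum.distrib sum_negf)
  then show ?thesis unfolding 1 by (simp add: algebra_simps)
qed

lemma weight_eq_0: "\<not> inj_on z {..<N} \<Longrightarrow> weight N z = 0"
proof -
  assume "\<not> inj_on z {..<N}"
  then obtain j k where "j < N" "k < N" "j \<noteq> k" "z j = z k" by (auto simp: inj_on_def)
  then obtain j k where "j < k" "k < N" "z j = z k" by (metis nat_neq_iff)
  then have "\<exists>k\<in>{j<..<N}. (z j - z k)^2 = 0" by force
  then have "(\<Prod>k\<in>{j<..<N}. (z j - z k)^2) = 0" by (intro prod_zero) auto
  then have "\<exists>j\<in>{..<N}. (\<Prod>k\<in>{j<..<N}. (z j - z k)^2) = 0" using \<open>j < k\<close> \<open>k < N\<close> by force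
  then have "(\<Prod>j<N. \<Prod>k\<in>{j<..<N}. (z j - z k)^2) = 0" by (intro prod_zero) auto
  then show ?thesis unfolding weight_def by simp
qed

lemma weight_nonneg: "0 \<le> weight N z"
  unfolding weight_def by (intro mult_nonneg_nonneg prod_nonneg) auto

lemma weight_measurable [measurable]: "weight N \<in> borel_measurable (PiM {..<N} (\<lambda>_. borel))"
  unfolding weight_def by measurable

text \<open>On injective configurations the energy factor is bounded by a constant; the left-over
  factors \<open>exp (- Q)\<close> integrate to an \<open>N\<close>-th power, which is only linear
  in \<open>N\<close> in the exponent.\<close>

lemma
  assumes \<epsilon>: "\<epsilon> > 0" and min: "\<And>\<nu>. prob_borel \<nu> \<Longrightarrow> ereal I \<le> energy Q \<nu>"
  shows integrable_weight: "integrable (PiM {..<N} (\<lambda>_. lborel)) (weight N)"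
    and integral_weight_le: "\<exists>K. \<forall>N. (\<integral>z. weight N z \<partial>PiM {..<N} (\<lambda>_. lborel)) \<le> exp (- (real N^2 * (I - \<epsilon>)) + K * real N)"
proof -
  interpret product_sigma_finite "\<lambda>_::nat. lborel :: real measure" ..
  obtain K where K: "\<And>N z. inj_on z {..<N} \<Longrightarrow> real N^2 * (I - \<epsilon>) - K * real N \<le> config_energy N z"
    using config_energy_lower[OF \<epsilon> min] by blast
  have bound: "weight N z \<le> exp (- (real N^2 * (I - \<epsilon>)) + K * real N) * (\<Prod>j<N. exp (- Q (z j)))" for N z
  proof (cases "inj_on z {..<N}")
    case True
    have "weight N z = exp (- config_energy N z) * (\<Prod>j<N. exp (- Q (z j)))"
      by (simp add: weight_eq[OF True] mult_exp_exp sum_negf flip: exp_sum)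
    also have "\<dots> \<le> exp (- (real N^2 * (I - \<epsilon>)) + K * real N) * (\<Prod>j<N. exp (- Q (z j)))"
      using K[OF True] by (intro mult_right_mono prod_nonneg) auto
    finally show ?thesis .
  qed (auto simp: weight_eq_0 intro!: mult_nonneg_nonneg prod_nonneg)
  have intp: "integrable (PiM {..<N} (\<lambda>_. lborel)) (\<lambda>z. exp (- (real N^2 * (I - \<epsilon>)) + K * real N) * (\<Prod>j<N. exp (- Q (z j))))" for N
    by (intro integrable_mult_right product_integrable_prod integrable_exp_neg) auto
  show int: "integrable (PiM {..<N} (\<lambda>_. lborel)) (weight N)" for N
  proof (rule Bochner_Integration.integrable_bound[OF intp])
    show "AE z in PiM {..<N} (\<lambda>_. lborel). norm (weight N z) \<le> norm (exp (- (real N^2 * (I - \<epsilon>)) + K * real N) * (\<Prod>j<N. exp (- Q (z j))))"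
      using bound[of N] by (auto simp: weight_nonneg abs_mult abs_prod)
    have "sets (PiM {..<N} (\<lambda>_. lborel)) = sets (PiM {..<N} (\<lambda>_. borel :: real measure))" by (intro sets_PiM_cong) auto
    then show "weight N \<in> borel_measurable (PiM {..<N} (\<lambda>_. lborel))" using weight_measurable[of N] measurable_cong_sets by blast
  qed
  \<comment> \<open>The summand \<open>1\<close> makes the base positive, so that its power can be
    written as an exponential.\<close>
  define c where "c = 1 + (\<integral>x. exp (- Q x) \<partial>lborel)"
  have c: "c \<ge> 1" by (simp add: c_def)
  have "(\<integral>z. weight N z \<partial>PiM {..<N} (\<lambda>_. lborel)) \<le> exp (- (real N^2 * (I - \<epsilon>)) + (K + ln c) * real N)" for N
  proof -
    have "(\<integral>z. weight N z \<partial>PiM {..<N} (\<lambda>_. lborel)) \<le> (\<integral>z. exp (- (real N^2 * (I - \<epsilon>)) + K * real N) * (\<Prod>j<N. exp (- Q (z j))) \<partial>PiM {..<N} (\<lambda>_. lborel))"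
      by (intro integral_mono int intp bound)
    also have "\<dots> = exp (- (real N^2 * (I - \<epsilon>)) + K * real N) * (\<integral>x. exp (- Q x) \<partial>lborel) ^ N"
      using product_integral_prod[of "{..<N}" "\<lambda>_ x. exp (- Q x)"] integrable_exp_neg by simp
    also have "\<dots> \<le> exp (- (real N^2 * (I - \<epsilon>)) + K * real N) * c ^ N"
      by (intro mult_left_mono power_mono) (auto simp: c_def)
    also have "c ^ N = exp (ln c * N)" using c by (simp add: mult.commute exp_of_nat_mult)
    finally show ?thesis by (simp add: mult_exp_exp algebra_simps)
  qed
  then show "\<exists>K. \<forall>N. (\<integral>z. weight N z \<partial>PiM {..<N} (\<lambda>_. lborel)) \<le> exp (- (real N^2 * (I - \<epsilon>)) + K * real N)" by blast
qed

end

section \<open>Products of copies of a law\<close>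

lemma PiM_borel_cong: "sets M = sets borel \<Longrightarrow> sets (PiM S (\<lambda>_. M)) = sets (PiM S (\<lambda>_. borel))"
  by (intro sets_PiM_cong) auto

context compact_law begin

lemma product_prob_space_law: "product_prob_space (\<lambda>_. \<nu>)" ..

lemma PiM_law:
  "PiM {..<N} (\<lambda>_. \<nu>) = density (PiM {..<N} (\<lambda>_. lborel)) (\<lambda>z. ennreal (\<Prod>j<(N::nat). p (z j)))"
proof -
  interpret P: product_prob_space "\<lambda>_::nat. \<nu>" by (rule product_prob_space_law)
  interpret L: product_sigma_finite "\<lambda>_::nat. lborel :: real measure" ..
  show ?thesis
  proof (rule P.PiM_eqI[symmetric])
    show "sets (density (PiM {..<N} (\<lambda>_. lborel)) (\<lambda>z. ennreal (\<Prod>j<N. p (z j)))) = sets (PiM {..<N} (\<lambda>_. \<nu>))"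
      using PiM_borel_cong[of lborel "{..<N}"] PiM_borel_cong[of \<nu> "{..<N}"] by simp
    fix B :: "nat \<Rightarrow> real set" assume B: "\<And>i. i \<in> {..<N} \<Longrightarrow> B i \<in> sets \<nu>"
    have [measurable]: "i < N \<Longrightarrow> B i \<in> sets borel" for i using B by auto
    have meas: "(\<lambda>z. ennreal (\<Prod>j<N. p (z j))) \<in> borel_measurable (PiM {..<N} (\<lambda>_. lborel))"
      by measurable
    have "emeasure (density (PiM {..<N} (\<lambda>_. lborel)) (\<lambda>z. ennreal (\<Prod>j<N. p (z j)))) (Pi\<^sub>E {..<N} B)
      = (\<integral>\<^sup>+z. ennreal (\<Prod>j<N. p (z j)) * indicator (Pi\<^sub>E {..<N} B) z \<partial>PiM {..<N} (\<lambda>_. lborel))"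
      using B by (intro emeasure_density meas sets_PiM_I_finite) auto
    also have "\<dots> = (\<integral>\<^sup>+z. (\<Prod>j<N. ennreal (p (z j)) * indicator (B j) (z j)) \<partial>PiM {..<N} (\<lambda>_. lborel))"
    proof (intro nn_integral_cong)
      fix z :: "nat \<Rightarrow> real" assume "z \<in> space (PiM {..<N} (\<lambda>_. lborel))"
      then have z: "z \<in> extensional {..<N}" by (simp add: space_PiM PiE_def)
      have "indicator (Pi\<^sub>E {..<N} B) z = (\<Prod>j<N. indicator (B j) (z j) :: ennreal)"
      proof (cases "z \<in> Pi\<^sub>E {..<N} B")
        case True
        have "(\<Prod>j<N. indicator (B j) (z j) :: ennreal) = 1"
          using PiE_mem[OF True] by (intro prod.neutral ballI) simp
        then show ?thesis using True by simp
      next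
        case False
        then obtain j where j: "j < N" "z j \<notin> B j" using z by (auto simp: PiE_iff)
        have "(\<Prod>j<N. indicator (B j) (z j) :: ennreal) = 0"
          by (intro prod_zero bexI[of _ j]) (use j in simp_all)
        then show ?thesis using False by simp
      qed
      moreover have "ennreal (\<Prod>j<N. p (z j)) = (\<Prod>j<N. ennreal (p (z j)))"
        by (intro prod_ennreal[symmetric] p_nonneg)
      ultimately show "ennreal (\<Prod>j<N. p (z j)) * indicator (Pi\<^sub>E {..<N} B) z = (\<Prod>j<N. ennreal (p (z j)) * indicator (B j) (z j))"
        by (simp only: prod.distrib)
    qed
    also have "\<dots> = (\<Prod>j<N. \<integral>\<^sup>+x. ennreal (p x) * indicator (B j) x \<partial>lborel)"
      by (rule L.product_nn_integral_prod) auto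
    also have "\<dots> = (\<Prod>j\<in>{..<N}. emeasure \<nu> (B j))"
      unfolding law by (intro prod.cong refl emeasure_density[symmetric]) auto
    finally show "emeasure (density (PiM {..<N} (\<lambda>_. lborel)) (\<lambda>z. ennreal (\<Prod>j<N. p (z j)))) (Pi\<^sub>E {..<N} B) = (\<Prod>j\<in>{..<N}. emeasure \<nu> (B j))" .
  qed simp
qed

lemma distr_PiM_pair:
  assumes jk: "j < (N::nat)" "k < N" "j \<noteq> k"
  shows "distr (PiM {..<N} (\<lambda>_. \<nu>)) (\<nu> \<Otimes>\<^sub>M \<nu>) (\<lambda>z. (z j, z k)) = \<nu> \<Otimes>\<^sub>M \<nu>"
proof -
  interpret P: product_prob_space "\<lambda>_::nat. \<nu>" by (rule product_prob_space_law)
  have meas: "(\<lambda>z. (z j, z k)) \<in> measurable (PiM {..<N} (\<lambda>_. \<nu>)) (\<nu> \<Otimes>\<^sub>M \<nu>)"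
    using jk by (intro measurable_Pair measurable_component_singleton) auto
  show ?thesis
  proof (rule pair_measure_eqI[symmetric])
    fix X Y assume XY: "X \<in> sets \<nu>" "Y \<in> sets \<nu>"
    define F where "F i = (if i = j then X else if i = k then Y else UNIV)" for i
    have F: "F i \<in> sets \<nu>" for i using XY by (auto simp: F_def)
    have "emeasure (distr (PiM {..<N} (\<lambda>_. \<nu>)) (\<nu> \<Otimes>\<^sub>M \<nu>) (\<lambda>z. (z j, z k))) (X \<times> Y)
      = emeasure (PiM {..<N} (\<lambda>_. \<nu>)) ((\<lambda>z. (z j, z k)) -` (X \<times> Y) \<inter> space (PiM {..<N} (\<lambda>_. \<nu>)))"
      using XY by (intro emeasure_distr meas) auto
    also have "(\<lambda>z. (z j, z k)) -` (X \<times> Y) \<inter> space (PiM {..<N} (\<lambda>_. \<nu>)) = Pi\<^sub>E {..<N} F"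
      using jk by (auto simp: space_PiM F_def PiE_def Pi_def split: if_splits)
    also have "emeasure (PiM {..<N} (\<lambda>_. \<nu>)) (Pi\<^sub>E {..<N} F) = (\<Prod>i<N. emeasure \<nu> (F i))"
      by (rule P.emeasure_PiM) (use F in auto)
    also have "\<dots> = emeasure \<nu> (F j) * (emeasure \<nu> (F k) * (\<Prod>i\<in>{..<N}-{j}-{k}. emeasure \<nu> (F i)))"
      using jk by (simp add: prod.remove[of _ j] prod.remove[of _ k])
    also have "(\<Prod>i\<in>{..<N}-{j}-{k}. emeasure \<nu> (F i)) = 1"
      by (rule prod.neutral) (auto simp: F_def emeasure_space_1[simplified])
    finally show "emeasure \<nu> X * emeasure \<nu> Y = emeasure (distr (PiM {..<N} (\<lambda>_. \<nu>)) (\<nu> \<Otimes>\<^sub>M \<nu>) (\<lambda>z. (z j, z k))) (X \<times> Y)"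
      using jk by (simp add: F_def)
  qed (auto intro: sigma_finite_measure_axioms)
qed

lemma distr_PiM_single:
  assumes "j < (N::nat)"
  shows "distr (PiM {..<N} (\<lambda>_. \<nu>)) \<nu> (\<lambda>z. z j) = \<nu>"
  by (rule distr_PiM_component) (use assms prob_space_axioms in auto)

lemma
  fixes f :: "real \<times> real \<Rightarrow> real"
  assumes jk: "j < (N::nat)" "k < N" "j \<noteq> k" and f: "integrable (\<nu> \<Otimes>\<^sub>M \<nu>) f"
  shows integrable_PiM_pair: "integrable (PiM {..<N} (\<lambda>_. \<nu>)) (\<lambda>z. f (z j, z k))"
    and integral_PiM_pair: "(\<integral>z. f (z j, z k) \<partial>PiM {..<N} (\<lambda>_. \<nu>)) = (\<integral>q. f q \<partial>(\<nu> \<Otimes>\<^sub>M \<nu>))"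
proof -
  have meas: "(\<lambda>z. (z j, z k)) \<in> measurable (PiM {..<N} (\<lambda>_. \<nu>)) (\<nu> \<Otimes>\<^sub>M \<nu>)"
    using jk by (intro measurable_Pair measurable_component_singleton) auto
  have fm: "f \<in> borel_measurable (\<nu> \<Otimes>\<^sub>M \<nu>)" using f by auto
  show "integrable (PiM {..<N} (\<lambda>_. \<nu>)) (\<lambda>z. f (z j, z k))"
    using integrable_distr_eq[OF meas fm] f distr_PiM_pair[OF jk] by simp
  show "(\<integral>z. f (z j, z k) \<partial>PiM {..<N} (\<lambda>_. \<nu>)) = (\<integral>q. f q \<partial>(\<nu> \<Otimes>\<^sub>M \<nu>))"
    using integral_distr[OF meas fm] distr_PiM_pair[OF jk] by simp
qed

lemma
  fixes f :: "real \<Rightarrow> real"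
  assumes j: "j < (N::nat)" and f: "integrable \<nu> f"
  shows integrable_PiM_single: "integrable (PiM {..<N} (\<lambda>_. \<nu>)) (\<lambda>z. f (z j))"
    and integral_PiM_single: "(\<integral>z. f (z j) \<partial>PiM {..<N} (\<lambda>_. \<nu>)) = (\<integral>x. f x \<partial>\<nu>)"
proof -
  have meas: "(\<lambda>z. z j) \<in> measurable (PiM {..<N} (\<lambda>_. \<nu>)) \<nu>"
    using j by (intro measurable_component_singleton) auto
  have fm: "f \<in> borel_measurable \<nu>" using f by (rule borel_measurable_integrable)
  show "integrable (PiM {..<N} (\<lambda>_. \<nu>)) (\<lambda>z. f (z j))"
    using integrable_distr_eq[OF meas fm] f distr_PiM_single[OF j] by simp
  show "(\<integral>z. f (z j) \<partial>PiM {..<N} (\<lambda>_. \<nu>)) = (\<integral>x. f x \<partial>\<nu>)"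
    using integral_distr[OF meas fm] distr_PiM_single[OF j] by simp
qed

text \<open>Finiteness of the entropy: \<open>p * ln p\<close> is bounded, from below because
  \<open>- (t * ln t) \<le> 1\<close> for \<open>t > 0\<close> and from above because
  \<open>p \<le> C\<close>, and it vanishes outside a bounded interval. At zeros of \<open>p\<close>
  the value \<open>ln 0 = 0\<close> is multiplied by zero.\<close>

lemma integrable_ln_density: "integrable \<nu> (\<lambda>x. ln (p x))"
proof -
  have b: "\<bar>p x * ln (p x)\<bar> \<le> 1 + C * \<bar>ln C\<bar>" for x
  proof (cases "p x = 0")
    case True then show ?thesis using C_nonneg by simp
  next
    case False
    then have px: "p x > 0" using p_nonneg[of x] by simp
    have "ln (inverse (p x)) \<le> inverse (p x) - 1" using px by (intro ln_le_minus_one) auto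
    then have "p x * (- ln (p x)) \<le> p x * (inverse (p x) - 1)" using px by (intro mult_left_mono) (auto simp: ln_inverse)
    also have "\<dots> \<le> 1" using px by (simp add: algebra_simps)
    finally have 1: "- (p x * ln (p x)) \<le> 1" by simp
    have "ln (p x) \<le> \<bar>ln C\<bar>" using px p_le[of x] by (smt (verit) ln_le_cancel_iff)
    then have "p x * ln (p x) \<le> p x * \<bar>ln C\<bar>" using px by (intro mult_left_mono) auto
    also have "\<dots> \<le> C * \<bar>ln C\<bar>" using p_le by (intro mult_right_mono) auto
    finally show ?thesis using 1 C_nonneg by (simp add: abs_le_iff add_increasing add_increasing2)
  qed
  have "integrable lborel (\<lambda>x. indicator {-A..A} x *\<^sub>R (1 + C * \<bar>ln C\<bar>))"
    by (intro integrable_scaleR_left integrable_real_indicator) (auto simp: emeasure_lborel_Icc_eq)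
  then have "integrable lborel (\<lambda>x. p x * ln (p x))"
  proof (rule Bochner_Integration.integrable_bound)
    show "AE x in lborel. norm (p x * ln (p x)) \<le> norm (indicator {-A..A} x *\<^sub>R (1 + C * \<bar>ln C\<bar>))"
    proof (rule AE_I2)
      fix x
      show "norm (p x * ln (p x)) \<le> norm (indicator {-A..A} x *\<^sub>R (1 + C * \<bar>ln C\<bar>))"
        using b[of x] p_out[of x] by (cases "\<bar>x\<bar> \<le> A") (auto simp: indicator_def)
    qed
  qed measurable
  then show ?thesis unfolding law by (subst integrable_density) (auto simp: p_nonneg)
qed

lemma integrable_continuous:
  assumes "continuous_on UNIV f" shows "integrable \<nu> (f :: real \<Rightarrow> real)"
proof -
  obtain B where "\<forall>x. \<bar>x\<bar> \<le> A \<longrightarrow> \<bar>f x\<bar> \<le> B" using continuous_bounded_abs[OF assms] by blast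
  then show ?thesis
    by (intro integrable_bounded[where B=B] borel_measurable_continuous_onI assms) auto
qed

end

section \<open>Jensen's inequality and the limit of the free energy\<close>

locale equilibrium_gas = log_gas Q + compact_law \<nu> p C A
  for Q \<nu> p C A +
  assumes equilibrium: "is_eq_measure Q \<nu>"
begin

definition min_energy :: real where
  "min_energy = (\<integral>q. pair_energy Q q \<partial>(\<nu> \<Otimes>\<^sub>M \<nu>))"

lemma min_energy_le: "prob_borel \<mu> \<Longrightarrow> ereal min_energy \<le> energy Q \<mu>"
  using equilibrium energy_law[OF Q_cont] by (simp add: is_eq_measure_def min_energy_def)

text \<open>The weight divided by the product density is \<open>exp (- X)\<close>, where the mean of
  \<open>X\<close> consists of \<open>N * (N - 1)\<close> pair energies and \<open>N\<close>
  one-point terms. The entropy therefore enters at lower order.\<close>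

lemma integral_weight_ge:
  "exp (- (real N * (real N - 1) * min_energy + real N * ((\<integral>x. Q x \<partial>\<nu>) + (\<integral>x. ln (p x) \<partial>\<nu>))))
    \<le> (\<integral>z. weight N z \<partial>PiM {..<N} (\<lambda>_. lborel))"
proof -
  let ?P = "PiM {..<N} (\<lambda>_. \<nu>)" and ?L = "PiM {..<N} (\<lambda>_. lborel)"
  interpret P: product_prob_space "\<lambda>_::nat. \<nu>" by (rule product_prob_space_law)
  interpret PN: prob_space ?P by (intro prob_space_PiM prob_space_axioms)
  define X where "X z = config_energy N z + (\<Sum>j<N. Q (z j)) + (\<Sum>j<N. ln (p (z j)))" for z
  \<comment> \<open>Division by zero makes this \<open>0\<close> where the product density vanishes.
    Multiplying back thus gives at most the weight, which is the direction needed at the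
    end.\<close>
  define Y where "Y z = weight N z / (\<Prod>j<N. p (z j))" for z
  define m where "m = real N * (real N - 1) * min_energy + real N * ((\<integral>x. Q x \<partial>\<nu>) + (\<integral>x. ln (p x) \<partial>\<nu>))"
  note ints = integrable_PiM_pair[OF _ _ _ integrable_pair_energy[OF Q_cont]]
     integrable_PiM_single[OF _ integrable_continuous[OF Q_cont]] integrable_PiM_single[OF _ integrable_ln_density]
  have i1: "integrable ?P (\<lambda>z. \<Sum>j<N. \<Sum>k\<in>{..<N}-{j}. pair_energy Q (z j, z k))"
    and i2: "integrable ?P (\<lambda>z. \<Sum>j<N. Q (z j))" and i3: "integrable ?P (\<lambda>z. \<Sum>j<N. ln (p (z j)))"
    by (intro Bochner_Integration.integrable_sum ints; auto)+
  have intX: "integrable ?P X"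
    unfolding X_def[abs_def] config_energy_def
    by (intro Bochner_Integration.integrable_add i1 i2 i3)
  have "(\<integral>z. X z \<partial>?P) = (\<integral>z. (\<Sum>j<N. \<Sum>k\<in>{..<N}-{j}. pair_energy Q (z j, z k)) \<partial>?P)
      + (\<integral>z. (\<Sum>j<N. Q (z j)) \<partial>?P) + (\<integral>z. (\<Sum>j<N. ln (p (z j))) \<partial>?P)"
    unfolding X_def[abs_def] config_energy_def
    using i1 i2 i3 by (simp add: Bochner_Integration.integral_add Bochner_Integration.integrable_add del: Bochner_Integration.integral_sum)
  also have "(\<integral>z. (\<Sum>j<N. \<Sum>k\<in>{..<N}-{j}. pair_energy Q (z j, z k)) \<partial>?P)
      = (\<Sum>j<N. \<integral>z. (\<Sum>k\<in>{..<N}-{j}. pair_energy Q (z j, z k)) \<partial>?P)"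
    by (intro Bochner_Integration.integral_sum Bochner_Integration.integrable_sum ints) auto
  also have "\<dots> = (\<Sum>j<N. \<Sum>k\<in>{..<N}-{j}. \<integral>z. pair_energy Q (z j, z k) \<partial>?P)"
    by (intro sum.cong refl Bochner_Integration.integral_sum ints) auto
  also have "\<dots> = (\<Sum>j<N. \<Sum>k\<in>{..<N}-{j}. min_energy)"
    unfolding min_energy_def
    by (intro sum.cong refl integral_PiM_pair integrable_pair_energy Q_cont) auto
  also have "(\<integral>z. (\<Sum>j<N. Q (z j)) \<partial>?P) = (\<Sum>j<N. \<integral>z. Q (z j) \<partial>?P)"
    by (intro Bochner_Integration.integral_sum ints) auto
  also have "\<dots> = (\<Sum>j<N. \<integral>x. Q x \<partial>\<nu>)"
    by (intro sum.cong refl integral_PiM_single integrable_continuous Q_cont) auto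
  also have "(\<integral>z. (\<Sum>j<N. ln (p (z j))) \<partial>?P) = (\<Sum>j<N. \<integral>z. ln (p (z j)) \<partial>?P)"
    by (intro Bochner_Integration.integral_sum ints) auto
  also have "\<dots> = (\<Sum>j<N. \<integral>x. ln (p x) \<partial>\<nu>)"
    by (intro sum.cong refl integral_PiM_single[where f="\<lambda>x. ln (p x)"] integrable_ln_density) auto
  finally have "(\<integral>z. X z \<partial>?P) = (\<Sum>j<N. \<Sum>k\<in>{..<N}-{j}. min_energy) + (\<Sum>j<N. \<integral>x. Q x \<partial>\<nu>) + (\<Sum>j<N. \<integral>x. ln (p x) \<partial>\<nu>)" .
  also have "\<dots> = m"
    by (cases "N = 0") (simp_all add: m_def card_Diff_singleton of_nat_diff Suc_leI algebra_simps)
  finally have EX: "(\<integral>z. X z \<partial>?P) = m" .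
  have [measurable]: "weight N \<in> borel_measurable ?L"
    by (subst measurable_cong_sets[OF PiM_borel_cong[of lborel] refl]) auto
  have [measurable]: "(\<lambda>z. \<Prod>j<N. p (z j)) \<in> borel_measurable ?L" by measurable
  have [measurable]: "Y \<in> borel_measurable ?L" unfolding Y_def[abs_def] by measurable
  have pY: "(\<Prod>j<N. p (z j)) * Y z \<le> weight N z" "0 \<le> (\<Prod>j<N. p (z j)) * Y z" for z
    by (auto simp: Y_def weight_nonneg)
  have intW: "integrable ?L (weight N)" by (rule integrable_weight[OF zero_less_one min_energy_le])
  have intpY: "integrable ?L (\<lambda>z. (\<Prod>j<N. p (z j)) * Y z)"
  proof (rule Bochner_Integration.integrable_bound[OF intW])
    show "AE z in ?L. norm ((\<Prod>j<N. p (z j)) * Y z) \<le> norm (weight N z)"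
    proof (rule AE_I2)
      fix z show "norm ((\<Prod>j<N. p (z j)) * Y z) \<le> norm (weight N z)" using pY[of z] weight_nonneg[of N z] unfolding real_norm_def by linarith
    qed
  qed measurable
  have p0: "0 \<le> (\<Prod>j<N. p (z j))" for z by (intro prod_nonneg) (auto simp: p_nonneg)
  have intY: "integrable ?P Y" unfolding PiM_law by (subst integrable_density) (auto simp: p0 intpY)
  have ae1: "AE z in ?P. \<forall>j\<in>{..<N}. 0 < p (z j)"
  proof (rule eventually_ball_finite[OF finite_lessThan], rule ballI)
    fix j assume j: "j \<in> {..<N}"
    have "AE x in \<nu>. 0 < p x" unfolding law by (subst AE_density) (auto simp: ennreal_less_zero_iff)
    then show "AE z in ?P. 0 < p (z j)"
      using j by (intro AE_PiM_component prob_space_axioms)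
  qed
  have ae2: "AE z in ?P. \<forall>j\<in>{..<N}. \<forall>k\<in>{..<N}-{j}. z j \<noteq> z k"
  proof (rule eventually_ball_finite[OF finite_lessThan], rule ballI, rule eventually_ball_finite, simp, rule ballI)
    fix j k assume jk: "j \<in> {..<N}" "k \<in> {..<N} - {j}"
    have meas: "(\<lambda>z. (z j, z k)) \<in> measurable ?P (\<nu> \<Otimes>\<^sub>M \<nu>)"
      using jk by (intro measurable_Pair measurable_component_singleton) auto
    have "AE q in distr ?P (\<nu> \<Otimes>\<^sub>M \<nu>) (\<lambda>z. (z j, z k)). fst q \<noteq> snd q"
      using AE_off_diagonal jk by (subst distr_PiM_pair) auto
    from AE_distrD[OF meas this] show "AE z in ?P. z j \<noteq> z k" by simp
  qed
  \<comment> \<open>Jensen through the tangent of the exponential at the mean: the tangent has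
    expectation exactly \<open>exp (- m)\<close>.\<close>
  have "exp (- m) = (\<integral>z. exp (- m) * (1 + m - X z) \<partial>?P)"
    using intX EX by (simp add: PN.prob_space)
  also have "\<dots> \<le> (\<integral>z. Y z \<partial>?P)"
  proof (rule integral_mono_AE)
    show "AE z in ?P. exp (- m) * (1 + m - X z) \<le> Y z"
      using ae1 ae2
    proof eventually_elim
      case (elim z)
      then have inj: "inj_on z {..<N}" by (auto simp: inj_on_def)
      have "(\<Prod>j<N. p (z j)) = exp (\<Sum>j<N. ln (p (z j)))" using elim by (simp add: exp_sum)
      then have "Y z = exp (- X z)" unfolding Y_def X_def weight_eq[OF inj] by (simp flip: exp_diff)
      also have "\<dots> = exp (- m) * exp (m - X z)" by (simp add: mult_exp_exp)
      also have "\<dots> \<ge> exp (- m) * (1 + m - X z)"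
      proof (rule mult_left_mono)
        show "1 + m - X z \<le> exp (m - X z)" using exp_ge_add_one_self[of "m - X z"] by linarith
      qed simp
      finally show ?case .
    qed
  qed (use intX intY in auto)
  also have "\<dots> = (\<integral>z. (\<Prod>j<N. p (z j)) * Y z \<partial>?L)"
    unfolding PiM_law by (subst integral_density) (auto simp: p0)
  also have "\<dots> \<le> (\<integral>z. weight N z \<partial>?L)"
    by (rule integral_mono[OF intpY intW pY(1)])
  finally show ?thesis by (simp add: m_def)
qed

text \<open>In both estimates the logarithm of the integral has leading term
  \<open>- min_energy * N^2\<close>; what remains is of order \<open>N\<close>, or an arbitrarily
  small multiple of \<open>N^2\<close>.\<close>

theorem free_energy_limit:
  "(\<lambda>N. - ln (\<integral>z. weight N z \<partial>PiM {..<N} (\<lambda>_. lborel)) / (real N)^2) \<longlonglongrightarrow> min_energy"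
proof (rule order_tendstoI)
  define Z where "Z N = (\<integral>z. weight N z \<partial>PiM {..<N} (\<lambda>_. lborel))" for N
  define c where "c = (\<integral>x. Q x \<partial>\<nu>) + (\<integral>x. ln (p x) \<partial>\<nu>) - min_energy"
  have lower: "exp (- (real N^2 * min_energy + real N * c)) \<le> Z N" for N
    using integral_weight_ge[of N] by (simp add: Z_def c_def power2_eq_square algebra_simps)
  have Zpos: "Z N > 0" for N using less_le_trans[OF exp_gt_zero lower] .
  fix a
  {
    assume a: "a < min_energy"
    define \<epsilon> where "\<epsilon> = (min_energy - a) / 2"
    have \<epsilon>: "\<epsilon> > 0" "a < min_energy - \<epsilon>" using a by (auto simp: \<epsilon>_def field_simps)
    obtain K where K: "\<And>N. Z N \<le> exp (- (real N^2 * (min_energy - \<epsilon>)) + K * real N)"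
      using integral_weight_le[OF \<epsilon>(1) min_energy_le] unfolding Z_def by blast
    have "(\<lambda>N. min_energy - \<epsilon> - K / real N) \<longlonglongrightarrow> min_energy - \<epsilon> - 0"
      by (intro tendsto_intros lim_const_over_n)
    then have "\<forall>\<^sub>F N in sequentially. a < min_energy - \<epsilon> - K / real N"
      using \<epsilon> by (intro order_tendstoD) auto
    then show "\<forall>\<^sub>F N in sequentially. a < - ln (\<integral>z. weight N z \<partial>PiM {..<N} (\<lambda>_. lborel)) / (real N)^2"
      using eventually_gt_at_top[of 0]
    proof eventually_elim
      case (elim N)
      have "ln (Z N) \<le> - (real N^2 * (min_energy - \<epsilon>)) + K * real N"
        using K[of N] Zpos[of N] by (metis ln_exp ln_le_cancel_iff exp_gt_zero)
      then have "real N^2 * (min_energy - \<epsilon> - K / real N) \<le> - ln (Z N)"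
        using elim by (simp add: power2_eq_square algebra_simps)
      then have "min_energy - \<epsilon> - K / real N \<le> - ln (Z N) / (real N)^2"
        using elim by (subst pos_le_divide_eq) (auto simp: mult.commute)
      then show ?case using elim unfolding Z_def by linarith
    qed
  }
  {
    assume a: "min_energy < a"
    have "(\<lambda>N. min_energy + c / real N) \<longlonglongrightarrow> min_energy + 0"
      by (intro tendsto_intros lim_const_over_n)
    then have "\<forall>\<^sub>F N in sequentially. min_energy + c / real N < a"
      using a by (intro order_tendstoD) auto
    then show "\<forall>\<^sub>F N in sequentially. - ln (\<integral>z. weight N z \<partial>PiM {..<N} (\<lambda>_. lborel)) / (real N)^2 < a"
      using eventually_gt_at_top[of 0]
    proof eventually_elim
      case (elim N)
      have "- (real N^2 * min_energy + real N * c) \<le> ln (Z N)"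
        using lower[of N] Zpos[of N] by (metis ln_exp ln_le_cancel_iff exp_gt_zero)
      then have "- ln (Z N) \<le> real N^2 * (min_energy + c / real N)"
        using elim by (simp add: power2_eq_square algebra_simps)
      then have "- ln (Z N) / (real N)^2 \<le> min_energy + c / real N"
        using elim by (subst pos_divide_le_eq) (auto simp: mult.commute)
      then show ?case using elim unfolding Z_def by linarith
    qed
  }
qed

end

section \<open>Integrals depending holomorphically on a parameter\<close>

text \<open>Taylor's formula with Cauchy's estimate for the second derivative. Discs of radius
  \<open>r\<close> around points of \<open>ball w r\<close> must stay in the domain, which explains
  the radius \<open>3 * r\<close> of the hypotheses.\<close>

lemma holomorphic_second_order_bound:
  assumes f: "f holomorphic_on ball w (3 * r)" and r: "r > 0"
    and C: "\<And>x. x \<in> ball w (3 * r) \<Longrightarrow> norm (f x) \<le> C" and z: "z \<in> ball w r"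
  shows "norm (f z - f w - deriv f w * (z - w)) \<le> 2 * C / r^2 * norm (z - w)^2"
proof -
  have "norm ((deriv ^^ 0) f z - (\<Sum>i\<le>1. (deriv ^^ i) f w * (z - w)^i / fact i)) \<le> (2 * C / r^2) * norm (z - w)^(Suc 1) / fact 1"
  proof (rule complex_Taylor[of "ball w r" 1 "\<lambda>i. (deriv ^^ i) f"])
    fix i x assume x: "x \<in> ball w r"
    then have "x \<in> ball w (3 * r)" using r by auto
    then show "((deriv ^^ i) f has_field_derivative (deriv ^^ Suc i) f x) (at x within ball w r)"
      using holomorphic_derivI[OF holomorphic_higher_deriv[OF f open_ball] open_ball, of x i]
      by (auto intro: DERIV_subset)
  next
    fix x assume x: "x \<in> ball w r"
    have sub: "cball x r \<subseteq> ball w (3 * r)"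
    proof
      fix y assume "y \<in> cball x r"
      then have "dist w y \<le> dist w x + dist x y" "dist w x < r" "dist x y \<le> r" using x by (auto intro: dist_triangle)
      then show "y \<in> ball w (3 * r)" using r by simp
    qed
    have "norm ((deriv ^^ 2) f x) \<le> fact 2 * C / r^2"
    proof (rule Cauchy_inequality)
      show "f holomorphic_on ball x r" using sub by (intro holomorphic_on_subset[OF f]) auto
      show "continuous_on (cball x r) f" using sub by (intro holomorphic_on_imp_continuous_on holomorphic_on_subset[OF f])
      show "norm (f y) \<le> C" if "norm (x - y) = r" for y using that sub by (intro C) (auto simp: dist_norm)
    qed (rule r)
    then show "norm ((deriv ^^ Suc 1) f x) \<le> 2 * C / r^2" by (simp add: numeral_2_eq_2)
  qed (use z r in auto)
  then show ?thesis by (simp add: algebra_simps numeral_2_eq_2)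
qed

lemma Cauchy_deriv_bound:
  assumes f: "f holomorphic_on ball w R" and r: "0 < r" "r < R"
    and C: "\<And>x. x \<in> ball w R \<Longrightarrow> norm (f x) \<le> C"
  shows "norm (deriv f w) \<le> C / r"
proof -
  have "norm ((deriv ^^ 1) f w) \<le> fact 1 * C / r^1"
  proof (rule Cauchy_inequality)
    show "f holomorphic_on ball w r" using r by (intro holomorphic_on_subset[OF f]) auto
    show "continuous_on (cball w r) f" using r by (intro holomorphic_on_imp_continuous_on holomorphic_on_subset[OF f]) auto
    show "norm (f y) \<le> C" if "norm (w - y) = r" for y using that r by (intro C) (auto simp: dist_norm)
  qed (use r in auto)
  then show ?thesis by simp
qed

text \<open>A function with a second-order expansion around every point is holomorphic; integrals of
  holomorphic functions over a parameter inherit such expansions from the Cauchy estimates.\<close>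
lemma has_field_derivative_second_order:
  fixes F :: "complex \<Rightarrow> complex"
  assumes r: "r > 0" and K: "\<And>z. z \<in> ball w r \<Longrightarrow> norm (F z - F w - D * (z - w)) \<le> K * norm (z - w)^2"
  shows "(F has_field_derivative D) (at w)"
proof -
  have "((\<lambda>z. (F z - F w) / (z - w) - D) \<longlongrightarrow> 0) (at w)"
  proof (rule Lim_null_comparison)
    show "\<forall>\<^sub>F z in at w. norm ((F z - F w) / (z - w) - D) \<le> K * norm (z - w)"
      unfolding eventually_at
    proof (intro exI[of _ r] conjI ballI impI r)
      fix z assume z: "z \<noteq> w \<and> dist z w < r"
      then have "norm (F z - F w - D * (z - w)) \<le> K * norm (z - w)^2" by (intro K) (auto simp: dist_commute)
      moreover have "(F z - F w) / (z - w) - D = (F z - F w - D * (z - w)) / (z - w)" using z by (simp add: field_simps)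
      ultimately show "norm ((F z - F w) / (z - w) - D) \<le> K * norm (z - w)"
        using z by (simp add: norm_divide divide_le_eq power2_eq_square mult.assoc)
    qed
    show "((\<lambda>z. K * norm (z - w)) \<longlongrightarrow> 0) (at w)"
      by (rule tendsto_eq_intros | simp)+
  qed
  then have "((\<lambda>z. (F z - F w) / (z - w)) \<longlongrightarrow> D) (at w)" by (simp add: LIM_zero_iff)
  then show ?thesis by (simp add: has_field_derivative_iff)
qed

text \<open>Reaches the derivative through countably many difference quotients, so that its
  measurability in a further parameter follows from that of the function.\<close>

lemma AE_cong_limit_deriv:
  fixes f :: "complex \<Rightarrow> complex"
  assumes "(f has_field_derivative D) (at w)" "r > (0::real)"
  shows "(\<lambda>n. (f (w + of_real (r / real (Suc n))) - f w) / of_real (r / real (Suc n))) \<longlonglongrightarrow> D"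
proof -
  have "((\<lambda>h. (f (w + h) - f w) / h) \<longlongrightarrow> D) (at 0)"
    using assms(1) by (simp add: DERIV_def)
  moreover have "filterlim (\<lambda>n. complex_of_real (r / real (Suc n))) (at 0) sequentially"
  proof (rule filterlim_atI)
    have "(\<lambda>n. r / real (Suc n)) \<longlonglongrightarrow> 0" by (rule LIMSEQ_Suc[OF lim_const_over_n])
    then show "(\<lambda>n. complex_of_real (r / real (Suc n))) \<longlonglongrightarrow> 0" using tendsto_of_real[where 'a=complex, of _ 0 sequentially] by (simp only: of_real_0)
    show "\<forall>\<^sub>F n in sequentially. complex_of_real (r / real (Suc n)) \<noteq> 0"
      using assms(2) by (intro always_eventually allI) (simp del: of_nat_Suc)
  qed
  ultimately show ?thesis by (rule filterlim_compose)
qed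

lemma holomorphic_on_integral_param:
  fixes f :: "complex \<Rightarrow> 'a \<Rightarrow> complex"
  assumes fin: "finite_measure M" and U: "open U"
    and meas: "\<And>w. w \<in> U \<Longrightarrow> f w \<in> borel_measurable M"
    and hol: "AE x in M. (\<lambda>w. f w x) holomorphic_on U"
    and bnd: "\<And>w. w \<in> U \<Longrightarrow> \<exists>r>0. \<exists>C. ball w r \<subseteq> U \<and> (AE x in M. \<forall>w'\<in>ball w r. norm (f w' x) \<le> C)"
  shows "(\<lambda>w. \<integral>x. f w x \<partial>M) holomorphic_on U"
proof (rule holomorphic_onI)
  interpret finite_measure M by fact
  fix w assume w: "w \<in> U"
  obtain R C where R: "R > 0" "ball w R \<subseteq> U" and C: "AE x in M. \<forall>w'\<in>ball w R. norm (f w' x) \<le> C"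
    using bnd[OF w] by blast
  define r where "r = R / 3"
  have r: "r > 0" "3 * r = R" using R by (auto simp: r_def)
  have int: "integrable M (f z)" if "z \<in> ball w R" for z
  proof (rule integrable_const_bound[where B=C])
    show "AE x in M. norm (f z x) \<le> C" using C by eventually_elim (use that in auto)
  qed (use that R meas in auto)
  \<comment> \<open>Measurable as a limit of measurable functions; for almost all \<open>x\<close>
    it is the derivative at \<open>w\<close>.\<close>
  define D where "D x = lim (\<lambda>n. (f (w + of_real (r / real (Suc n))) x - f w x) / of_real (r / real (Suc n)))" for x
  have inball: "w + of_real (r / real (Suc n)) \<in> ball w R" for n
  proof -
    have "norm (complex_of_real (r / real (Suc n))) \<le> r" using r by (subst norm_of_real) (simp add: divide_le_eq)
    then show ?thesis using r R(1) by (simp add: dist_norm)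
  qed
  have Dm: "D \<in> borel_measurable M" unfolding D_def[abs_def]
    by (intro borel_measurable_lim_metric borel_measurable_divide borel_measurable_diff meas borel_measurable_const)
       (use inball R w in auto)
  have exp: "AE x in M. norm (D x) \<le> C / r \<and> (\<forall>z\<in>ball w r. norm (f z x - f w x - D x * (z - w)) \<le> 2 * C / r^2 * norm (z - w)^2)"
    using C hol
  proof eventually_elim
    case (elim x)
    have h: "(\<lambda>w. f w x) holomorphic_on ball w R" using elim(2) R by (auto intro: holomorphic_on_subset)
    have "((\<lambda>w. f w x) has_field_derivative deriv (\<lambda>w. f w x) w) (at w)"
      by (rule holomorphic_derivI[OF h]) (use R in auto)
    from AE_cong_limit_deriv[OF this r(1)] have D: "D x = deriv (\<lambda>w. f w x) w" unfolding D_def by (rule limI)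
    have "norm (deriv (\<lambda>w. f w x) w) \<le> C / r"
      by (rule Cauchy_deriv_bound[OF h r(1)]) (use r elim in auto)
    moreover have "norm (f z x - f w x - D x * (z - w)) \<le> 2 * C / r^2 * norm (z - w)^2" if "z \<in> ball w r" for z
      unfolding D using elim h r that by (intro holomorphic_second_order_bound) auto
    ultimately show ?case using D by auto
  qed
  have Dint: "integrable M D"
    by (rule integrable_const_bound[where B="C / r"]) (use exp Dm in \<open>auto elim!: eventually_mono\<close>)
  have "((\<lambda>w. \<integral>x. f w x \<partial>M) has_field_derivative (\<integral>x. D x \<partial>M)) (at w)"
  proof (rule has_field_derivative_second_order[OF r(1)])
    fix z assume z: "z \<in> ball w r"
    then have zR: "z \<in> ball w R" using r by auto
    have wR: "w \<in> ball w R" using R by auto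
    have "(\<integral>x. f z x \<partial>M) - (\<integral>x. f w x \<partial>M) - (\<integral>x. D x \<partial>M) * (z - w) = (\<integral>x. f z x - f w x - D x * (z - w) \<partial>M)"
      using int[OF zR] int[OF wR] Dint by simp
    also have "norm \<dots> \<le> (\<integral>x. 2 * C / r^2 * norm (z - w)^2 \<partial>M)"
    proof (rule order_trans[OF integral_norm_bound integral_mono_AE])
      show "AE x in M. norm (f z x - f w x - D x * (z - w)) \<le> 2 * C / r^2 * norm (z - w)^2"
        using exp by eventually_elim (use z in auto)
    qed (use int[OF zR] int[OF wR] Dint in auto)
    also have "\<dots> = (measure M (space M) * (2 * C / r^2)) * norm (z - w)^2" by simp
    finally show "norm ((\<integral>x. f z x \<partial>M) - (\<integral>x. f w x \<partial>M) - (\<integral>x. D x \<partial>M) * (z - w)) \<le> (measure M (space M) * (2 * C / r^2)) * norm (z - w)^2" .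
  qed
  then show "(\<lambda>w. \<integral>x. f w x \<partial>M) field_differentiable at w within U"
    using field_differentiable_at_within field_differentiable_def by blast
qed

section \<open>Contour integrals along segments and rectangles\<close>

lemma contour_integral_linepath_set_integral:
  assumes "continuous_on (closed_segment a b) f"
  shows "contour_integral (linepath a b) f = (LINT x:{0..1}|lborel. f (linepath a b x) * (b - a))"
    and "set_integrable lborel {0..1} (\<lambda>x. f (linepath a b x) * (b - a))"
proof -
  have "continuous_on {0..1} (\<lambda>x. f (linepath a b x) * (b - a))"
    by (intro continuous_intros continuous_on_compose2[OF assms]) (auto simp: linepath_in_path)
  then show 1: "set_integrable lborel {0..1} (\<lambda>x. f (linepath a b x) * (b - a))"
    unfolding set_integrable_def by (intro borel_integrable_compact) auto
  show "contour_integral (linepath a b) f = (LINT x:{0..1}|lborel. f (linepath a b x) * (b - a))"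
    unfolding contour_integral_integral using set_borel_integral_eq_integral(2)[OF 1, symmetric] by simp
qed

lemma holomorphic_on_contour_integral_param_linepath:
  assumes U: "open U"
    and cont: "\<And>w. w \<in> U \<Longrightarrow> continuous_on (closed_segment a b) (f w)"
    and hol: "\<And>s. s \<in> closed_segment a b \<Longrightarrow> (\<lambda>w. f w s) holomorphic_on U"
    and bnd: "\<And>w. w \<in> U \<Longrightarrow> \<exists>r>0. \<exists>C. ball w r \<subseteq> U \<and> (\<forall>w'\<in>ball w r. \<forall>s\<in>closed_segment a b. norm (f w' s) \<le> C)"
  shows "(\<lambda>w. contour_integral (linepath a b) (f w)) holomorphic_on U"
proof -
  let ?M = "restrict_space lborel {0..1::real}"
  have seg: "linepath a b x \<in> closed_segment a b" if "x \<in> {0..1}" for x using that by (rule linepath_in_path)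
  have "(\<lambda>w. \<integral>x. f w (linepath a b x) * (b - a) \<partial>?M) holomorphic_on U"
  proof (rule holomorphic_on_integral_param[OF _ U])
    show "finite_measure ?M" by (rule finite_measureI) (simp add: emeasure_restrict_space space_restrict_space)
    show "(\<lambda>x. f w (linepath a b x) * (b - a)) \<in> borel_measurable ?M" if "w \<in> U" for w
    proof -
      have "continuous_on {0..1} (\<lambda>x. f w (linepath a b x) * (b - a))"
        by (intro continuous_intros continuous_on_compose2[OF cont[OF that]]) (auto simp: linepath_in_path)
      then have "(\<lambda>x. f w (linepath a b x) * (b - a)) \<in> borel_measurable (restrict_space borel {0..1})"
        by (rule borel_measurable_continuous_on_restrict)
      then show ?thesis by (simp add: measurable_cong_sets[OF sets_restrict_space_cong[OF sets_lborel] refl])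
    qed
    show "AE x in ?M. (\<lambda>w. f w (linepath a b x) * (b - a)) holomorphic_on U"
      by (rule AE_I2) (auto simp: space_restrict_space intro!: holomorphic_intros hol seg)
    fix w assume "w \<in> U"
    then obtain r C where rC: "r > 0" "ball w r \<subseteq> U" "\<forall>w'\<in>ball w r. \<forall>s\<in>closed_segment a b. norm (f w' s) \<le> C"
      using bnd by blast
    have "AE x in ?M. \<forall>w'\<in>ball w r. norm (f w' (linepath a b x) * (b - a)) \<le> C * norm (b - a)"
      using rC(3) seg by (intro AE_I2) (auto simp: space_restrict_space norm_mult intro!: mult_right_mono)
    then show "\<exists>r>0. \<exists>C. ball w r \<subseteq> U \<and> (AE x in ?M. \<forall>w'\<in>ball w r. norm (f w' (linepath a b x) * (b - a)) \<le> C)"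
      using rC by blast
  qed
  then show ?thesis
  proof (rule holomorphic_transform)
    fix w assume "w \<in> U"
    then show "(\<integral>x. f w (linepath a b x) * (b - a) \<partial>?M) = contour_integral (linepath a b) (f w)"
      by (simp add: contour_integral_linepath_set_integral[OF cont] integral_restrict_space set_lebesgue_integral_def)
  qed
qed

lemma contour_integral_rectpath:
  assumes "continuous_on (path_image (rectpath a c)) f"
  defines "b \<equiv> Complex (Re c) (Im a)" and "d \<equiv> Complex (Re a) (Im c)"
  shows "contour_integral (rectpath a c) f = contour_integral (linepath a b) f + contour_integral (linepath b c) f
     + contour_integral (linepath c d) f + contour_integral (linepath d a) f"
    and "f contour_integrable_on rectpath a c"
    and "path_image (rectpath a c) = closed_segment a b \<union> closed_segment b c \<union> closed_segment c d \<union> closed_segment d a"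
proof -
  have rp: "rectpath a c = linepath a b +++ linepath b c +++ linepath c d +++ linepath d a"
    by (simp add: rectpath_def Let_def b_def d_def)
  show pi: "path_image (rectpath a c) = closed_segment a b \<union> closed_segment b c \<union> closed_segment c d \<union> closed_segment d a"
    unfolding rp by (simp add: path_image_join Un_assoc)
  have c: "continuous_on (closed_segment a b) f" "continuous_on (closed_segment b c) f"
      "continuous_on (closed_segment c d) f" "continuous_on (closed_segment d a) f"
    using assms(1) unfolding pi by (auto intro: continuous_on_subset)
  note ci = c[THEN contour_integrable_continuous_linepath]
  show "contour_integral (rectpath a c) f = contour_integral (linepath a b) f + contour_integral (linepath b c) f
     + contour_integral (linepath c d) f + contour_integral (linepath d a) f" "f contour_integrable_on rectpath a c"
    unfolding rp using ci by (simp_all add: contour_integrable_join valid_path_join)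
qed

lemma holomorphic_on_contour_integral_param_rectpath:
  assumes U: "open U"
    and cont: "\<And>w. w \<in> U \<Longrightarrow> continuous_on (path_image (rectpath a c)) (f w)"
    and hol: "\<And>s. s \<in> path_image (rectpath a c) \<Longrightarrow> (\<lambda>w. f w s) holomorphic_on U"
    and bnd: "\<And>w. w \<in> U \<Longrightarrow> \<exists>r>0. \<exists>C. ball w r \<subseteq> U \<and> (\<forall>w'\<in>ball w r. \<forall>s\<in>path_image (rectpath a c). norm (f w' s) \<le> C)"
  shows "(\<lambda>w. contour_integral (rectpath a c) (f w)) holomorphic_on U"
proof -
  define b d where "b = Complex (Re c) (Im a)" and "d = Complex (Re a) (Im c)"
  have pi: "path_image (rectpath a c) = closed_segment a b \<union> closed_segment b c \<union> closed_segment c d \<union> closed_segment d a"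
    unfolding b_def d_def by (rule contour_integral_rectpath(3)[of a c "\<lambda>_. 0"]) auto
  have seg: "(\<lambda>w. contour_integral (linepath x y) (f w)) holomorphic_on U"
    if sub: "closed_segment x y \<subseteq> path_image (rectpath a c)" for x y
  proof (rule holomorphic_on_contour_integral_param_linepath[OF U])
    show "continuous_on (closed_segment x y) (f w)" if "w \<in> U" for w using cont[OF that] sub continuous_on_subset by blast
    show "(\<lambda>w. f w s) holomorphic_on U" if "s \<in> closed_segment x y" for s using hol sub that by blast
    show "\<exists>r>0. \<exists>C. ball w r \<subseteq> U \<and> (\<forall>w'\<in>ball w r. \<forall>s\<in>closed_segment x y. norm (f w' s) \<le> C)" if "w \<in> U" for w
      using bnd[OF that] sub by (meson subset_iff)
  qed
  have "(\<lambda>w. contour_integral (linepath a b) (f w) + contour_integral (linepath b c) (f w)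
     + contour_integral (linepath c d) (f w) + contour_integral (linepath d a) (f w)) holomorphic_on U"
    by (intro holomorphic_intros seg) (auto simp: pi)
  then show ?thesis
    by (rule holomorphic_transform) (auto simp: contour_integral_rectpath(1)[OF cont] b_def d_def)
qed

text \<open>Fubini for a segment and the law. The witness \<open>k\<close> is an integrable version
  of the inner contour integral; it has to agree with it only on \<open>[-A, A]\<close>, where the
  law lives.\<close>

lemma (in compact_law) contour_integral_linepath_law:
  fixes f :: "complex \<Rightarrow> real \<Rightarrow> complex"
  assumes f: "continuous_on (closed_segment a b \<times> {-A..A}) (\<lambda>(s, y). f s y)"
    and meas: "\<And>s. s \<in> closed_segment a b \<Longrightarrow> f s \<in> borel_measurable borel"
    and cont: "continuous_on (closed_segment a b) (\<lambda>s. \<integral>y. f s y \<partial>\<nu>)"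
  shows "\<exists>k. integrable \<nu> k \<and> (\<forall>y. \<bar>y\<bar> \<le> A \<longrightarrow> k y = contour_integral (linepath a b) (\<lambda>s. f s y)) \<and>
    (\<integral>y. k y \<partial>\<nu>) = contour_integral (linepath a b) (\<lambda>s. \<integral>y. f s y \<partial>\<nu>)"
proof -
  interpret LP: pair_sigma_finite lborel \<nu> ..
  let ?S = "{0..1} \<times> {-A..A} :: (real \<times> real) set"
  define g where "g x y = f (linepath a b x) y * (b - a)" for x y
  \<comment> \<open>The cut-off makes the continuous integrand measurable and bounded on the whole
    product, and the law does not see the difference.\<close>
  define F where "F q = indicator ?S q *\<^sub>R g (fst q) (snd q)" for q
  have seg: "linepath a b x \<in> closed_segment a b" if "x \<in> {0..1}" for x using that by (rule linepath_in_path)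
  have gc: "continuous_on ?S (\<lambda>q. g (fst q) (snd q))"
  proof -
    have "continuous_on ?S (\<lambda>q. linepath a b (fst q))"
      unfolding linepath_def by (intro continuous_intros)
    then have "continuous_on ?S (\<lambda>q. (\<lambda>(s, y). f s y) (linepath a b (fst q), snd q))"
      by (intro continuous_on_compose2[OF f]) (auto intro!: continuous_intros seg)
    then show ?thesis unfolding g_def by (auto intro!: continuous_intros)
  qed
  have cpt: "compact ?S" by (intro compact_Times) auto
  obtain B where B: "\<And>q. q \<in> ?S \<Longrightarrow> norm (g (fst q) (snd q)) \<le> B"
    using compact_imp_bounded[OF compact_continuous_image[OF gc cpt]] unfolding bounded_iff by blast
  have Sm: "?S \<in> sets borel" using cpt by (intro borel_closed compact_imp_closed)
  have "F \<in> borel_measurable borel"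
    unfolding F_def[abs_def] by (rule borel_measurable_continuous_on_indicator[OF Sm gc])
  then have Fm [measurable]: "F \<in> borel_measurable (borel \<Otimes>\<^sub>M borel)" by (simp add: borel_prod)
  have Fb: "norm (F q) \<le> indicator {0..1} (fst q) * \<bar>B\<bar>" for q
    using B[of q] by (auto simp: F_def indicator_def)
  have Fint: "integrable (lborel \<Otimes>\<^sub>M \<nu>) F"
  proof (rule Bochner_Integration.integrable_bound)
    show "integrable (lborel \<Otimes>\<^sub>M \<nu>) (\<lambda>q. indicator ({0..1} \<times> UNIV :: (real \<times> real) set) q *\<^sub>R \<bar>B\<bar>)"
    proof (intro integrable_scaleR_left integrable_real_indicator)
      show "({0..1} \<times> UNIV :: (real \<times> real) set) \<in> sets (lborel \<Otimes>\<^sub>M \<nu>)" by (intro pair_measureI) auto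
      show "emeasure (lborel \<Otimes>\<^sub>M \<nu>) ({0..1} \<times> UNIV :: (real \<times> real) set) < \<infinity>"
        using emeasure_pair_measure_Times[of "{0..1::real}" lborel UNIV] emeasure_space_1 by simp
    qed
    show "AE q in lborel \<Otimes>\<^sub>M \<nu>. norm (F q) \<le> norm (indicator ({0..1} \<times> UNIV :: (real \<times> real) set) q *\<^sub>R \<bar>B\<bar>)"
    proof (rule AE_I2)
      fix q :: "real \<times> real"
      show "norm (F q) \<le> norm (indicator ({0..1} \<times> UNIV) q *\<^sub>R \<bar>B\<bar>)"
        using Fb[of q] by (cases "fst q \<in> {0..1}") (auto simp: indicator_def mem_Times_iff)
    qed
  qed measurable
  show ?thesis
  proof (intro exI[of _ "\<lambda>y. \<integral>x. F (x, y) \<partial>lborel"] conjI allI impI)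
    show "integrable \<nu> (\<lambda>y. \<integral>x. F (x, y) \<partial>lborel)"
      using LP.integrable_snd[of "\<lambda>x y. F (x, y)"] Fint by simp
    fix y assume y: "\<bar>y\<bar> \<le> A"
    have "continuous_on (closed_segment a b) (\<lambda>s. (\<lambda>(s, y). f s y) (s, y))"
      by (rule continuous_on_compose2[OF f]) (use y in \<open>auto intro!: continuous_intros\<close>)
    then have "contour_integral (linepath a b) (\<lambda>s. f s y) = (LINT x:{0..1}|lborel. g x y)"
      unfolding g_def by (intro contour_integral_linepath_set_integral) auto
    also have "\<dots> = (\<integral>x. F (x, y) \<partial>lborel)"
      unfolding set_lebesgue_integral_def F_def using y
      by (intro Bochner_Integration.integral_cong) (auto simp: indicator_def)
    finally show "(\<integral>x. F (x, y) \<partial>lborel) = contour_integral (linepath a b) (\<lambda>s. f s y)" by simp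
  next
    have "(\<integral>y. \<integral>x. F (x, y) \<partial>lborel \<partial>\<nu>) = (\<integral>x. \<integral>y. F (x, y) \<partial>\<nu> \<partial>lborel)"
      using LP.Fubini_integral[of "\<lambda>x y. F (x, y)"] Fint by simp
    also have "\<dots> = (LINT x:{0..1}|lborel. (\<integral>y. f (linepath a b x) y \<partial>\<nu>) * (b - a))"
      unfolding set_lebesgue_integral_def
    proof (intro Bochner_Integration.integral_cong refl)
      fix x :: real
      show "(\<integral>y. F (x, y) \<partial>\<nu>) = indicator {0..1} x *\<^sub>R ((\<integral>y. f (linepath a b x) y \<partial>\<nu>) * (b - a))"
      proof (cases "x \<in> {0..1}")
        case True
        have "continuous_on {-A..A} (\<lambda>y. (\<lambda>(s, y). f s y) (linepath a b x, y))"
          by (rule continuous_on_compose2[OF f]) (use True in \<open>auto intro!: continuous_intros seg\<close>)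
        then have m: "(\<lambda>y. indicator {-A..A} y *\<^sub>R f (linepath a b x) y) \<in> borel_measurable borel"
          by (intro borel_measurable_continuous_on_indicator) auto
        have "(\<integral>y. F (x, y) \<partial>\<nu>) = (\<integral>y. (indicator {-A..A} y *\<^sub>R f (linepath a b x) y) * (b - a) \<partial>\<nu>)"
          using True by (intro Bochner_Integration.integral_cong) (auto simp: F_def g_def indicator_def)
        also have "\<dots> = (\<integral>y. indicator {-A..A} y *\<^sub>R f (linepath a b x) y \<partial>\<nu>) * (b - a)"
          by (rule integral_mult_left_zero)
        also have "(\<integral>y. indicator {-A..A} y *\<^sub>R f (linepath a b x) y \<partial>\<nu>) = (\<integral>y. f (linepath a b x) y \<partial>\<nu>)"
        proof (rule integral_cong_AE)
          show "AE y in \<nu>. indicator {-A..A} y *\<^sub>R f (linepath a b x) y = f (linepath a b x) y"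
            using AE_bounded by eventually_elim (auto simp: indicator_def)
        qed (use m meas[OF seg[OF True]] in auto)
        finally show ?thesis using True by simp
      next
        case False
        then have "F (x, y) = 0" for y by (auto simp: F_def indicator_def)
        then show ?thesis using False by simp
      qed
    qed
    also have "\<dots> = contour_integral (linepath a b) (\<lambda>s. \<integral>y. f s y \<partial>\<nu>)"
      by (rule contour_integral_linepath_set_integral(1)[OF cont, symmetric])
    finally show "(\<integral>y. \<integral>x. F (x, y) \<partial>lborel \<partial>\<nu>) = contour_integral (linepath a b) (\<lambda>s. \<integral>y. f s y \<partial>\<nu>)" .
  qed
qed

lemma (in compact_law) contour_integral_rectpath_law:
  fixes f :: "complex \<Rightarrow> real \<Rightarrow> complex" and a c :: complex
  defines "\<gamma> \<equiv> rectpath a c"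
  assumes f: "continuous_on (path_image \<gamma> \<times> {-A..A}) (\<lambda>(s, y). f s y)"
    and meas: "\<And>s. s \<in> path_image \<gamma> \<Longrightarrow> f s \<in> borel_measurable borel"
    and cont: "continuous_on (path_image \<gamma>) (\<lambda>s. \<integral>y. f s y \<partial>\<nu>)"
    and h: "h \<in> borel_measurable borel" "\<And>y. \<bar>y\<bar> \<le> A \<Longrightarrow> h y = contour_integral \<gamma> (\<lambda>s. f s y)"
  shows "(\<integral>y. h y \<partial>\<nu>) = contour_integral \<gamma> (\<lambda>s. \<integral>y. f s y \<partial>\<nu>)"
proof -
  define b d where "b = Complex (Re c) (Im a)" and "d = Complex (Re a) (Im c)"
  have pi: "path_image \<gamma> = closed_segment a b \<union> closed_segment b c \<union> closed_segment c d \<union> closed_segment d a"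
    unfolding b_def d_def \<gamma>_def by (rule contour_integral_rectpath(3)[of a c "\<lambda>_. 0"]) auto
  have seg: "\<exists>k. integrable \<nu> k \<and> (\<forall>y. \<bar>y\<bar> \<le> A \<longrightarrow> k y = contour_integral (linepath x y') (\<lambda>s. f s y)) \<and>
    (\<integral>y. k y \<partial>\<nu>) = contour_integral (linepath x y') (\<lambda>s. \<integral>y. f s y \<partial>\<nu>)"
    if sub: "closed_segment x y' \<subseteq> path_image \<gamma>" for x y'
    by (rule contour_integral_linepath_law)
       (use sub in \<open>auto intro: continuous_on_subset[OF f] continuous_on_subset[OF cont] meas\<close>)
  obtain k1 where k1: "integrable \<nu> k1" "\<And>y. \<bar>y\<bar> \<le> A \<Longrightarrow> k1 y = contour_integral (linepath a b) (\<lambda>s. f s y)"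
    "(\<integral>y. k1 y \<partial>\<nu>) = contour_integral (linepath a b) (\<lambda>s. \<integral>y. f s y \<partial>\<nu>)" using seg[of a b] pi by blast
  obtain k2 where k2: "integrable \<nu> k2" "\<And>y. \<bar>y\<bar> \<le> A \<Longrightarrow> k2 y = contour_integral (linepath b c) (\<lambda>s. f s y)"
    "(\<integral>y. k2 y \<partial>\<nu>) = contour_integral (linepath b c) (\<lambda>s. \<integral>y. f s y \<partial>\<nu>)" using seg[of b c] pi by blast
  obtain k3 where k3: "integrable \<nu> k3" "\<And>y. \<bar>y\<bar> \<le> A \<Longrightarrow> k3 y = contour_integral (linepath c d) (\<lambda>s. f s y)"
    "(\<integral>y. k3 y \<partial>\<nu>) = contour_integral (linepath c d) (\<lambda>s. \<integral>y. f s y \<partial>\<nu>)" using seg[of c d] pi by blast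
  obtain k4 where k4: "integrable \<nu> k4" "\<And>y. \<bar>y\<bar> \<le> A \<Longrightarrow> k4 y = contour_integral (linepath d a) (\<lambda>s. f s y)"
    "(\<integral>y. k4 y \<partial>\<nu>) = contour_integral (linepath d a) (\<lambda>s. \<integral>y. f s y \<partial>\<nu>)" using seg[of d a] pi by blast
  have "(\<integral>y. h y \<partial>\<nu>) = (\<integral>y. k1 y + k2 y + k3 y + k4 y \<partial>\<nu>)"
  proof (rule integral_cong_AE)
    show "AE y in \<nu>. h y = k1 y + k2 y + k3 y + k4 y"
      using AE_bounded
    proof eventually_elim
      case (elim y)
      have "continuous_on (path_image \<gamma>) (\<lambda>s. (\<lambda>(s, y). f s y) (s, y))"
        by (rule continuous_on_compose2[OF f]) (use elim in \<open>auto intro!: continuous_intros\<close>)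
      then have "contour_integral \<gamma> (\<lambda>s. f s y) = k1 y + k2 y + k3 y + k4 y"
        using contour_integral_rectpath(1)[of a c "\<lambda>s. f s y"] elim k1 k2 k3 k4
        by (simp add: \<gamma>_def b_def d_def)
      then show ?case using h(2)[OF elim] by simp
    qed
    show "h \<in> borel_measurable \<nu>" using h(1) by simp
  qed (use k1 k2 k3 k4 in auto)
  also have "\<dots> = contour_integral \<gamma> (\<lambda>s. \<integral>y. f s y \<partial>\<nu>)"
    using k1 k2 k3 k4 contour_integral_rectpath(1)[of a c "\<lambda>s. \<integral>y. f s y \<partial>\<nu>"] cont
    by (simp add: \<gamma>_def b_def d_def)
  finally show ?thesis .
qed

section \<open>The loop equation\<close>

text \<open>Compares the energy of the law with that of its image under x + eps phi x for small eps of both signs.\<close>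
lemma (in equilibrium_gas) first_variation:
  fixes Q' \<phi> :: "real \<Rightarrow> real"
  assumes expand: "h0 > 0" "\<And>x h. \<bar>x\<bar> \<le> A \<Longrightarrow> \<bar>h\<bar> \<le> h0 \<Longrightarrow> \<bar>Q (x + h) - Q x - h * Q' x\<bar> \<le> K * h^2"
    and Q': "continuous_on UNIV Q'"
    and lip: "\<And>x y. \<bar>\<phi> x - \<phi> y\<bar> \<le> L * \<bar>x - y\<bar>" and bnd: "\<And>x. \<bar>\<phi> x\<bar> \<le> B"
    and \<phi>: "continuous_on UNIV \<phi>"
  shows "(\<integral>q. (\<phi> (fst q) - \<phi> (snd q)) / (fst q - snd q) \<partial>(\<nu> \<Otimes>\<^sub>M \<nu>)) = (\<integral>x. Q' x * \<phi> x \<partial>\<nu>)"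
proof -
  have [measurable]: "\<phi> \<in> borel_measurable borel" "Q' \<in> borel_measurable borel"
    using \<phi> Q' by (auto intro: borel_measurable_continuous_onI)
  have L: "L \<ge> 0" using lip[of 0 1] by simp
  have B: "B \<ge> 0" using bnd[of 0] by linarith
  have K: "K \<ge> 0" if "A \<ge> 0"
    using expand(2)[of 0 h0] expand(1) that by (smt (verit) abs_zero zero_le_mult_iff zero_less_power)
  define dq where "dq q = (\<phi> (fst q) - \<phi> (snd q)) / (fst q - snd q)" for q
  have [measurable]: "dq \<in> borel_measurable (borel \<Otimes>\<^sub>M borel)" unfolding dq_def[abs_def] by measurable
  have dqL: "\<bar>dq q\<bar> \<le> L" for q
  proof (cases "fst q = snd q")
    case False then show ?thesis using lip[of "fst q" "snd q"] by (simp add: dq_def divide_le_eq)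
  qed (simp add: dq_def L)
  have dqi: "integrable (\<nu> \<Otimes>\<^sub>M \<nu>) dq"
    by (rule integrable_pair_bounded[where B=L]) (use dqL in auto)
  obtain Bq where Bq: "\<And>x. \<bar>x\<bar> \<le> A \<Longrightarrow> \<bar>Q' x\<bar> \<le> Bq" using continuous_bounded_abs[OF Q'] by blast
  have Q\<phi>i: "integrable \<nu> (\<lambda>x. Q' x * \<phi> x)"
    by (rule integrable_bounded[where B="Bq * B"])
       (use Bq bnd in \<open>auto simp: abs_mult intro!: mult_mono dest: order_trans[OF abs_ge_zero]\<close>)
  define I1 where "I1 = (\<integral>q. dq q \<partial>(\<nu> \<Otimes>\<^sub>M \<nu>))"
  define I2 where "I2 = (\<integral>x. Q' x * \<phi> x \<partial>\<nu>)"
  \<comment> \<open>The first bound keeps \<open>\<epsilon> * dq\<close> within \<open>1/2\<close>,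
    so that the deformation is injective and the logarithm can be expanded. The second keeps the
    displacement within the range of the Taylor bound for \<open>Q\<close>.\<close>
  define \<epsilon>0 where "\<epsilon>0 = min (1 / (2 * (L + 1))) (h0 / (B + 1))"
  have \<epsilon>0: "\<epsilon>0 > 0" using L B expand(1) by (simp add: \<epsilon>0_def)
  \<comment> \<open>Second-order constant: \<open>2 * L^2\<close> comes from
    \<open>\<bar>ln (1 + u) - u\<bar> \<le> 2 * u^2\<close>, the rest from the Taylor bound for
    \<open>Q\<close>.\<close>
  define M where "M = 2 * L^2 + \<bar>K\<bar> * B^2"
  have fstint: "(\<integral>q. f (fst q) \<partial>(\<nu> \<Otimes>\<^sub>M \<nu>)) = (\<integral>x. f x \<partial>\<nu>)" "integrable (\<nu> \<Otimes>\<^sub>M \<nu>) (\<lambda>q. f (fst q))" if "integrable \<nu> f" for f :: "real \<Rightarrow> real"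
  proof -
    have d: "distr (\<nu> \<Otimes>\<^sub>M \<nu>) \<nu> fst = \<nu>" by (rule distr_pair_fst)
    show "(\<integral>q. f (fst q) \<partial>(\<nu> \<Otimes>\<^sub>M \<nu>)) = (\<integral>x. f x \<partial>\<nu>)"
      using integral_distr[of fst "\<nu> \<Otimes>\<^sub>M \<nu>" \<nu> f] that d by simp
    show "integrable (\<nu> \<Otimes>\<^sub>M \<nu>) (\<lambda>q. f (fst q))"
      using integrable_distr_eq[of fst "\<nu> \<Otimes>\<^sub>M \<nu>" \<nu> f] that d by simp
  qed
  have sndint: "(\<integral>q. f (snd q) \<partial>(\<nu> \<Otimes>\<^sub>M \<nu>)) = (\<integral>x. f x \<partial>\<nu>)" "integrable (\<nu> \<Otimes>\<^sub>M \<nu>) (\<lambda>q. f (snd q))" if "integrable \<nu> f" for f :: "real \<Rightarrow> real"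
  proof -
    have m: "(\<lambda>q. f (fst q)) \<in> borel_measurable (\<nu> \<Otimes>\<^sub>M \<nu>)" using fstint(2)[OF that] by auto
    show "(\<integral>q. f (snd q) \<partial>(\<nu> \<Otimes>\<^sub>M \<nu>)) = (\<integral>x. f x \<partial>\<nu>)"
      using pair.integral_product_swap[OF m] fstint(1)[OF that] by (simp add: case_prod_unfold)
    show "integrable (\<nu> \<Otimes>\<^sub>M \<nu>) (\<lambda>q. f (snd q))"
      using pair.integrable_product_swap[OF fstint(2)[OF that]] by (simp add: case_prod_unfold)
  qed
  have key: "0 \<le> \<epsilon> * (I2 - I1) + \<epsilon>^2 * M" if \<epsilon>: "\<bar>\<epsilon>\<bar> \<le> \<epsilon>0" for \<epsilon>
  proof -
    have \<epsilon>L: "\<bar>\<epsilon>\<bar> * L \<le> 1/2"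
    proof -
      have "\<bar>\<epsilon>\<bar> * L \<le> \<epsilon>0 * (L + 1)" using \<epsilon> L by (intro mult_mono) auto
      also have "\<dots> \<le> 1 / (2 * (L + 1)) * (L + 1)" using L by (intro mult_right_mono) (auto simp: \<epsilon>0_def)
      also have "\<dots> = 1/2" using L by (simp add: field_simps)
      finally show ?thesis .
    qed
    have \<epsilon>B: "\<bar>\<epsilon>\<bar> * B \<le> h0"
    proof -
      have "\<bar>\<epsilon>\<bar> * B \<le> \<epsilon>0 * (B + 1)" using \<epsilon> B by (intro mult_mono) auto
      also have "\<dots> \<le> h0 / (B + 1) * (B + 1)" using B by (intro mult_right_mono) (auto simp: \<epsilon>0_def)
      also have "\<dots> = h0" using B by simp
      finally show ?thesis .
    qed
    have \<epsilon>dq: "\<bar>\<epsilon> * dq q\<bar> \<le> 1/2" for q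
      using mult_left_mono[OF dqL[of q], of "\<bar>\<epsilon>\<bar>"] \<epsilon>L by (simp add: abs_mult)
    define T where "T x = x + \<epsilon> * \<phi> x" for x
    have Tc: "continuous_on UNIV T" unfolding T_def[abs_def] by (intro continuous_intros \<phi>)
    have [measurable]: "T \<in> borel_measurable borel" by (rule borel_measurable_continuous_onI[OF Tc])
    \<comment> \<open>The deformation stretches distances by \<open>1 + \<epsilon> * dq\<close>, so
      the interaction changes by the logarithm of this factor.\<close>
    have Tdiff: "T (fst q) - T (snd q) = (fst q - snd q) * (1 + \<epsilon> * dq q)" if "fst q \<noteq> snd q" for q
      using that by (simp add: T_def dq_def field_simps)
    have pos: "1 + \<epsilon> * dq q > 0" for q using \<epsilon>dq[of q] by (auto simp: abs_le_iff)
    define \<mu> where "\<mu> = distr \<nu> borel T"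
    have \<mu>p: "prob_space \<mu>" unfolding \<mu>_def by (rule prob_space_distr) simp
    have \<mu>b: "prob_borel \<mu>" using \<mu>p by (simp add: prob_borel_def \<mu>_def)
    have \<mu>\<mu>: "\<mu> \<Otimes>\<^sub>M \<mu> = distr (\<nu> \<Otimes>\<^sub>M \<nu>) (borel \<Otimes>\<^sub>M borel) (\<lambda>(x, y). (T x, T y))"
      unfolding \<mu>_def using \<mu>p
      by (intro pair_measure_distr) (auto simp: \<mu>_def prob_space_imp_sigma_finite)
    have Tm: "(\<lambda>(x, y). (T x, T y)) \<in> measurable (\<nu> \<Otimes>\<^sub>M \<nu>) (borel \<Otimes>\<^sub>M borel)" by measurable
    define \<Delta> where "\<Delta> x = Q (T x) - Q x" for x
    have \<Delta>i: "integrable \<nu> \<Delta>"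
      unfolding \<Delta>_def[abs_def] by (intro integrable_continuous continuous_intros Q_cont continuous_on_compose2[OF Q_cont Tc]) auto
    have lnm: "integrable (\<nu> \<Otimes>\<^sub>M \<nu>) (\<lambda>q. ln (1 + \<epsilon> * dq q))"
    proof (rule integrable_pair_bounded[where B="1"])
      fix x y
      have "\<bar>ln (1 + \<epsilon> * dq (x, y)) - \<epsilon> * dq (x, y)\<bar> \<le> 2 * (\<epsilon> * dq (x, y))^2"
        by (rule abs_ln_one_plus_x_minus_x_bound) (rule \<epsilon>dq)
      also have "\<dots> \<le> 2 * (1/2)^2" using power_mono[OF \<epsilon>dq[of "(x, y)"], of 2] by simp
      finally show "norm (ln (1 + \<epsilon> * dq (x, y))) \<le> 1"
        using \<epsilon>dq[of "(x, y)"] unfolding real_norm_def power2_eq_square by linarith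
    qed measurable
    define E where "E q = pair_energy Q q - ln (1 + \<epsilon> * dq q) + (\<Delta> (fst q) + \<Delta> (snd q)) / 2" for q
    have pe: "pair_energy Q (T (fst q), T (snd q)) = E q" if "fst q \<noteq> snd q" for q
    proof -
      have "ln \<bar>T (fst q) - T (snd q)\<bar> = ln \<bar>fst q - snd q\<bar> + ln (1 + \<epsilon> * dq q)"
        unfolding Tdiff[OF that] abs_mult using pos[of q] that by (subst ln_mult_pos) auto
      then show ?thesis by (simp add: pair_energy_def E_def \<Delta>_def add_divide_distrib diff_divide_distrib)
    qed
    have peae: "AE q in \<nu> \<Otimes>\<^sub>M \<nu>. pair_energy Q (T (fst q), T (snd q)) = E q"
      using AE_off_diagonal by eventually_elim (rule pe)
    have Ei: "integrable (\<nu> \<Otimes>\<^sub>M \<nu>) E"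
      unfolding E_def[abs_def] using integrable_pair_energy[OF Q_cont] lnm fstint(2)[OF \<Delta>i] sndint(2)[OF \<Delta>i] by auto
    have pm [measurable]: "pair_energy Q \<in> borel_measurable (borel \<Otimes>\<^sub>M borel)" by (simp add: pair_energy_def[abs_def])
    have Em: "E \<in> borel_measurable (\<nu> \<Otimes>\<^sub>M \<nu>)" using Ei by auto
    have pTm: "(\<lambda>q. pair_energy Q (T (fst q), T (snd q))) \<in> borel_measurable (\<nu> \<Otimes>\<^sub>M \<nu>)" by measurable
    have pTi: "integrable (\<nu> \<Otimes>\<^sub>M \<nu>) (\<lambda>q. pair_energy Q (T (fst q), T (snd q)))"
      by (subst integrable_cong_AE[OF pTm Em peae]) (rule Ei)
    have "energy Q \<mu> = ereal (\<integral>q. pair_energy Q q \<partial>(\<mu> \<Otimes>\<^sub>M \<mu>))"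
    proof (rule energy_eq_integral)
      show "integrable (\<mu> \<Otimes>\<^sub>M \<mu>) (pair_energy Q)"
        unfolding \<mu>\<mu> using pTi by (subst integrable_distr_eq[OF Tm pm]) (simp add: case_prod_unfold)
      show "AE q in \<mu> \<Otimes>\<^sub>M \<mu>. fst q \<noteq> snd q"
        unfolding \<mu>\<mu>
      proof (subst AE_distr_iff[OF Tm])
        show "{q \<in> space (borel \<Otimes>\<^sub>M borel). fst q \<noteq> (snd q :: real)} \<in> sets (borel \<Otimes>\<^sub>M borel)" by measurable
        show "AE q in \<nu> \<Otimes>\<^sub>M \<nu>. fst (case q of (x, y) \<Rightarrow> (T x, T y)) \<noteq> snd (case q of (x, y) \<Rightarrow> (T x, T y))"
          using AE_off_diagonal
        proof eventually_elim
          case (elim q)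
          then show ?case using Tdiff[of q] pos[of q] by (auto simp: case_prod_unfold)
        qed
      qed
    qed
    also have "(\<integral>q. pair_energy Q q \<partial>(\<mu> \<Otimes>\<^sub>M \<mu>)) = (\<integral>q. pair_energy Q (T (fst q), T (snd q)) \<partial>(\<nu> \<Otimes>\<^sub>M \<nu>))"
      unfolding \<mu>\<mu> by (subst integral_distr[OF Tm pm]) (simp add: case_prod_unfold)
    also have "\<dots> = (\<integral>q. E q \<partial>(\<nu> \<Otimes>\<^sub>M \<nu>))"
      by (rule integral_cong_AE[OF pTm Em peae])
    also have "\<dots> = min_energy - (\<integral>q. ln (1 + \<epsilon> * dq q) \<partial>(\<nu> \<Otimes>\<^sub>M \<nu>)) + (\<integral>x. \<Delta> x \<partial>\<nu>)"
      unfolding E_def[abs_def] min_energy_def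
      using integrable_pair_energy[OF Q_cont] lnm fstint[OF \<Delta>i] sndint[OF \<Delta>i] by (simp add: add_divide_distrib)
    finally have "0 \<le> - (\<integral>q. ln (1 + \<epsilon> * dq q) \<partial>(\<nu> \<Otimes>\<^sub>M \<nu>)) + (\<integral>x. \<Delta> x \<partial>\<nu>)"
      using min_energy_le[OF \<mu>b] by simp
    moreover have "(\<integral>q. \<epsilon> * dq q - 2 * \<epsilon>^2 * L^2 \<partial>(\<nu> \<Otimes>\<^sub>M \<nu>)) \<le> (\<integral>q. ln (1 + \<epsilon> * dq q) \<partial>(\<nu> \<Otimes>\<^sub>M \<nu>))"
    proof (rule integral_mono)
      fix q
      have "\<bar>ln (1 + \<epsilon> * dq q) - \<epsilon> * dq q\<bar> \<le> 2 * (\<epsilon> * dq q)^2"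
        by (rule abs_ln_one_plus_x_minus_x_bound) (rule \<epsilon>dq)
      moreover have "(\<epsilon> * dq q)^2 \<le> \<epsilon>^2 * L^2"
        using power_mono[OF dqL[of q], of 2] by (simp add: power_mult_distrib mult_left_mono)
      ultimately show "\<epsilon> * dq q - 2 * \<epsilon>^2 * L^2 \<le> ln (1 + \<epsilon> * dq q)" by linarith
    qed (use dqi lnm in auto)
    moreover have "(\<integral>q. \<epsilon> * dq q - 2 * \<epsilon>^2 * L^2 \<partial>(\<nu> \<Otimes>\<^sub>M \<nu>)) = \<epsilon> * I1 - 2 * \<epsilon>^2 * L^2"
      using dqi by (simp add: I1_def pair.P.prob_space[simplified])
    moreover have "(\<integral>x. \<Delta> x \<partial>\<nu>) \<le> (\<integral>x. \<epsilon> * (Q' x * \<phi> x) + \<bar>K\<bar> * \<epsilon>^2 * B^2 \<partial>\<nu>)"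
    proof (rule integral_mono_AE)
      show "AE x in \<nu>. \<Delta> x \<le> \<epsilon> * (Q' x * \<phi> x) + \<bar>K\<bar> * \<epsilon>^2 * B^2"
        using AE_bounded
      proof eventually_elim
        case (elim x)
        have "\<bar>\<epsilon> * \<phi> x\<bar> \<le> h0" using mult_left_mono[OF bnd[of x], of "\<bar>\<epsilon>\<bar>"] \<epsilon>B by (simp add: abs_mult)
        then have "\<bar>Q (x + \<epsilon> * \<phi> x) - Q x - \<epsilon> * \<phi> x * Q' x\<bar> \<le> K * (\<epsilon> * \<phi> x)^2" by (rule expand(2)[OF elim])
        also have "\<dots> \<le> \<bar>K\<bar> * (\<epsilon>^2 * B^2)"
          using power_mono[OF bnd[of x], of 2] by (intro mult_mono) (auto simp: power_mult_distrib intro: mult_left_mono)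
        finally have "Q (x + \<epsilon> * \<phi> x) - Q x - \<epsilon> * \<phi> x * Q' x \<le> \<bar>K\<bar> * (\<epsilon>^2 * B^2)" by (rule abs_le_D1)
        then show ?case unfolding \<Delta>_def T_def by (simp add: algebra_simps)
      qed
    qed (use \<Delta>i Q\<phi>i in auto)
    moreover have "(\<integral>x. \<epsilon> * (Q' x * \<phi> x) + \<bar>K\<bar> * \<epsilon>^2 * B^2 \<partial>\<nu>) = \<epsilon> * I2 + \<bar>K\<bar> * \<epsilon>^2 * B^2"
      using Q\<phi>i by (simp add: I2_def prob_space[simplified])
    ultimately show ?thesis by (simp add: M_def algebra_simps)
  qed
  have M: "M \<ge> 0" by (simp add: M_def)
  \<comment> \<open>A linear term that is nonnegative up to a quadratic error for both signs of
    \<open>\<epsilon>\<close> vanishes; \<open>e\<close> is taken so small that the quadratic term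
    loses.\<close>
  have "I2 - I1 = 0"
  proof (rule ccontr)
    define d where "d = I2 - I1"
    assume "I2 - I1 \<noteq> 0"
    then have d: "\<bar>d\<bar> > 0" by (simp add: d_def)
    define e where "e = min \<epsilon>0 (\<bar>d\<bar> / (2 * (M + 1)))"
    have e: "e > 0" "e \<le> \<epsilon>0" using d M \<epsilon>0 by (auto simp: e_def)
    have "e * M \<le> \<bar>d\<bar> / (2 * (M + 1)) * (M + 1)" using M d by (intro mult_mono) (auto simp: e_def)
    also have "\<dots> = \<bar>d\<bar> / 2" using M by (simp add: field_simps)
    finally have eM: "e * M \<le> \<bar>d\<bar> / 2" .
    have "0 \<le> (- sgn d * e) * d + (- sgn d * e)^2 * M" unfolding d_def
      by (rule key) (use e in \<open>auto simp: abs_mult sgn_if\<close>)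
    also have "\<dots> = e * (e * M - \<bar>d\<bar>)" using d by (auto simp: sgn_if power2_eq_square algebra_simps split: if_splits)
    also have "\<dots> < 0" using e eM d by (intro mult_pos_neg) auto
    finally show False by simp
  qed
  then show ?thesis by (simp add: I1_def I2_def dq_def[abs_def])
qed

section \<open>The Stieltjes transform of a compactly supported law\<close>

locale supported_law = compact_law \<nu> p C A for \<nu> p C A +
  fixes J :: "real set"
  assumes J_compact: "compact J" and J_sub: "J \<subseteq> {-A..A}" and p_supp: "\<And>x. x \<notin> J \<Longrightarrow> p x = 0"
begin

lemma J_measurable [measurable]: "J \<in> sets borel"
  using J_compact by (intro borel_closed compact_imp_closed)

lemma AE_support: "AE x in \<nu>. x \<in> J"
  unfolding law by (subst AE_density) (auto simp: p_supp intro!: AE_I2 dest: contrapos_nn[of _ "p _ = 0"] intro: ccontr)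

definition stieltjes :: "complex \<Rightarrow> complex" where
  "stieltjes z = (\<integral>y. 1 / (z - of_real y) \<partial>\<nu>)"

lemma closed_cJ: "closed (complex_of_real ` J)"
  by (intro compact_imp_closed compact_continuous_image J_compact continuous_intros)

lemma integrable_cauchy_kernel:
  assumes "z \<notin> of_real ` J"
  shows "integrable \<nu> (\<lambda>y. 1 / (z - of_real y) :: complex)"
proof -
  obtain e where e: "e > 0" "ball z e \<subseteq> - of_real ` J"
    using closed_cJ assms by (metis ComplI open_Compl open_contains_ball)
  show ?thesis
  proof (rule integrable_const_bound[where B="1/e"])
    show "AE y in \<nu>. norm (1 / (z - of_real y)) \<le> 1 / e"
      using AE_support
    proof eventually_elim
      case (elim y)
      then have "of_real y \<notin> ball z e" using e by auto
      then show ?case using e by (simp add: norm_divide dist_norm frac_le)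
    qed
  qed measurable
qed

lemma stieltjes_holomorphic: "stieltjes holomorphic_on (- of_real ` J)"
  unfolding stieltjes_def[abs_def]
proof (rule holomorphic_on_integral_param)
  show "finite_measure \<nu>" by (rule finite_measure_axioms)
  show "open (- complex_of_real ` J)" using closed_cJ by auto
  show "AE y in \<nu>. (\<lambda>w. 1 / (w - complex_of_real y)) holomorphic_on - of_real ` J"
    using AE_support by eventually_elim (auto intro!: holomorphic_intros)
  fix w assume w: "w \<in> - complex_of_real ` J"
  obtain e where e: "e > 0" "ball w e \<subseteq> - of_real ` J"
    using closed_cJ w by (metis open_Compl open_contains_ball)
  have "AE y in \<nu>. \<forall>w'\<in>ball w (e/2). norm (1 / (w' - complex_of_real y)) \<le> 2 / e"
    using AE_support
  proof eventually_elim
    case (elim y)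
    show ?case
    proof
      fix w' assume w': "w' \<in> ball w (e/2)"
      have "complex_of_real y \<notin> ball w e" using e elim by auto
      then have "e \<le> dist w (of_real y)" by simp
      also have "\<dots> \<le> dist w w' + dist w' (of_real y)" by (rule dist_triangle)
      finally have "e / 2 \<le> norm (w' - of_real y)" using w' by (simp add: dist_norm)
      then show "norm (1 / (w' - complex_of_real y)) \<le> 2 / e"
        using e frac_le[of 1 1 "e/2" "norm (w' - of_real y)"] by (simp add: norm_divide)
    qed
  qed
  moreover have "0 < e / 2" using e by simp
  moreover have "ball w (e/2) \<subseteq> - of_real ` J"
    by (rule order_trans[OF subset_ball e(2)]) (use e in simp)
  ultimately show "\<exists>r>0. \<exists>C. ball w r \<subseteq> - of_real ` J \<and> (AE y in \<nu>. \<forall>w'\<in>ball w r. norm (1 / (w' - complex_of_real y)) \<le> C)"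
    by blast
qed measurable

text \<open>For \<open>\<bar>y\<bar> \<le> A\<close> the kernel is at most
  \<open>2 / norm z\<close>. Together with a factor \<open>1 / (s - z)\<close> this gives the
  quadratic decay that lets contours be pushed to infinity.\<close>

lemma stieltjes_decay:
  assumes "norm z \<ge> 2 * A" "z \<noteq> 0" "A > 0"
  shows "norm (stieltjes z) \<le> 2 / norm z"
proof -
  have "norm (stieltjes z) \<le> (\<integral>y. 2 / norm z \<partial>\<nu>)"
    unfolding stieltjes_def
  proof (rule order_trans[OF integral_norm_bound integral_mono_AE])
    have zJ: "z \<notin> of_real ` J"
    proof
      assume "z \<in> of_real ` J"
      then obtain y where "y \<in> J" "z = of_real y" by auto
      moreover have "y \<in> {-A..A}" using J_sub \<open>y \<in> J\<close> by blast
      ultimately show False using assms by auto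
    qed
    show "integrable \<nu> (\<lambda>y. norm (1 / (z - complex_of_real y)))" by (intro integrable_norm integrable_cauchy_kernel zJ)
    show "AE y in \<nu>. norm (1 / (z - complex_of_real y)) \<le> 2 / norm z"
      using AE_bounded
    proof eventually_elim
      case (elim y)
      have "norm z \<le> norm (z - of_real y) + norm (complex_of_real y)" by (metis diff_add_cancel norm_triangle_ineq)
      then have "norm z / 2 \<le> norm (z - of_real y)" using elim assms by simp
      then show ?case using assms frac_le[of 1 1 "norm z / 2" "norm (z - of_real y)"] by (simp add: norm_divide)
    qed
  qed simp
  then show ?thesis by (simp add: prob_space[simplified])
qed

text \<open>The imaginary part is a Poisson integral. Rescaling by the height turns it into an
  average of \<open>p\<close> around \<open>x\<close> with the fixed kernel
  \<open>inverse (1 + u^2)\<close> of mass \<open>pi\<close>, and dominated convergence applies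
  because \<open>p\<close> is bounded and continuous at \<open>x\<close>.\<close>

lemma stieltjes_boundary:
  assumes cont: "isCont p x"
  shows "(\<lambda>n. Im (stieltjes (of_real x + \<i> * of_real (1 / real (Suc n))))) \<longlonglongrightarrow> - (pi * p x)"
proof -
  have i1: "integrable lborel (\<lambda>u::real. inverse (1 + u^2))"
    using integrable_inverse_1_plus_square by (simp add: set_integrable_def einterval_def)
  have i2: "(\<integral>u. inverse (1 + u^2 :: real) \<partial>lborel) = pi"
    using LBINT_inverse_1_plus_square
    by (simp add: interval_lebesgue_integral_def set_lebesgue_integral_def einterval_def)
  have eq: "Im (stieltjes (of_real x + \<i> * of_real \<epsilon>)) = - (\<integral>u. p (x + \<epsilon> * u) * inverse (1 + u^2) \<partial>lborel)" if \<epsilon>: "\<epsilon> > 0" for \<epsilon>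
  proof -
    let ?z = "of_real x + \<i> * of_real \<epsilon> :: complex"
    have "?z \<notin> of_real ` J" using \<epsilon> by (auto simp: complex_eq_iff)
    then have "Im (stieltjes ?z) = (\<integral>y. Im (1 / (?z - of_real y)) \<partial>\<nu>)"
      unfolding stieltjes_def by (intro integral_Im[symmetric] integrable_cauchy_kernel)
    also have "\<dots> = (\<integral>y. - (\<epsilon> / ((x - y)^2 + \<epsilon>^2)) \<partial>\<nu>)"
      by (intro Bochner_Integration.integral_cong) (auto simp: Im_divide power2_eq_square)
    also have "\<dots> = (\<integral>y. p y * - (\<epsilon> / ((x - y)^2 + \<epsilon>^2)) \<partial>lborel)"
      unfolding law by (subst integral_density) (auto simp: p_nonneg)
    also have "\<dots> = \<bar>\<epsilon>\<bar> *\<^sub>R (\<integral>u. p (x + \<epsilon> * u) * - (\<epsilon> / ((x - (x + \<epsilon> * u))^2 + \<epsilon>^2)) \<partial>lborel)"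
      using \<epsilon> by (intro lborel_integral_real_affine) auto
    also have "\<dots> = (\<integral>u. \<epsilon> * (p (x + \<epsilon> * u) * - (\<epsilon> / ((x - (x + \<epsilon> * u))^2 + \<epsilon>^2))) \<partial>lborel)"
      using \<epsilon> by (simp only: abs_of_pos real_scaleR_def integral_mult_right_zero)
    also have "\<dots> = (\<integral>u. - (p (x + \<epsilon> * u) * inverse (1 + u^2)) \<partial>lborel)"
    proof (intro Bochner_Integration.integral_cong refl)
      fix u :: real
      have "(x - (x + \<epsilon> * u))^2 + \<epsilon>^2 = \<epsilon>^2 * (1 + u^2)" by (simp add: power2_eq_square algebra_simps)
      moreover have "1 + u^2 > 0" by (simp add: add_pos_nonneg)
      ultimately show "\<epsilon> * (p (x + \<epsilon> * u) * - (\<epsilon> / ((x - (x + \<epsilon> * u))^2 + \<epsilon>^2))) = - (p (x + \<epsilon> * u) * inverse (1 + u^2))"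
        using \<epsilon> by (simp add: power2_eq_square divide_simps)
    qed
    finally show ?thesis by simp
  qed
  have "(\<lambda>n. \<integral>u. p (x + 1 / real (Suc n) * u) * inverse (1 + u^2) \<partial>lborel) \<longlonglongrightarrow> (\<integral>u. p x * inverse (1 + u^2) \<partial>lborel)"
  proof (rule integral_dominated_convergence[where w="\<lambda>u. C * inverse (1 + u^2)"])
    show "integrable lborel (\<lambda>u. C * inverse (1 + u^2))" using i1 by simp
    show "AE u in lborel. (\<lambda>n. p (x + 1 / real (Suc n) * u) * inverse (1 + u^2)) \<longlonglongrightarrow> p x * inverse (1 + u^2)"
    proof (rule AE_I2)
      fix u :: real
      have "(\<lambda>n. x + 1 / real (Suc n) * u) \<longlonglongrightarrow> x + 0 * u"
        by (intro tendsto_intros LIMSEQ_Suc[OF lim_const_over_n])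
      then have "(\<lambda>n. p (x + 1 / real (Suc n) * u)) \<longlonglongrightarrow> p x"
        using isCont_tendsto_compose[OF cont] by simp
      then show "(\<lambda>n. p (x + 1 / real (Suc n) * u) * inverse (1 + u^2)) \<longlonglongrightarrow> p x * inverse (1 + u^2)"
        by (intro tendsto_intros)
    qed
    show "AE u in lborel. norm (p (x + 1 / real (Suc n) * u) * inverse (1 + u^2)) \<le> C * inverse (1 + u^2)" for n
      using p_nonneg p_le by (intro AE_I2) (auto simp: abs_mult intro!: mult_mono C_nonneg add_nonneg_nonneg)
  qed measurable
  then have "(\<lambda>n. - (\<integral>u. p (x + 1 / real (Suc n) * u) * inverse (1 + u^2) \<partial>lborel)) \<longlonglongrightarrow> - (p x * pi)"
    by (intro tendsto_minus) (simp add: i2)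
  then show ?thesis by (simp only: eq zero_less_divide_1_iff of_nat_0_less_iff zero_less_Suc mult.commute)
qed

end

locale supported_gas = equilibrium_gas Q \<nu> p C A + supported_law \<nu> p C A J for Q \<nu> p C A J

text \<open>The kernel \<open>k x = 1 / (z - x)\<close> has the divided difference
  \<open>k x * k y\<close>, so the double integral of the first variation factors into the square of
  the Stieltjes transform.\<close>

lemma (in supported_gas) loop_equation:
  fixes Q' :: "real \<Rightarrow> real"
  assumes expand: "h0 > 0" "\<And>x h. \<bar>x\<bar> \<le> A \<Longrightarrow> \<bar>h\<bar> \<le> h0 \<Longrightarrow> \<bar>Q (x + h) - Q x - h * Q' x\<bar> \<le> K * h^2"
    and Q': "continuous_on UNIV Q'" and z: "Im z \<noteq> 0"
  shows "stieltjes z ^ 2 = (\<integral>x. of_real (Q' x) / (z - of_real x) \<partial>\<nu>)"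
    and "integrable \<nu> (\<lambda>x. of_real (Q' x) / (z - of_real x) :: complex)"
proof -
  have nz: "z - of_real x \<noteq> 0" for x using z by (auto simp: complex_eq_iff)
  have [measurable]: "Q' \<in> borel_measurable borel" using Q' by (auto intro: borel_measurable_continuous_onI)
  define k where "k = (\<lambda>x. 1 / (z - complex_of_real x))"
  have [measurable]: "k \<in> borel_measurable borel" unfolding k_def by measurable
  have kc: "continuous_on UNIV k" unfolding k_def using nz by (intro continuous_intros) auto
  have kb: "norm (k x) \<le> 1 / \<bar>Im z\<bar>" for x
  proof -
    have "\<bar>Im z\<bar> \<le> norm (z - of_real x)" using abs_Im_le_cmod[of "z - of_real x"] by simp
    then show ?thesis using z by (simp add: k_def norm_divide frac_le)
  qed
  have kd: "k x - k y = of_real (x - y) * (k x * k y)" for x y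
    using nz[of x] nz[of y] by (simp add: k_def field_simps)
  have ki: "integrable \<nu> k" by (rule integrable_bounded[where B="1 / \<bar>Im z\<bar>"]) (use kb in auto)
  obtain Bq where Bq: "\<And>x. \<bar>x\<bar> \<le> A \<Longrightarrow> \<bar>Q' x\<bar> \<le> Bq" using continuous_bounded_abs[OF Q'] by blast
  have Qki: "integrable \<nu> (\<lambda>x. of_real (Q' x) * k x)"
  proof (rule integrable_bounded[where B="Bq * (1 / \<bar>Im z\<bar>)"])
    fix x assume "\<bar>x\<bar> \<le> A"
    then show "norm (of_real (Q' x) * k x) \<le> Bq * (1 / \<bar>Im z\<bar>)"
      using Bq[of x] kb[of x] unfolding norm_mult norm_of_real
      by (intro mult_mono) (auto intro: order_trans[OF abs_ge_zero])
  qed measurable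
  then show "integrable \<nu> (\<lambda>x. of_real (Q' x) / (z - of_real x) :: complex)" by (simp add: k_def)
  have kki: "integrable (\<nu> \<Otimes>\<^sub>M \<nu>) (\<lambda>q. k (fst q) * k (snd q))"
    by (rule integrable_pair_bounded[where B="(1 / \<bar>Im z\<bar>) * (1 / \<bar>Im z\<bar>)"])
       (use kb in \<open>auto simp only: norm_mult fst_conv snd_conv intro!: mult_mono borel_measurable_times measurable_compose[OF measurable_fst] measurable_compose[OF measurable_snd] norm_ge_zero divide_nonneg_nonneg abs_ge_zero zero_le_one \<open>k \<in> borel_measurable borel\<close>\<close>)
  have sq: "(\<integral>q. k (fst q) * k (snd q) \<partial>(\<nu> \<Otimes>\<^sub>M \<nu>)) = (\<integral>x. k x \<partial>\<nu>)^2"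
    using pair.integral_fst'[OF kki] ki by (simp add: power2_eq_square)
  have re: "Re (c * (\<integral>q. k (fst q) * k (snd q) \<partial>(\<nu> \<Otimes>\<^sub>M \<nu>))) = Re (c * (\<integral>x. of_real (Q' x) * k x \<partial>\<nu>))" for c
  proof -
    define \<phi> where "\<phi> x = Re (c * k x)" for x
    have d: "\<phi> x - \<phi> y = (x - y) * Re (c * (k x * k y))" for x y
    proof -
      have "\<phi> x - \<phi> y = Re (c * (k x - k y))" by (simp add: \<phi>_def algebra_simps)
      also have "c * (k x - k y) = of_real (x - y) * (c * (k x * k y))" unfolding kd by (simp add: algebra_simps)
      also have "Re \<dots> = (x - y) * Re (c * (k x * k y))" by simp
      finally show ?thesis .
    qed
    have "(\<integral>q. (\<phi> (fst q) - \<phi> (snd q)) / (fst q - snd q) \<partial>(\<nu> \<Otimes>\<^sub>M \<nu>)) = (\<integral>x. Q' x * \<phi> x \<partial>\<nu>)"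
    proof (rule first_variation[OF expand Q'])
      fix x y
      show "\<bar>\<phi> x\<bar> \<le> norm c * (1 / \<bar>Im z\<bar>)"
        unfolding \<phi>_def by (rule order_trans[OF abs_Re_le_cmod]) (simp only: norm_mult, intro mult_left_mono kb norm_ge_zero)
      have "\<bar>Re (c * (k x * k y))\<bar> \<le> norm c * ((1 / \<bar>Im z\<bar>) * (1 / \<bar>Im z\<bar>))"
        by (rule order_trans[OF abs_Re_le_cmod])
           (simp only: norm_mult, intro mult_left_mono mult_mono kb norm_ge_zero divide_nonneg_nonneg abs_ge_zero zero_le_one)
      then show "\<bar>\<phi> x - \<phi> y\<bar> \<le> (norm c * ((1 / \<bar>Im z\<bar>) * (1 / \<bar>Im z\<bar>))) * \<bar>x - y\<bar>"
        unfolding d abs_mult by (subst mult.commute) (intro mult_right_mono abs_ge_zero)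
      show "continuous_on UNIV \<phi>" unfolding \<phi>_def[abs_def] by (intro continuous_intros kc)
    qed
    moreover have "(\<integral>q. (\<phi> (fst q) - \<phi> (snd q)) / (fst q - snd q) \<partial>(\<nu> \<Otimes>\<^sub>M \<nu>)) = (\<integral>q. Re (c * (k (fst q) * k (snd q))) \<partial>(\<nu> \<Otimes>\<^sub>M \<nu>))"
    proof (rule integral_cong_AE)
      show "AE q in \<nu> \<Otimes>\<^sub>M \<nu>. (\<phi> (fst q) - \<phi> (snd q)) / (fst q - snd q) = Re (c * (k (fst q) * k (snd q)))"
        using AE_off_diagonal by eventually_elim (simp add: d)
      have [measurable]: "\<phi> \<in> borel_measurable borel" unfolding \<phi>_def[abs_def] by measurable
      show "(\<lambda>q. (\<phi> (fst q) - \<phi> (snd q)) / (fst q - snd q)) \<in> borel_measurable (\<nu> \<Otimes>\<^sub>M \<nu>)" by measurable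
    qed measurable
    moreover have "(\<integral>q. Re (c * (k (fst q) * k (snd q))) \<partial>(\<nu> \<Otimes>\<^sub>M \<nu>)) = Re (c * (\<integral>q. k (fst q) * k (snd q) \<partial>(\<nu> \<Otimes>\<^sub>M \<nu>)))"
      using kki by (subst integral_Re) auto
    moreover have "(\<integral>x. Q' x * \<phi> x \<partial>\<nu>) = (\<integral>x. Re (c * (of_real (Q' x) * k x)) \<partial>\<nu>)"
      by (intro Bochner_Integration.integral_cong refl) (simp add: \<phi>_def algebra_simps)
    moreover have "\<dots> = Re (c * (\<integral>x. of_real (Q' x) * k x \<partial>\<nu>))"
      using Qki by (subst integral_Re) auto
    ultimately show ?thesis by simp
  qed
  \<comment> \<open>\<open>c = 1\<close> compares the real parts, \<open>c = - \<i>\<close> the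
    imaginary parts.\<close>
  have "(\<integral>q. k (fst q) * k (snd q) \<partial>(\<nu> \<Otimes>\<^sub>M \<nu>)) = (\<integral>x. of_real (Q' x) * k x \<partial>\<nu>)"
    using re[of 1] re[of "- \<i>"] by (simp add: complex_eq_iff)
  then show "stieltjes z ^ 2 = (\<integral>x. of_real (Q' x) / (z - of_real x) \<partial>\<nu>)"
    unfolding sq by (simp add: stieltjes_def k_def)
qed

section \<open>The discriminant of the loop equation\<close>

locale analytic_gas = supported_gas Q \<nu> p C A J for Q \<nu> p C A J +
  fixes Q' :: "real \<Rightarrow> real" and h0 K M :: real and S :: "complex set" and vp :: "complex \<Rightarrow> complex"
  assumes expand: "h0 > 0" "\<And>x h. \<bar>x\<bar> \<le> A \<Longrightarrow> \<bar>h\<bar> \<le> h0 \<Longrightarrow> \<bar>Q (x + h) - Q x - h * Q' x\<bar> \<le> K * h^2"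
    and Q'_cont: "continuous_on UNIV Q'"
    and S: "open S" "convex S" "of_real ` {-A..A} \<subseteq> S"
    and vp: "vp holomorphic_on S" "\<And>z. z \<in> S \<Longrightarrow> norm (deriv vp z) \<le> M"
    and vp_real: "\<And>x. of_real x \<in> S \<Longrightarrow> vp (of_real x) = of_real (Q' x)"
begin

lemma Q'_measurable [measurable]: "Q' \<in> borel_measurable borel"
  using Q'_cont by (rule borel_measurable_continuous_onI)

lemma J_in_S: "y \<in> J \<Longrightarrow> complex_of_real y \<in> S"
  using J_sub S(3) by blast

text \<open>The divided difference of \<open>vp\<close> with its removable singularity filled in. At
  the real point it is written with \<open>Q'\<close>, which is measurable on the whole line,
  whereas \<open>vp\<close> is controlled on \<open>S\<close> only.\<close>

definition quot :: "complex \<Rightarrow> real \<Rightarrow> complex" where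
  "quot z y = (if z = of_real y then deriv vp (of_real y) else (vp z - of_real (Q' y)) / (z - of_real y))"

lemma quot_measurable:
  assumes "z \<in> S" shows "quot z \<in> borel_measurable borel"
proof -
  have "quot z = (\<lambda>y. if z = complex_of_real y then deriv vp z else (vp z - of_real (Q' y)) / (z - of_real y))"
    by (auto simp: quot_def fun_eq_iff)
  also have "\<dots> \<in> borel_measurable borel" by measurable
  finally show ?thesis .
qed

lemma quot_holomorphic:
  assumes "y \<in> J" shows "(\<lambda>z. quot z y) holomorphic_on S"
proof -
  have "(\<lambda>z. if z = of_real y then deriv vp (of_real y) else (vp z - vp (of_real y)) / (z - of_real y)) holomorphic_on S"
    by (rule pole_lemma_open[OF vp(1) S(1)])
  then show ?thesis unfolding quot_def vp_real[OF J_in_S[OF assms]] .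
qed

lemma quot_bound:
  assumes "y \<in> J" "z \<in> S" shows "norm (quot z y) \<le> M"
proof (cases "z = of_real y")
  case False
  have "norm (vp z - vp (of_real y)) \<le> M * norm (z - of_real y)"
    by (rule field_differentiable_bound[OF S(2)])
       (use assms J_in_S holomorphic_derivI[OF vp(1) S(1)] vp(2) in \<open>auto intro: DERIV_subset\<close>)
  then show ?thesis using False by (simp add: quot_def vp_real[OF J_in_S[OF assms(1)], symmetric] norm_divide divide_le_eq)
qed (use assms vp(2) in \<open>simp add: quot_def\<close>)

definition P :: "complex \<Rightarrow> complex" where "P z = (\<integral>y. quot z y \<partial>\<nu>)"

text \<open>The discriminant of the quadratic equation \<open>g^2 - vp * g + P = 0\<close> for the
  Stieltjes transform \<open>g\<close>. Unlike \<open>g\<close> it is holomorphic across the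
  support, because \<open>P\<close> averages bounded holomorphic divided differences.\<close>

definition D :: "complex \<Rightarrow> complex" where "D z = vp z ^ 2 - 4 * P z"

lemma P_holomorphic: "P holomorphic_on S"
  unfolding P_def[abs_def]
proof (rule holomorphic_on_integral_param)
  show "finite_measure \<nu>" by (rule finite_measure_axioms)
  show "quot w \<in> borel_measurable \<nu>" if "w \<in> S" for w using quot_measurable[OF that] by simp
  show "AE y in \<nu>. (\<lambda>w. quot w y) holomorphic_on S"
    using AE_support by eventually_elim (rule quot_holomorphic)
  fix w assume "w \<in> S"
  then obtain r where r: "r > 0" "ball w r \<subseteq> S" using S(1) open_contains_ball by blast
  moreover have "AE y in \<nu>. \<forall>w'\<in>ball w r. norm (quot w' y) \<le> M"
    using AE_support by eventually_elim (use r quot_bound in blast)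
  ultimately show "\<exists>r>0. \<exists>C. ball w r \<subseteq> S \<and> (AE y in \<nu>. \<forall>w'\<in>ball w r. norm (quot w' y) \<le> C)" by blast
qed (rule S(1))

lemma D_holomorphic: "D holomorphic_on S"
  unfolding D_def[abs_def] by (intro holomorphic_intros P_holomorphic vp)

lemma stieltjes_isCont: "z \<notin> of_real ` J \<Longrightarrow> isCont stieltjes z"
  by (rule continuous_on_interior[OF holomorphic_on_imp_continuous_on[OF stieltjes_holomorphic]])
     (simp add: interior_open open_Compl closed_cJ)

lemma holo_isCont: "f holomorphic_on S \<Longrightarrow> z \<in> S \<Longrightarrow> isCont f z"
  using holomorphic_on_imp_continuous_on[of f S] continuous_on_eq_continuous_at[OF S(1), of f] by blast

lemma vertical_limit: "(\<lambda>n. of_real x + \<i> * of_real (1 / real (Suc n))) \<longlonglongrightarrow> complex_of_real x"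
proof -
  have "(\<lambda>n. complex_of_real x + \<i> * of_real (1 / real (Suc n))) \<longlonglongrightarrow> of_real x + \<i> * of_real 0"
    by (intro tendsto_intros LIMSEQ_Suc[OF lim_const_over_n])
  then show ?thesis by simp
qed

lemma vertical_Im: "Im (of_real x + \<i> * of_real (1 / real (Suc n))) > 0"
  by (simp only: plus_complex.sel times_complex.sel imaginary_unit.sel Re_complex_of_real Im_complex_of_real) simp

lemma vertical_nonreal: "of_real x + \<i> * of_real (1 / real (Suc n)) \<notin> of_real ` J"
  using vertical_Im[of x n] by (metis Im_complex_of_real imageE less_irrefl)

text \<open>The loop equation is available off the real axis. Both sides are continuous on
  \<open>S\<close> away from the support, so the remaining real points are reached by vertical
  limits.\<close>

lemma D_eq_square:
  assumes z: "z \<in> S" "z \<notin> of_real ` J"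
  shows "D z = (vp z - 2 * stieltjes z)^2"
proof -
  have nonreal: "D z = (vp z - 2 * stieltjes z)^2" if z: "z \<in> S" "Im z \<noteq> 0" for z
  proof -
    have nz: "z - of_real x \<noteq> 0" for x using z by (auto simp: complex_eq_iff)
    have zJ: "z \<notin> of_real ` J" using z by auto
    note loop = loop_equation[OF expand Q'_cont z(2)]
    have "P z = (\<integral>y. vp z * (1 / (z - of_real y)) - of_real (Q' y) / (z - of_real y) \<partial>\<nu>)"
      unfolding P_def quot_def using nz
      by (intro Bochner_Integration.integral_cong refl) (auto simp: diff_divide_distrib)
    also have "\<dots> = (\<integral>y. vp z * (1 / (z - of_real y)) \<partial>\<nu>) - (\<integral>y. of_real (Q' y) / (z - of_real y) \<partial>\<nu>)"
      by (intro Bochner_Integration.integral_diff integrable_mult_right integrable_cauchy_kernel zJ loop(2))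
    also have "\<dots> = vp z * stieltjes z - stieltjes z ^ 2"
      by (simp only: integral_mult_right_zero stieltjes_def[symmetric] loop(1))
    finally have "P z = vp z * stieltjes z - stieltjes z ^ 2" .
    then have "D z = vp z ^ 2 - 4 * (vp z * stieltjes z - stieltjes z ^ 2)" unfolding D_def by (simp only:)
    then show ?thesis by (simp add: power2_eq_square algebra_simps)
  qed
  show ?thesis
  proof (cases "Im z = 0")
    case True
    define x where "x = Re z"
    have zx: "z = of_real x" using True by (simp add: x_def complex_eq_iff)
    let ?z = "\<lambda>n. of_real x + \<i> * of_real (1 / real (Suc n)) :: complex"
    have z_lim: "?z \<longlonglongrightarrow> z" unfolding zx by (rule vertical_limit)
    have "(\<lambda>n. D (?z n)) \<longlonglongrightarrow> D z"
      by (rule isCont_tendsto_compose[OF holo_isCont[OF D_holomorphic z(1)] z_lim])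
    moreover have "\<forall>\<^sub>F n in sequentially. ?z n \<in> S"
      by (rule topological_tendstoD[OF z_lim S(1) z(1)])
    then have "\<forall>\<^sub>F n in sequentially. D (?z n) = (vp (?z n) - 2 * stieltjes (?z n))^2"
      by eventually_elim (rule nonreal[OF _ less_imp_neq[OF vertical_Im, symmetric]])
    ultimately have "(\<lambda>n. (vp (?z n) - 2 * stieltjes (?z n))^2) \<longlonglongrightarrow> D z"
      by (rule Lim_transform_eventually)
    moreover have "(\<lambda>n. (vp (?z n) - 2 * stieltjes (?z n))^2) \<longlonglongrightarrow> (vp z - 2 * stieltjes z)^2"
      by (intro tendsto_power tendsto_diff tendsto_mult tendsto_const
          isCont_tendsto_compose[OF holo_isCont[OF vp(1) z(1)] z_lim] isCont_tendsto_compose[OF stieltjes_isCont[OF z(2)] z_lim])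
    ultimately show ?thesis by (rule LIMSEQ_unique)
  qed (use nonreal z in auto)
qed

text \<open>At a real point the divided differences are real for almost every \<open>y\<close>. In
  \<open>D_density\<close> this fixes the real part of the boundary values.\<close>

lemma D_real:
  assumes x: "of_real x \<in> S" shows "Im (D (of_real x)) = 0"
proof -
  have "P (of_real x) = (\<integral>y. of_real ((Q' x - Q' y) / (x - y)) \<partial>\<nu>)"
    unfolding P_def
  proof (rule integral_cong_AE)
    show "AE y in \<nu>. quot (of_real x) y = of_real ((Q' x - Q' y) / (x - y))"
      using AE_point_neq[of x] by eventually_elim (simp add: quot_def vp_real[OF x])
    show "quot (of_real x) \<in> borel_measurable \<nu>" using quot_measurable[OF x] by simp
  qed measurable
  also have "\<dots> = of_real (\<integral>y. (Q' x - Q' y) / (x - y) \<partial>\<nu>)" by (rule integral_complex_of_real)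
  finally show ?thesis by (simp add: D_def vp_real[OF x])
qed

text \<open>Above \<open>x\<close> the squares of \<open>\<zeta> n\<close> tend to a real number
  while \<open>Im (\<zeta> n)\<close> tends to \<open>2 * pi * p x > 0\<close>. Since the imaginary
  part of a square is twice the product of real and imaginary part, \<open>Re (\<zeta> n)\<close>
  tends to zero, and the density alone determines the limit.\<close>

lemma D_density:
  assumes x: "of_real x \<in> S" and p: "isCont p x" "p x > 0"
  shows "D (of_real x) = - of_real ((2 * pi * p x)^2)"
proof -
  let ?z = "\<lambda>n. of_real x + \<i> * of_real (1 / real (Suc n)) :: complex"
  define \<zeta> where "\<zeta> n = vp (?z n) - 2 * stieltjes (?z n)" for n
  define \<beta> where "\<beta> = 2 * pi * p x"
  have \<beta>: "\<beta> > 0" using p by (simp add: \<beta>_def)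
  have "(\<lambda>n. vp (?z n)) \<longlonglongrightarrow> vp (of_real x)"
    by (rule isCont_tendsto_compose[OF holo_isCont[OF vp(1) x] vertical_limit])
  then have "(\<lambda>n. Im (vp (?z n)) - 2 * Im (stieltjes (?z n))) \<longlonglongrightarrow> Im (vp (of_real x)) - 2 * - (pi * p x)"
    by (intro tendsto_intros stieltjes_boundary p)
  then have B: "(\<lambda>n. Im (\<zeta> n)) \<longlonglongrightarrow> \<beta>"
    by (simp add: \<zeta>_def \<beta>_def vp_real[OF x] mult.assoc)
  have "(\<lambda>n. D (?z n)) \<longlonglongrightarrow> D (of_real x)"
    by (rule isCont_tendsto_compose[OF holo_isCont[OF D_holomorphic x] vertical_limit])
  moreover have "\<forall>\<^sub>F n in sequentially. ?z n \<in> S"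
    by (rule topological_tendstoD[OF vertical_limit S(1) x])
  then have "\<forall>\<^sub>F n in sequentially. D (?z n) = \<zeta> n ^ 2"
    unfolding \<zeta>_def by eventually_elim (rule D_eq_square[OF _ vertical_nonreal])
  ultimately have lim: "(\<lambda>n. \<zeta> n ^ 2) \<longlonglongrightarrow> D (of_real x)" by (rule Lim_transform_eventually)
  have "(\<lambda>n. Im (\<zeta> n ^ 2)) \<longlonglongrightarrow> 0" using tendsto_Im[OF lim] D_real[OF x] by simp
  then have "(\<lambda>n. Im (\<zeta> n ^ 2) / (2 * Im (\<zeta> n))) \<longlonglongrightarrow> 0 / (2 * \<beta>)"
    by (intro tendsto_intros B) (use \<beta> in auto)
  moreover have "\<forall>\<^sub>F n in sequentially. Im (\<zeta> n) > 0" using B \<beta> by (rule order_tendstoD)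
  then have "\<forall>\<^sub>F n in sequentially. Im (\<zeta> n ^ 2) / (2 * Im (\<zeta> n)) = Re (\<zeta> n)"
    by eventually_elim (simp add: Im_power2)
  ultimately have "(\<lambda>n. Re (\<zeta> n)) \<longlonglongrightarrow> 0 / (2 * \<beta>)" by (rule Lim_transform_eventually)
  then have Ar: "(\<lambda>n. Re (\<zeta> n)) \<longlonglongrightarrow> 0" by simp
  have "(\<lambda>n. Re (\<zeta> n)^2 - Im (\<zeta> n)^2) \<longlonglongrightarrow> 0^2 - \<beta>^2" by (intro tendsto_intros Ar B)
  moreover have "(\<lambda>n. Re (\<zeta> n)^2 - Im (\<zeta> n)^2) \<longlonglongrightarrow> Re (D (of_real x))"
    using tendsto_Re[OF lim] by (simp add: Re_power2)
  ultimately have "0^2 - \<beta>^2 = Re (D (of_real x))" by (rule LIMSEQ_unique)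
  then have "Re (D (of_real x)) = - (\<beta>^2)" by simp
  then show ?thesis using D_real[OF x] by (simp add: complex_eq_iff \<beta>_def)
qed

end

section \<open>Continuation of the resolvent across the support\<close>

text \<open>The complement is the union of four convex sets: the parts of \<open>B\<close> above and
  below the real axis, left of \<open>a\<close> and right of \<open>b\<close>. They overlap near the
  two end points.\<close>

lemma connected_convex_minus_real_segment:
  fixes B :: "complex set"
  assumes B: "open B" "convex B" and I: "of_real ` {a..b} \<subseteq> B" and ab: "a \<le> b"
  shows "connected (B - of_real ` {a..b})"
proof -
  define U1 U2 U3 U4 where "U1 = B \<inter> {z. Im z > 0}" and "U2 = B \<inter> {z. Re z < a}" and "U3 = B \<inter> {z. Im z < 0}" and "U4 = B \<inter> {z. Re z > b}"
  have c: "connected U1" "connected U2" "connected U3" "connected U4"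
    unfolding U1_def U2_def U3_def U4_def
    by (intro convex_connected convex_Int B convex_halfspace_Im_gt convex_halfspace_Re_lt convex_halfspace_Im_lt convex_halfspace_Re_gt)+
  have "complex_of_real a \<in> B" "complex_of_real b \<in> B" using I ab by auto
  then obtain e1 e2 where e: "e1 > 0" "ball (complex_of_real a) e1 \<subseteq> B" "e2 > 0" "ball (complex_of_real b) e2 \<subseteq> B"
    using B(1) open_contains_ball by metis
  have pt: "Complex (x - d) d' \<in> ball (complex_of_real x) r" if "\<bar>d\<bar> < r / 2" "\<bar>d'\<bar> < r / 2" for x d d' r
  proof -
    have "dist (complex_of_real x) (Complex (x - d) d') \<le> \<bar>d\<bar> + \<bar>d'\<bar>"
      unfolding dist_norm by (rule order_trans[OF cmod_le]) simp
    then show ?thesis using that by simp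
  qed
  have n1: "U1 \<inter> U2 \<noteq> {}" and n2: "U3 \<inter> U2 \<noteq> {}" and n3: "U1 \<inter> U4 \<noteq> {}"
  proof -
    have "Complex (a - e1/4) (e1/4) \<in> U1 \<inter> U2" using e pt[of "e1/4" e1 "e1/4" a] by (auto simp: U1_def U2_def)
    then show "U1 \<inter> U2 \<noteq> {}" by blast
    have "Complex (a - e1/4) (-e1/4) \<in> U3 \<inter> U2" using e pt[of "e1/4" e1 "-e1/4" a] by (auto simp: U3_def U2_def)
    then show "U3 \<inter> U2 \<noteq> {}" by blast
    have "Complex (b - (-e2/4)) (e2/4) \<in> U1 \<inter> U4" using e pt[of "-e2/4" e2 "e2/4" b] by (auto simp: U1_def U4_def)
    then show "U1 \<inter> U4 \<noteq> {}" by blast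
  qed
  have "connected (U1 \<union> U2)" using c n1 by (intro connected_Un) auto
  then have "connected ((U1 \<union> U2) \<union> U3)" using connected_Un[OF _ c(3)] n2 by blast
  then have "connected (((U1 \<union> U2) \<union> U3) \<union> U4)" using connected_Un[OF _ c(4)] n3 by blast
  also have "((U1 \<union> U2) \<union> U3) \<union> U4 = B - of_real ` {a..b}"
  proof (intro equalityI subsetI)
    fix z assume z: "z \<in> B - of_real ` {a..b}"
    have "Im z = 0 \<Longrightarrow> z = of_real (Re z)" by (simp add: complex_eq_iff)
    then have "Im z = 0 \<Longrightarrow> Re z \<notin> {a..b}" using z by (metis DiffD2 image_eqI)
    then show "z \<in> ((U1 \<union> U2) \<union> U3) \<union> U4" using z by (auto simp: U1_def U2_def U3_def U4_def)
  qed (auto simp: U1_def U2_def U3_def U4_def)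
  finally show ?thesis .
qed

text \<open>The quotient is continuous with values in \<open>{1, -1}\<close>, hence constant on a
  connected set.\<close>

lemma equal_squares_constant_sign:
  fixes f u :: "complex \<Rightarrow> complex"
  assumes conn: "connected X" and f: "continuous_on X f" and u: "continuous_on X u"
    and nz: "\<And>z. z \<in> X \<Longrightarrow> u z \<noteq> 0" and sq: "\<And>z. z \<in> X \<Longrightarrow> f z ^ 2 = u z ^ 2"
  shows "\<exists>\<sigma>. \<forall>z\<in>X. f z = \<sigma> * u z"
proof -
  have "(\<lambda>z. f z / u z) ` X \<subseteq> {1, -1}"
  proof
    fix w assume "w \<in> (\<lambda>z. f z / u z) ` X"
    then obtain z where z: "z \<in> X" "w = f z / u z" by blast
    then have "w ^ 2 = 1" using sq[OF z(1)] nz[OF z(1)] by (simp add: power_divide)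
    then show "w \<in> {1, -1}" by (simp add: power2_eq_1_iff)
  qed
  then have "finite ((\<lambda>z. f z / u z) ` X)" by (rule finite_subset) simp
  then have "(\<lambda>z. f z / u z) constant_on X"
    by (intro continuous_finite_range_constant conn continuous_on_divide f u) (use nz in auto)
  then obtain \<sigma> where "\<And>z. z \<in> X \<Longrightarrow> f z / u z = \<sigma>" unfolding constant_on_def by blast
  then have "\<forall>z\<in>X. f z = \<sigma> * u z" using nz by (metis nonzero_divide_eq_eq)
  then show ?thesis by blast
qed

text \<open>The branch of the square root of (z - a) (z - b) with its cut on the segment from a to b and
  asymptotic to z at infinity.\<close>
definition seg_sqrt :: "complex \<Rightarrow> complex \<Rightarrow> complex \<Rightarrow> complex" where
  "seg_sqrt a b z = (z - b) * csqrt ((z - a) / (z - b))"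

text \<open>A nonpositive quotient \<open>t\<close> would exhibit \<open>z\<close> as the convex
  combination of \<open>a\<close> and \<open>b\<close> with weight \<open>- t / (1 - t)\<close> at
  \<open>b\<close>. The end points are complex here because they become so when the parameter leaves
  the real line.\<close>

lemma seg_sqrt_arg:
  fixes z a b :: complex
  assumes z: "z \<notin> closed_segment a b"
  shows "(z - a) / (z - b) \<notin> \<real>\<^sub>\<le>\<^sub>0"
proof
  assume "(z - a) / (z - b) \<in> \<real>\<^sub>\<le>\<^sub>0"
  then obtain t where t: "(z - a) / (z - b) = of_real t" "t \<le> 0"
    by (metis nonpos_Reals_cases)
  have zb: "z \<noteq> b" using z by auto
  then have eq: "z - a = of_real t * (z - b)" using t(1) nonzero_divide_eq_eq[of "z - b" "z - a" "of_real t"] by simp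
  define s where "s = - t / (1 - t)"
  have t1: "1 - t > 0" using t(2) by simp
  have s0: "0 \<le> s" unfolding s_def by (rule divide_nonneg_pos) (use t(2) t1 in auto)
  have s1: "s \<le> 1" unfolding s_def by (subst pos_divide_le_eq) (use t1 in auto)
  have "(1 - t) * s = - t" using t1 by (simp add: s_def)
  then have st: "(1 - complex_of_real t) * of_real s = - of_real t"
    by (metis of_real_1 of_real_diff of_real_minus of_real_mult)
  have nz: "1 - complex_of_real t \<noteq> 0" using t1 by (metis of_real_1 of_real_diff of_real_eq_0_iff less_irrefl)
  have "(1 - of_real t) * z = a - of_real t * b" using eq by (simp add: algebra_simps)
  also have "\<dots> = (1 - of_real t) * a - ((1 - of_real t) * of_real s) * a + ((1 - of_real t) * of_real s) * b"
    unfolding st by (simp add: algebra_simps)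
  also have "\<dots> = (1 - of_real t) * ((1 - s) *\<^sub>R a + s *\<^sub>R b)"
    by (simp add: scaleR_conv_of_real algebra_simps)
  finally have "z = (1 - s) *\<^sub>R a + s *\<^sub>R b" using nz by (metis mult_left_cancel)
  then show False using z s0 s1 by (auto simp: closed_segment_def)
qed

text \<open>All three arguments vary, so one statement gives holomorphy in the point as well as, for
  a fixed point, in end points that move with the parameter.\<close>

lemma seg_sqrt_holomorphic:
  assumes "f holomorphic_on X" "g holomorphic_on X" "k holomorphic_on X"
    and "\<And>x. x \<in> X \<Longrightarrow> k x \<notin> closed_segment (f x) (g x)"
  shows "(\<lambda>x. seg_sqrt (f x) (g x) (k x)) holomorphic_on X"
  unfolding seg_sqrt_def
proof (intro holomorphic_intros assms holomorphic_on_csqrt')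
  show "k x - g x \<noteq> 0" if "x \<in> X" for x using assms(4)[OF that] by auto
  show "(k x - f x) / (k x - g x) \<notin> \<real>\<^sub>\<le>\<^sub>0" if "x \<in> X" for x using seg_sqrt_arg assms(4)[OF that] by blast
qed

lemma seg_sqrt_square: "z \<noteq> b \<Longrightarrow> seg_sqrt a b z ^ 2 = (z - a) * (z - b)"
  unfolding seg_sqrt_def power_mult_distrib power2_csqrt by (simp add: power2_eq_square)

lemma seg_sqrt_nonzero: "z \<notin> closed_segment a b \<Longrightarrow> seg_sqrt a b z \<noteq> 0"
  by (auto simp: seg_sqrt_def)

lemma norm_seg_sqrt: "z \<noteq> b \<Longrightarrow> norm (seg_sqrt a b z) ^ 2 = norm (z - a) * norm (z - b)"
  by (metis seg_sqrt_square norm_power norm_mult)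

lemma convex_thickening:
  fixes K :: "complex set"
  assumes "convex K" shows "convex (\<Union>x\<in>K. ball x e)"
proof -
  have "(\<Union>x\<in>K. ball x e) = (\<Union>x\<in>K. \<Union>y\<in>ball 0 e. {x + y})"
  proof (intro equalityI subsetI)
    fix z assume "z \<in> (\<Union>x\<in>K. ball x e)"
    then obtain x where "x \<in> K" "z - x \<in> ball 0 e" by (auto simp: dist_norm norm_minus_commute)
    moreover have "z = x + (z - x)" by simp
    ultimately show "z \<in> (\<Union>x\<in>K. \<Union>y\<in>ball 0 e. {x + y})" by blast
  next
    fix z assume "z \<in> (\<Union>x\<in>K. \<Union>y\<in>ball 0 e. {x + y})"
    then obtain x y where "x \<in> K" "y \<in> ball 0 e" "z = x + y" by auto
    then show "z \<in> (\<Union>x\<in>K. ball x e)" by (intro UN_I[of x]) (auto simp: dist_norm)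
  qed
  then show ?thesis using convex_sums[OF assms convex_ball[of 0 e]] by simp
qed

lemma convex_open_nbhd:
  fixes K :: "complex set"
  assumes "compact K" "convex K" "open N" "K \<subseteq> N" "K \<noteq> {}"
  shows "\<exists>B. open B \<and> convex B \<and> K \<subseteq> B \<and> B \<subseteq> N"
proof -
  obtain e where e: "e > 0" "(\<Union>x\<in>K. ball x e) \<subseteq> N"
    using compact_subset_open_imp_ball_epsilon_subset[OF assms(1,3,4)] by blast
  have "convex (\<Union>x\<in>K. ball x e)" by (rule convex_thickening[OF assms(2)])
  moreover have "K \<subseteq> (\<Union>x\<in>K. ball x e)" using e(1) by auto
  moreover have "open (\<Union>x\<in>K. ball x e)" by auto
  ultimately show ?thesis using e(2) by (intro exI[of _ "\<Union>x\<in>K. ball x e"]) simp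
qed

lemma of_real_interval: "x \<le> y \<Longrightarrow> complex_of_real ` {x..y} = closed_segment (of_real x) (of_real y)"
  by (metis closed_segment_eq_real_ivl1 closed_segment_of_real)

lemma islimpt_of_real_interval:
  assumes "a < m" "m < (b::real)"
  shows "complex_of_real m islimpt (of_real ` {a<..<b})"
proof -
  have "m islimpt {a<..<b}" using assms by (simp add: islimpt_greaterThanLessThan1 interior_limit_point interior_open)
  then show ?thesis
    unfolding islimpt_approachable
    by (metis (no_types, lifting) dist_of_real imageI of_real_eq_iff)
qed

section \<open>Continuation across a union of intervals\<close>

locale interval_gas = analytic_gas Q \<nu> p C A J Q' h0 K M S vp
  for Q \<nu> p C A J Q' h0 K M S vp +
  fixes q :: nat and a b h :: "_ \<Rightarrow> real"
  assumes ab: "\<And>i. i < q \<Longrightarrow> a i < b i" and gaps: "\<And>i. Suc i < q \<Longrightarrow> b i < a (Suc i)" and q: "q \<ge> 1"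
    and J_def: "J = (\<Union>i<q. {a i..b i})"
    and h_analytic: "real_analytic_on h J" and h_pos: "\<And>x. x \<in> J \<Longrightarrow> h x > 0"
    and p_def: "p = (\<lambda>x. indicator J x * h x * sqrt \<bar>\<Prod>i<q. (x - a i) * (x - b i)\<bar> / (2 * pi))"
begin

lemma intervals_ordered: "i < j \<Longrightarrow> j < q \<Longrightarrow> b i < a j"
proof (induction j)
  case (Suc j)
  show ?case
  proof (cases "i = j")
    case True then show ?thesis using gaps Suc.prems by simp
  next
    case False
    then have "b i < a j" using Suc by simp
    also have "\<dots> < b j" using ab Suc.prems by simp
    also have "\<dots> < a (Suc j)" using gaps Suc.prems by simp
    finally show ?thesis .
  qed
qed simp

lemma intervals_unique: "i < q \<Longrightarrow> j < q \<Longrightarrow> x \<in> {a i..b i} \<Longrightarrow> x \<in> {a j..b j} \<Longrightarrow> i = j"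
  using intervals_ordered[of i j] intervals_ordered[of j i] by (metis atLeastAtMost_iff leD le_less_trans less_trans nat_neq_iff order_trans)

text \<open>A branch of the square root of \<open>RR\<close> whose cuts are exactly the support
  intervals; the principal root of \<open>RR\<close> would jump elsewhere too.\<close>

definition rr :: "complex \<Rightarrow> complex" where
  "rr z = (\<Prod>i<q. seg_sqrt (of_real (a i)) (of_real (b i)) z)"

definition RR :: "complex \<Rightarrow> complex" where
  "RR z = (\<Prod>i<q. (z - of_real (a i)) * (z - of_real (b i)))"

lemma in_segment_iff: "i < q \<Longrightarrow> closed_segment (complex_of_real (a i)) (of_real (b i)) = of_real ` {a i..b i}"
  using ab[of i] by (simp add: of_real_interval)

lemma outside_segment: "z \<notin> of_real ` J \<Longrightarrow> i < q \<Longrightarrow> z \<notin> closed_segment (complex_of_real (a i)) (of_real (b i))"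
  unfolding J_def using in_segment_iff[of i] by blast

lemma rr_holomorphic: "rr holomorphic_on - of_real ` J"
  unfolding rr_def[abs_def]
proof (rule holomorphic_on_prod)
  fix i assume "i \<in> {..<q}"
  then show "(\<lambda>z. seg_sqrt (of_real (a i)) (of_real (b i)) z) holomorphic_on - of_real ` J"
    using outside_segment
    by (intro seg_sqrt_holomorphic[of "\<lambda>_. of_real (a i)" _ "\<lambda>_. of_real (b i)" "\<lambda>z. z"]) auto
qed

lemma rr_nonzero: "z \<notin> of_real ` J \<Longrightarrow> rr z \<noteq> 0"
  unfolding rr_def using seg_sqrt_nonzero[OF outside_segment] by (simp add: prod_zero_iff)

lemma rr_square: "z \<notin> of_real ` J \<Longrightarrow> rr z ^ 2 = RR z"
  unfolding rr_def RR_def prod_power_distrib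
proof (intro prod.cong refl seg_sqrt_square)
  fix i assume z: "z \<notin> of_real ` J" "i \<in> {..<q}"
  have "complex_of_real (b i) \<in> closed_segment (of_real (a i)) (of_real (b i))" by simp
  then show "z \<noteq> of_real (b i)" using outside_segment[OF z(1)] z(2) by auto
qed

lemma RR_real: "RR (of_real x) = of_real (\<Prod>i<q. (x - a i) * (x - b i))"
  unfolding RR_def of_real_prod by simp

text \<open>Inside the i-th interval only the i-th factor changes sign between its two roots. This
  resolves the absolute value in the density into a polynomial, to which the identity theorem can be
  applied.\<close>

lemma RR_negative:
  assumes i: "i < q" and x: "a i < x" "x < b i"
  shows "(\<Prod>i<q. (x - a i) * (x - b i)) = - \<bar>\<Prod>i<q. (x - a i) * (x - b i)\<bar>"
proof -
  have "(\<Prod>j\<in>{..<q}-{i}. (x - a j) * (x - b j)) \<ge> 0"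
  proof (rule prod_nonneg)
    fix j assume j: "j \<in> {..<q} - {i}"
    then have "x < a j \<or> b j < x" using intervals_ordered[of i j] intervals_ordered[of j i] i x by (cases "i < j") auto
    moreover have "a j < b j" using ab j by auto
    ultimately have "(x - a j \<le> 0 \<and> x - b j \<le> 0) \<or> (0 \<le> x - a j \<and> 0 \<le> x - b j)" by auto
    then show "(x - a j) * (x - b j) \<ge> 0" by (auto intro: mult_nonneg_nonneg mult_nonpos_nonpos)
  qed
  moreover have "(x - a i) * (x - b i) \<le> 0" using x by (intro mult_nonneg_nonpos) auto
  ultimately have "(x - a i) * (x - b i) * (\<Prod>j\<in>{..<q}-{i}. (x - a j) * (x - b j)) \<le> 0"
    by (rule mult_nonpos_nonneg[rotated])
  then have "(\<Prod>i<q. (x - a i) * (x - b i)) \<le> 0" using i by (simp add: prod.remove[of "{..<q}" i])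
  then show ?thesis by simp
qed

text \<open>Near the i-th interval both sides of the conclusion have the same square, by the boundary values on
  the interval and the identity theorem, so their quotient is a constant sign.\<close>
lemma local_extension:
  assumes i: "i < q" and U: "open U" "of_real ` J \<subseteq> U" and G: "G holomorphic_on U"
    and Gh: "\<And>x. x \<in> J \<Longrightarrow> G (of_real x) = of_real (h x)"
  shows "\<exists>B \<sigma>. open B \<and> of_real ` {a i..b i} \<subseteq> B \<and> B \<subseteq> S \<inter> U \<and> B \<inter> of_real ` J \<subseteq> of_real ` {a i..b i} \<and>
     (\<forall>z\<in>B - of_real ` {a i..b i}. vp z - 2 * stieltjes z = \<sigma> * (G z * rr z))"
proof -
  let ?I = "\<lambda>j. complex_of_real ` {a j..b j}"
  \<comment> \<open>Zeros of \<open>G\<close> are excluded so that \<open>G * rr\<close> can be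
    divided by; the interval itself survives because \<open>h\<close> is positive there.\<close>
  define W where "W = U \<inter> G -` (- {0})"
  define N where "N = (S \<inter> U \<inter> W) - (\<Union>j\<in>{..<q}-{i}. ?I j)"
  have Icomp: "compact (?I j)" for j by (intro compact_continuous_image continuous_intros) auto
  have "open W" unfolding W_def
    by (rule continuous_open_preimage[OF holomorphic_on_imp_continuous_on[OF G] U(1)]) auto
  moreover have "closed (\<Union>j\<in>{..<q}-{i}. ?I j)" by (intro closed_UN) (auto intro: compact_imp_closed Icomp)
  ultimately have "open N" unfolding N_def using S(1) U(1) by (intro open_Diff open_Int)
  have IJ: "x \<in> {a i..b i} \<Longrightarrow> x \<in> J" for x using i unfolding J_def by auto
  have "?I i \<subseteq> N"
  proof
    fix z assume "z \<in> ?I i"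
    then obtain x where x: "x \<in> {a i..b i}" "z = of_real x" by auto
    have "G z \<noteq> 0" using Gh[OF IJ[OF x(1)]] h_pos[OF IJ[OF x(1)]] x by simp
    moreover have "z \<in> S" "z \<in> U" using J_in_S IJ x U(2) by auto
    moreover have "z \<notin> ?I j" if "j \<in> {..<q} - {i}" for j
      using intervals_unique[OF i, of j x] that x by auto
    ultimately show "z \<in> N" by (auto simp: N_def W_def)
  qed
  moreover have "convex (?I i)"
    using in_segment_iff[OF i] convex_closed_segment by metis
  moreover have "?I i \<noteq> {}" using ab[OF i] by auto
  ultimately obtain B where B: "open B" "convex B" "?I i \<subseteq> B" "B \<subseteq> N"
    using convex_open_nbhd[OF Icomp _ \<open>open N\<close>] by blast
  have BS: "B \<subseteq> S" "B \<subseteq> U" and G0: "\<And>z. z \<in> B \<Longrightarrow> G z \<noteq> 0" using B(4) by (auto simp: N_def W_def)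
  have BJ: "B \<inter> of_real ` J \<subseteq> ?I i"
  proof
    fix z assume z: "z \<in> B \<inter> of_real ` J"
    then obtain j where "j < q" "z \<in> ?I j" unfolding J_def by auto
    then show "z \<in> ?I i" using z B(4) by (cases "j = i") (auto simp: N_def)
  qed
  \<comment> \<open>Both terms are holomorphic across the interval and cancel on its interior, where
    \<open>D\<close> is given by the density; the midpoint is an accumulation point.\<close>
  have DG: "D z - G z ^ 2 * RR z = 0" if "z \<in> B" for z
  proof (rule analytic_continuation[of "\<lambda>z. D z - G z ^ 2 * RR z" B "of_real ` {a i<..<b i}" "of_real ((a i + b i)/2)"])
    have "RR holomorphic_on B" unfolding RR_def[abs_def] by (intro holomorphic_intros)
    moreover have "G holomorphic_on B" using G BS holomorphic_on_subset by blast
    moreover have "D holomorphic_on B" using D_holomorphic BS holomorphic_on_subset by blast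
    ultimately show "(\<lambda>z. D z - G z ^ 2 * RR z) holomorphic_on B" by (intro holomorphic_intros)
    show "connected B" using B convex_connected by blast
    show "of_real ` {a i<..<b i} \<subseteq> B" using B(3) by (auto simp: image_subset_iff)
    show "of_real ((a i + b i) / 2) \<in> B" using B(3) ab[OF i] by (intro subsetD[OF B(3)] imageI) (auto simp: field_simps)
    show "complex_of_real ((a i + b i) / 2) islimpt of_real ` {a i<..<b i}"
      using ab[OF i] by (intro islimpt_of_real_interval) (auto simp: field_simps)
    fix z assume "z \<in> complex_of_real ` {a i<..<b i}"
    then obtain x where x: "a i < x" "x < b i" "z = of_real x" by auto
    have xJ: "x \<in> J" using x by (intro IJ) auto
    have xS: "of_real x \<in> S" using xJ by (rule J_in_S)
    \<comment> \<open>\<open>h\<close> is known only through its analytic extension, so continuity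
      of \<open>p\<close> is read off from \<open>Re (G (of_real y))\<close>.\<close>
    have "continuous_on {a i<..<b i} p"
    proof (rule continuous_on_eq)
      have "continuous_on {a i<..<b i} (\<lambda>y. G (of_real y))"
        by (rule continuous_on_compose2[OF holomorphic_on_imp_continuous_on[OF G]])
           (use U(2) IJ in \<open>auto intro!: continuous_intros\<close>)
      then show "continuous_on {a i<..<b i} (\<lambda>y. Re (G (of_real y)) * sqrt \<bar>\<Prod>i<q. (y - a i) * (y - b i)\<bar> / (2 * pi))"
        by (intro continuous_intros) auto
      fix y assume y: "y \<in> {a i<..<b i}"
      then have "y \<in> J" by (intro IJ) auto
      then show "Re (G (of_real y)) * sqrt \<bar>\<Prod>i<q. (y - a i) * (y - b i)\<bar> / (2 * pi) = p y"
        by (simp add: p_def Gh)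
    qed
    then have pc: "isCont p x" using x by (simp add: continuous_on_eq_continuous_at)
    have px: "p x = h x * sqrt \<bar>\<Prod>i<q. (x - a i) * (x - b i)\<bar> / (2 * pi)" using xJ by (simp add: p_def)
    have "(\<Prod>i<q. (x - a i) * (x - b i)) \<noteq> 0"
    proof -
      have "(x - a j) * (x - b j) \<noteq> 0" if "j < q" for j
      proof
        assume "(x - a j) * (x - b j) = 0"
        then have "x \<in> {a j..b j}" using ab[OF that] by auto
        then have "j = i" using intervals_unique[OF that i] x by auto
        then show False using \<open>(x - a j) * (x - b j) = 0\<close> x by auto
      qed
      then show ?thesis by auto
    qed
    then have "p x > 0" unfolding px using h_pos[OF xJ] by (intro divide_pos_pos mult_pos_pos) auto
    then have "D z = - of_real ((2 * pi * p x)^2)" using D_density[OF xS pc] x by simp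
    also have "(2 * pi * p x)^2 = h x ^ 2 * \<bar>\<Prod>i<q. (x - a i) * (x - b i)\<bar>"
      unfolding px by (simp add: power_mult_distrib)
    also have "\<dots> = - (h x ^ 2 * (\<Prod>i<q. (x - a i) * (x - b i)))"
      using RR_negative[OF i x(1,2)] by simp
    finally show "D z - G z ^ 2 * RR z = 0"
      using Gh[OF xJ] RR_real[of x] x by simp
  qed (use B that in auto)
  have outB: "z \<notin> of_real ` J" if "z \<in> B - ?I i" for z using that BJ by blast
  have sub: "B - ?I i \<subseteq> - of_real ` J" using outB by blast
  have "\<exists>\<sigma>. \<forall>z\<in>B - ?I i. vp z - 2 * stieltjes z = \<sigma> * (G z * rr z)"
  proof (rule equal_squares_constant_sign)
    show "connected (B - ?I i)" using ab[OF i] by (intro connected_convex_minus_real_segment B) auto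
    have "vp holomorphic_on (B - ?I i)" "G holomorphic_on (B - ?I i)" using BS by (auto intro: holomorphic_on_subset[OF vp(1)] holomorphic_on_subset[OF G])
    moreover have "stieltjes holomorphic_on (B - ?I i)" "rr holomorphic_on (B - ?I i)"
      using sub by (auto intro: holomorphic_on_subset[OF stieltjes_holomorphic] holomorphic_on_subset[OF rr_holomorphic])
    ultimately show "continuous_on (B - ?I i) (\<lambda>z. vp z - 2 * stieltjes z)" "continuous_on (B - ?I i) (\<lambda>z. G z * rr z)"
      by (auto intro!: holomorphic_on_imp_continuous_on holomorphic_intros)
    fix z assume z: "z \<in> B - ?I i"
    show "G z * rr z \<noteq> 0" using G0 rr_nonzero[OF outB[OF z]] z by auto
    have "(vp z - 2 * stieltjes z)^2 = D z" using D_eq_square[of z] outB[OF z] z BS by auto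
    also have "\<dots> = (G z * rr z)^2" using DG[of z] z rr_square[OF outB[OF z]] by (simp add: power_mult_distrib)
    finally show "(vp z - 2 * stieltjes z)^2 = (G z * rr z)^2" .
  qed
  then show ?thesis using B BS BJ by blast
qed

text \<open>Off the support the quotient by \<open>rr\<close> is holomorphic; near the i-th interval
  it equals \<open>\<sigma> i * G\<close>, which continues over the cut. The signs may differ from
  interval to interval, and the pieces agree on the overlaps.\<close>

lemma resolvent_extension:
  "\<exists>H. H holomorphic_on S \<and> (\<forall>z\<in>S - of_real ` J. vp z - 2 * stieltjes z = H z * rr z)"
proof -
  let ?I = "\<lambda>j. complex_of_real ` {a j..b j}"
  obtain U G where U: "open U" "of_real ` J \<subseteq> U" and G: "G holomorphic_on U" "\<And>x. x \<in> J \<Longrightarrow> G (of_real x) = of_real (h x)"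
    using h_analytic unfolding real_analytic_on_def by blast
  have "\<forall>i\<in>{..<q}. \<exists>B \<sigma>. open B \<and> ?I i \<subseteq> B \<and> B \<subseteq> S \<inter> U \<and> B \<inter> of_real ` J \<subseteq> ?I i \<and>
     (\<forall>z\<in>B - ?I i. vp z - 2 * stieltjes z = \<sigma> * (G z * rr z))"
    using local_extension[OF _ U G] by auto
  then obtain B where "\<forall>i\<in>{..<q}. \<exists>\<sigma>. open (B i) \<and> ?I i \<subseteq> B i \<and> B i \<subseteq> S \<inter> U \<and> B i \<inter> of_real ` J \<subseteq> ?I i \<and>
     (\<forall>z\<in>B i - ?I i. vp z - 2 * stieltjes z = \<sigma> * (G z * rr z))"
    by (rule bchoice[THEN exE])
  then obtain \<sigma> where B\<sigma>: "\<forall>i\<in>{..<q}. open (B i) \<and> ?I i \<subseteq> B i \<and> B i \<subseteq> S \<inter> U \<and> B i \<inter> of_real ` J \<subseteq> ?I i \<and>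
     (\<forall>z\<in>B i - ?I i. vp z - 2 * stieltjes z = \<sigma> i * (G z * rr z))"
    by (rule bchoice[THEN exE])
  define idx where "idx z = (SOME i. i < q \<and> z \<in> ?I i)" for z
  have idx: "idx z = i" if "i < q" "z \<in> ?I i" for i z
  proof -
    have "idx z < q \<and> z \<in> ?I (idx z)" unfolding idx_def using that by (intro someI[of "\<lambda>i. i < q \<and> z \<in> ?I i"]) auto
    then show ?thesis using intervals_unique that by auto
  qed
  \<comment> \<open>On the cut itself the quotient carries the values of one side of the branch
    only, so the continued expression takes over. The index is well defined since the intervals are
    disjoint.\<close>
  define H where "H z = (if z \<in> of_real ` J then \<sigma> (idx z) * G z else (vp z - 2 * stieltjes z) / rr z)" for z
  have op: "open (S - of_real ` J)" using S(1) closed_cJ by (intro open_Diff)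
  have H1: "H holomorphic_on (S - of_real ` J)"
  proof (rule holomorphic_transform)
    show "(\<lambda>z. (vp z - 2 * stieltjes z) / rr z) holomorphic_on (S - of_real ` J)"
      by (intro holomorphic_intros holomorphic_on_subset[OF vp(1)] holomorphic_on_subset[OF stieltjes_holomorphic]
          holomorphic_on_subset[OF rr_holomorphic]) (auto simp: rr_nonzero)
  qed (auto simp: H_def)
  have H2: "H holomorphic_on B i" if i: "i \<in> {..<q}" for i
  proof (rule holomorphic_transform)
    show "(\<lambda>z. \<sigma> i * G z) holomorphic_on B i" using B\<sigma> i by (intro holomorphic_intros holomorphic_on_subset[OF G(1)]) auto
    fix z assume z: "z \<in> B i"
    show "\<sigma> i * G z = H z"
    proof (cases "z \<in> of_real ` J")
      case True
      then have "z \<in> ?I i" using B\<sigma> i z by blast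
      then show ?thesis using True idx i by (simp add: H_def)
    next
      case False
      then have "z \<notin> ?I i" using i unfolding J_def by auto
      then show ?thesis using False B\<sigma> i z rr_nonzero[OF False] by (simp add: H_def)
    qed
  qed
  have "H holomorphic_on (S - of_real ` J) \<union> (\<Union>i\<in>{..<q}. B i)"
    using B\<sigma> by (intro holomorphic_on_Un H1 holomorphic_on_UN_open H2 op) auto
  moreover have "S \<subseteq> (S - of_real ` J) \<union> (\<Union>i\<in>{..<q}. B i)" using B\<sigma> unfolding J_def by fastforce
  ultimately have "H holomorphic_on S" by (rule holomorphic_on_subset)
  then show ?thesis by (intro exI[of _ H]) (auto simp: H_def rr_nonzero)
qed

end

section \<open>Integrals against the equilibrium measure as contour integrals\<close>

definition rect :: "real \<Rightarrow> real \<Rightarrow> real \<Rightarrow> complex" where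
  "rect X Y = rectpath (Complex (-X) (-Y)) (Complex X Y)"

definition crect :: "real \<Rightarrow> real \<Rightarrow> complex set" where
  "crect X Y = {z. \<bar>Re z\<bar> \<le> X \<and> \<bar>Im z\<bar> \<le> Y}"

lemma rect_simps [simp]: "valid_path (rect X Y)" "path (rect X Y)" "pathfinish (rect X Y) = pathstart (rect X Y)"
  by (simp_all add: rect_def)

lemma crect_eq_cbox: "crect X Y = cbox (Complex (-X) (-Y)) (Complex X Y)"
  by (auto simp: crect_def in_cbox_complex_iff)

lemma convex_crect: "convex (crect X Y)" and compact_crect: "compact (crect X Y)"
  by (simp_all add: crect_eq_cbox compact_cbox)

lemma path_image_rect:
  assumes "X \<ge> 0" "Y \<ge> 0"
  shows "path_image (rect X Y) = {z. (\<bar>Re z\<bar> = X \<and> \<bar>Im z\<bar> \<le> Y) \<or> (\<bar>Im z\<bar> = Y \<and> \<bar>Re z\<bar> \<le> X)}"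
  using assms by (auto simp: rect_def path_image_rectpath abs_le_iff)

lemma path_image_rect_subset: "X \<ge> 0 \<Longrightarrow> Y \<ge> 0 \<Longrightarrow> path_image (rect X Y) \<subseteq> crect X Y"
  by (auto simp: path_image_rect crect_def)

lemma winding_number_rect:
  assumes "\<bar>Re z\<bar> < X" "\<bar>Im z\<bar> < Y"
  shows "winding_number (rect X Y) z = 1"
  unfolding rect_def using assms by (intro winding_number_rectpath) (auto simp: in_box_complex_iff)

lemma rect_scale: "rect (k * X) (k * Y) t = of_real k * rect X Y t"
  unfolding rect_def rectpath_def Let_def joinpaths_def linepath_def
  by (auto simp: complex_eq_iff algebra_simps)

lemma contour_integral_rect_bound:
  assumes f: "continuous_on (path_image (rect X Y)) f" and X: "X \<ge> 0" "Y \<ge> 0"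
    and B: "B \<ge> 0" "\<And>z. z \<in> path_image (rect X Y) \<Longrightarrow> norm (f z) \<le> B"
  shows "norm (contour_integral (rect X Y) f) \<le> B * (4 * (X + Y))"
proof -
  define a b c d where "a = Complex (-X) (-Y)" and "b = Complex X (-Y)" and "c = Complex X Y" and "d = Complex (-X) Y"
  note rp = contour_integral_rectpath[of a c f, unfolded a_def c_def complex.sel, folded rect_def a_def c_def b_def d_def, OF f]
  have seg: "norm (contour_integral (linepath x y) f) \<le> B * norm (y - x)"
    if sub: "closed_segment x y \<subseteq> path_image (rect X Y)" for x y
    using B sub by (intro contour_integral_bound_linepath contour_integrable_continuous_linepath continuous_on_subset[OF f]) auto
  have df: "b - a = of_real (2 * X)" "c - b = \<i> * of_real (2 * Y)" "d - c = - of_real (2 * X)" "a - d = - (\<i> * of_real (2 * Y))"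
    by (auto simp: a_def b_def c_def d_def complex_eq_iff)
  have len: "norm (b - a) = 2 * X" "norm (c - b) = 2 * Y" "norm (d - c) = 2 * X" "norm (a - d) = 2 * Y"
    unfolding df norm_minus_cancel norm_mult norm_of_real using X by simp_all
  have "norm (contour_integral (rect X Y) f) \<le> norm (contour_integral (linepath a b) f) + norm (contour_integral (linepath b c) f)
     + norm (contour_integral (linepath c d) f) + norm (contour_integral (linepath d a) f)"
    unfolding rp(1) by (intro order_trans[OF norm_triangle_ineq] add_mono order_refl)
  also have "\<dots> \<le> B * (2 * X) + B * (2 * Y) + B * (2 * X) + B * (2 * Y)"
    using seg[of a b] seg[of b c] seg[of c d] seg[of d a] rp(3) unfolding len by (intro add_mono) auto
  finally show ?thesis by (simp add: algebra_simps)
qed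

text \<open>Scaling the contour to infinity does not change the integral.\<close>
lemma contour_integral_rect_decay:
  assumes X: "0 \<le> X0" "X0 < X" and Y: "0 \<le> Y0" "Y0 < Y"
    and f: "f holomorphic_on - crect X0 Y0"
    and decay: "\<And>z. norm z \<ge> \<rho> \<Longrightarrow> z \<notin> crect X0 Y0 \<Longrightarrow> norm (f z) \<le> C / norm z ^ 2"
  shows "contour_integral (rect X Y) f = 0"
proof -
  define m where "m = min X Y"
  have m: "m > 0" using X Y by (simp add: m_def)
  have op: "open (- crect X0 Y0)" using compact_crect compact_imp_closed by blast
  have outside: "of_real s * z \<in> - crect X0 Y0" if "z \<in> path_image (rect X Y)" "s \<ge> 1" for z s
  proof -
    have "X \<le> s * X" "Y \<le> s * Y" using that X Y by (auto intro: mult_right_mono[of 1 s, simplified])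
    then have "X0 < s * X" "Y0 < s * Y" using X Y by linarith+
    then show ?thesis using that X Y by (auto simp: path_image_rect crect_def abs_mult)
  qed
  \<comment> \<open>The length of the scaled contour grows like \<open>k\<close> and the integrand
    decays like \<open>1/k^2\<close>, which leaves a bound of order \<open>1/k\<close>.\<close>
  have "norm (contour_integral (rect X Y) f) \<le> (\<bar>C\<bar> * 4 * (X + Y) / m^2) / k" if k: "k \<ge> max 1 (\<rho> / m)" for k
  proof -
    have k1: "k \<ge> 1" "\<rho> \<le> k * m" using k m by (auto simp: pos_divide_le_eq)
    have img: "path_image (rect (k * X) (k * Y)) = (\<lambda>z. of_real k * z) ` path_image (rect X Y)"
      unfolding path_image_def by (auto simp: rect_scale)
    have sub: "path_image (rect (k * X) (k * Y)) \<subseteq> - crect X0 Y0"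
      unfolding img using outside k1 by auto
    \<comment> \<open>Interpolating between a point and its \<open>k\<close>-fold multiple passes
      only through multiples by factors at least \<open>1\<close>, and these stay outside the inner
      rectangle.\<close>
    have "homotopic_loops (- crect X0 Y0) (rect X Y) (rect (k * X) (k * Y))"
    proof (rule homotopic_loops_linear)
      fix t x :: real assume t: "t \<in> {0..1}"
      show "closed_segment (rect X Y t) (rect (k * X) (k * Y) t) \<subseteq> - crect X0 Y0"
      proof
        fix w assume "w \<in> closed_segment (rect X Y t) (rect (k * X) (k * Y) t)"
        then obtain u where u: "0 \<le> u" "u \<le> 1" "w = (1 - u) *\<^sub>R rect X Y t + u *\<^sub>R rect (k * X) (k * Y) t"
          unfolding closed_segment_def by blast
        have "w = of_real (1 + u * (k - 1)) * rect X Y t"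
          unfolding u(3) rect_scale by (simp add: scaleR_conv_of_real algebra_simps)
        moreover have "1 + u * (k - 1) \<ge> 1" using u k1 by simp
        moreover have "rect X Y t \<in> path_image (rect X Y)" using t by (auto simp: path_image_def)
        ultimately show "w \<in> - crect X0 Y0" using outside by metis
      qed
    qed auto
    then have "contour_integral (rect X Y) f = contour_integral (rect (k * X) (k * Y)) f"
      by (rule Cauchy_theorem_homotopic_loops[OF _ op f]) auto
    also have "norm \<dots> \<le> (\<bar>C\<bar> / (k * m)^2) * (4 * (k * X + k * Y))"
    proof (rule contour_integral_rect_bound)
      show "continuous_on (path_image (rect (k * X) (k * Y))) f"
        by (intro holomorphic_on_imp_continuous_on holomorphic_on_subset[OF f] sub)
      fix z assume z: "z \<in> path_image (rect (k * X) (k * Y))"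
      have km: "k * m > 0" using k1 m by simp
      have "k * m \<le> k * X" "k * m \<le> k * Y" using k1 by (auto simp: m_def)
      moreover have "\<bar>Re z\<bar> = k * X \<or> \<bar>Im z\<bar> = k * Y"
        using z X Y k1 by (auto simp: path_image_rect)
      ultimately have "k * m \<le> norm z"
        using abs_Re_le_cmod[of z] abs_Im_le_cmod[of z] by linarith
      then have "norm (f z) \<le> C / norm z ^ 2" using z sub k1 by (intro decay) auto
      also have "\<dots> \<le> \<bar>C\<bar> / (k * m)^2"
        using \<open>k * m \<le> norm z\<close> km by (intro frac_le power_mono) auto
      finally show "norm (f z) \<le> \<bar>C\<bar> / (k * m)^2" .
    qed (use k1 X Y in auto)
    also have "\<dots> = (\<bar>C\<bar> * 4 * (X + Y) / m^2) / k" using k1 m by (simp add: power2_eq_square field_simps)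
    finally show ?thesis .
  qed
  then have ev: "\<forall>\<^sub>F k in at_top. norm (contour_integral (rect X Y) f) \<le> (\<bar>C\<bar> * 4 * (X + Y) / m^2) / k"
    using eventually_ge_at_top by (rule eventually_mono[rotated])
  have lim: "((\<lambda>k::real. (\<bar>C\<bar> * 4 * (X + Y) / m^2) / k) \<longlongrightarrow> 0) at_top"
    by (intro tendsto_divide_0[OF tendsto_const] filterlim_at_top_imp_at_infinity filterlim_ident)
  have "norm (contour_integral (rect X Y) f) \<le> 0"
    by (rule tendsto_le[OF trivial_limit_at_top_linorder lim tendsto_const ev])
  then show ?thesis by simp
qed

context interval_gas begin

text \<open>By Cauchy \<open>2 * pi * \<i>\<close> times the integral is the contour integral of
  \<open>f * stieltjes\<close>, and there \<open>stieltjes = (vp - H * rr) / 2\<close>, where the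
  \<open>vp\<close> part drops out. The outer contour gives \<open>2 * pi * \<i> * H z\<close>, so
  the constant is \<open>- 2 * (2 * pi * \<i>)^2 = 8 * pi^2\<close>.\<close>

lemma moment_formula:
  assumes X: "0 < A" "A < X1" "X1 < X2" and Y: "0 < Y1" "Y1 < Y2" and S2: "crect X2 Y2 \<subseteq> S"
    and f: "f holomorphic_on S" and fr: "continuous_on UNIV fr" "\<And>y. \<bar>y\<bar> \<le> A \<Longrightarrow> f (of_real y) = of_real (fr y)"
  shows "of_real (\<integral>y. fr y \<partial>\<nu>) = contour_integral (rect X1 Y1)
    (\<lambda>z. f z * rr z * contour_integral (rect X2 Y2) (\<lambda>s. vp s / (rr s * (s - z)))) / of_real (8 * pi^2)"
proof -
  obtain H where H: "H holomorphic_on S" and Heq: "\<And>z. z \<in> S - of_real ` J \<Longrightarrow> vp z - 2 * stieltjes z = H z * rr z"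
    using resolvent_extension by blast
  have Jc: "of_real ` J \<subseteq> crect A 0" using J_sub by (auto simp: crect_def abs_le_iff)
  have cr: "crect X1 Y1 \<subseteq> S" using S2 X Y by (auto simp: crect_def)
  have im1: "path_image (rect X1 Y1) \<subseteq> S - of_real ` J"
    using path_image_rect_subset[of X1 Y1] cr X Y Jc by (auto simp: path_image_rect crect_def subset_iff)
  have im2: "path_image (rect X2 Y2) \<subseteq> S - of_real ` J"
    using path_image_rect_subset[of X2 Y2] S2 X Y Jc by (auto simp: path_image_rect crect_def subset_iff)
  have holo2: "vp holomorphic_on S - of_real ` J" "stieltjes holomorphic_on S - of_real ` J" "rr holomorphic_on S - of_real ` J" "H holomorphic_on S - of_real ` J"
    by (auto intro: holomorphic_on_subset[OF vp(1)] holomorphic_on_subset[OF stieltjes_holomorphic] holomorphic_on_subset[OF rr_holomorphic] holomorphic_on_subset[OF H])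
  have op: "open (S - of_real ` J)" using S(1) closed_cJ by (intro open_Diff)
  \<comment> \<open>Since \<open>vp / rr = H + 2 * stieltjes / rr\<close>, the outer contour
    produces \<open>H z\<close> by Cauchy's formula and an integral that disappears at
    infinity.\<close>
  have Hz: "contour_integral (rect X2 Y2) (\<lambda>s. vp s / (rr s * (s - z))) = 2 * pi * \<i> * H z" if z: "z \<in> crect X1 Y1" for z
  proof -
    have zim: "z \<notin> path_image (rect X2 Y2)" using z X Y by (auto simp: path_image_rect crect_def)
    have zS: "z \<in> S" using cr z by auto
    have op': "open (S - of_real ` J - {z})" using op by (rule open_delete)
    have im2': "path_image (rect X2 Y2) \<subseteq> S - of_real ` J - {z}" using im2 zim by auto
    have nz: "rr s * (s - z) \<noteq> 0" if "s \<in> S - of_real ` J - {z}" for s using that rr_nonzero by auto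
    have i1: "(\<lambda>s. H s / (s - z)) contour_integrable_on rect X2 Y2"
      by (rule contour_integrable_holomorphic_simple[OF _ op' _ im2']) (auto intro!: holomorphic_intros holomorphic_on_subset[OF holo2(4)])
    have i2: "(\<lambda>s. stieltjes s / (rr s * (s - z))) contour_integrable_on rect X2 Y2"
      by (rule contour_integrable_holomorphic_simple[OF _ op' _ im2'])
         (use nz in \<open>auto intro!: holomorphic_intros holomorphic_on_subset[OF holo2(2)] holomorphic_on_subset[OF holo2(3)]\<close>)
    have "((\<lambda>s. H s / (s - z)) has_contour_integral (2 * pi * \<i> * winding_number (rect X2 Y2) z * H z)) (rect X2 Y2)"
      using zS S zim im2 by (intro Cauchy_integral_formula_convex_simple[OF S(2) H]) (auto simp: interior_open)
    moreover have "winding_number (rect X2 Y2) z = 1"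
      using z X Y by (intro winding_number_rect) (auto simp: crect_def)
    ultimately have c1: "contour_integral (rect X2 Y2) (\<lambda>s. H s / (s - z)) = 2 * pi * \<i> * H z"
      by (simp add: contour_integral_unique)
    have c2: "contour_integral (rect X2 Y2) (\<lambda>s. stieltjes s / (rr s * (s - z))) = 0"
    proof (rule contour_integral_rect_decay[of X1 X2 Y1 Y2])
      have sub: "- crect X1 Y1 \<subseteq> - of_real ` J" using Jc X Y by (auto simp: crect_def)
      have "s - z \<noteq> 0" if "s \<in> - crect X1 Y1" for s using that z by auto
      moreover have "rr s \<noteq> 0" if "s \<in> - crect X1 Y1" for s using that sub rr_nonzero by blast
      ultimately show "(\<lambda>s. stieltjes s / (rr s * (s - z))) holomorphic_on - crect X1 Y1"
        using sub
        by (intro holomorphic_intros holomorphic_on_subset[OF stieltjes_holomorphic] holomorphic_on_subset[OF rr_holomorphic]) auto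
      \<comment> \<open>The threshold makes \<open>norm (s - z)\<close> at least half of
        \<open>norm s\<close> and every factor of \<open>rr\<close> at least \<open>1\<close> in
        modulus, and it allows \<open>stieltjes_decay\<close>.\<close>
      fix s assume s: "2 * A + 2 + 2 * norm z \<le> norm s" "s \<notin> crect X1 Y1"
      have s0: "norm s > 0" using s X norm_ge_zero[of z] by linarith
      have s2: "2 * A \<le> norm s" using s X norm_ge_zero[of z] by linarith
      have g: "norm (stieltjes s) \<le> 2 / norm s" using s2 s0 X by (intro stieltjes_decay) auto
      have far: "norm (s - of_real x) \<ge> 1" if "\<bar>x\<bar> \<le> A" for x
      proof -
        have "norm s \<le> norm (s - of_real x) + norm (complex_of_real x)" by (metis diff_add_cancel norm_triangle_ineq)
        then show ?thesis using s that X norm_ge_zero[of z] unfolding norm_of_real by linarith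
      qed
      have sz: "norm (s - z) \<ge> norm s / 2"
      proof -
        have "norm s \<le> norm (s - z) + norm z" by (metis diff_add_cancel norm_triangle_ineq)
        then show ?thesis using s X by linarith
      qed
      have "1 \<le> norm (seg_sqrt (of_real (a i)) (of_real (b i)) s)" if i: "i < q" for i
      proof -
        have "a i \<in> J" "b i \<in> J" using i ab[OF i] unfolding J_def by force+
        then have "\<bar>a i\<bar> \<le> A" "\<bar>b i\<bar> \<le> A" using J_sub by (auto simp: abs_le_iff)
        then have fa: "norm (s - of_real (a i)) \<ge> 1" "norm (s - of_real (b i)) \<ge> 1" by (auto intro: far)
        then have "s \<noteq> of_real (b i)" by auto
        then have "norm (seg_sqrt (of_real (a i)) (of_real (b i)) s) ^ 2 \<ge> 1 * 1"
          unfolding norm_seg_sqrt[OF \<open>s \<noteq> of_real (b i)\<close>] using fa by (intro mult_mono) auto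
        then show ?thesis by (intro power2_le_imp_le[of 1]) auto
      qed
      then have rr1: "1 \<le> norm (rr s)" unfolding rr_def prod_norm[symmetric] by (intro prod_ge_1) auto
      have "norm (stieltjes s / (rr s * (s - z))) \<le> (2 / norm s) / (1 * (norm s / 2))"
        unfolding norm_divide norm_mult using g rr1 sz s0 by (intro frac_le mult_mono) auto
      then show "norm (stieltjes s / (rr s * (s - z))) \<le> 4 / norm s ^ 2"
        by (simp add: power2_eq_square)
    qed (use X Y in auto)
    have "contour_integral (rect X2 Y2) (\<lambda>s. vp s / (rr s * (s - z)))
       = contour_integral (rect X2 Y2) (\<lambda>s. H s / (s - z) + 2 * (stieltjes s / (rr s * (s - z))))"
    proof (rule contour_integral_cong[OF refl])
      fix s assume "s \<in> path_image (rect X2 Y2)"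
      then have s: "s \<in> S - of_real ` J" "s \<noteq> z" using im2 zim by auto
      then have "rr s \<noteq> 0" using rr_nonzero by auto
      have "vp s = H s * rr s + 2 * stieltjes s" using Heq[OF s(1)] by (simp add: algebra_simps)
      then show "vp s / (rr s * (s - z)) = H s / (s - z) + 2 * (stieltjes s / (rr s * (s - z)))"
        using \<open>rr s \<noteq> 0\<close> s(2) by (simp add: divide_simps)
    qed
    also have "\<dots> = 2 * pi * \<i> * H z"
      by (simp only: contour_integral_add[OF i1 contour_integrable_lmul[OF i2]] contour_integral_lmul[OF i2] c1 c2) simp
    finally show ?thesis .
  qed
  have holo1: "(\<lambda>s. f s * stieltjes s) holomorphic_on S - of_real ` J"
    by (intro holomorphic_intros holo2 holomorphic_on_subset[OF f]) auto
  have g_eq: "(\<lambda>y. f s / (s - of_real y)) = (\<lambda>y. f s * (1 / (s - of_real y)))" for s by auto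
  have gint: "(\<integral>y. f s / (s - of_real y) \<partial>\<nu>) = f s * stieltjes s" for s
    unfolding stieltjes_def g_eq by (rule integral_mult_right_zero)
  \<comment> \<open>Cauchy's formula for \<open>f\<close> at the points of the support, integrated
    against the law: Fubini replaces the kernel by the Stieltjes transform.\<close>
  have "(\<integral>y. 2 * pi * \<i> * of_real (fr y) \<partial>\<nu>) = contour_integral (rect X1 Y1) (\<lambda>s. \<integral>y. f s / (s - of_real y) \<partial>\<nu>)"
    unfolding rect_def
  proof (rule contour_integral_rectpath_law, fold rect_def)
    have nz: "s - complex_of_real y \<noteq> 0" if "s \<in> path_image (rect X1 Y1)" "y \<in> {-A..A}" for s y
      using that X Y by (auto simp: path_image_rect)
    have "continuous_on (path_image (rect X1 Y1) \<times> {-A..A}) (\<lambda>q. f (fst q))"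
      by (rule continuous_on_compose2[OF holomorphic_on_imp_continuous_on[OF f]]) (use im1 in \<open>auto intro!: continuous_intros\<close>)
    then show "continuous_on (path_image (rect X1 Y1) \<times> {-A..A}) (\<lambda>(s, y). f s / (s - complex_of_real y))"
      unfolding case_prod_unfold using nz by (intro continuous_intros) auto
    show "continuous_on (path_image (rect X1 Y1)) (\<lambda>s. \<integral>y. f s / (s - complex_of_real y) \<partial>\<nu>)"
      unfolding gint by (intro holomorphic_on_imp_continuous_on holomorphic_on_subset[OF holo1 im1])
    show "(\<lambda>y. 2 * pi * \<i> * of_real (fr y)) \<in> borel_measurable borel"
      using borel_measurable_continuous_onI[OF fr(1)] by measurable
    fix y assume y: "\<bar>y\<bar> \<le> A"
    have "of_real y \<in> S" using y S(3) by (auto simp: abs_le_iff)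
    moreover have "complex_of_real y \<notin> path_image (rect X1 Y1)" using y X Y by (auto simp: path_image_rect)
    ultimately have "((\<lambda>s. f s / (s - of_real y)) has_contour_integral (2 * pi * \<i> * winding_number (rect X1 Y1) (of_real y) * f (of_real y))) (rect X1 Y1)"
      using S im1 by (intro Cauchy_integral_formula_convex_simple[OF S(2) f]) (auto simp: interior_open)
    moreover have "winding_number (rect X1 Y1) (of_real y) = 1" using y X Y by (intro winding_number_rect) auto
    ultimately show "2 * pi * \<i> * of_real (fr y) = contour_integral (rect X1 Y1) (\<lambda>s. f s / (s - of_real y))"
      by (simp add: contour_integral_unique fr(2)[OF y])
  qed measurable
  also have "\<dots> = contour_integral (rect X1 Y1) (\<lambda>s. (1/2) * (f s * vp s) + (- (1/2)) * (f s * (H s * rr s)))"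
    unfolding gint
  proof (rule contour_integral_cong[OF refl])
    fix s assume "s \<in> path_image (rect X1 Y1)"
    then have "vp s - 2 * stieltjes s = H s * rr s" using im1 by (intro Heq) auto
    then have st: "stieltjes s = (vp s - H s * rr s) / 2" by (simp add: field_simps)
    show "f s * stieltjes s = (1/2) * (f s * vp s) + (- (1/2)) * (f s * (H s * rr s))"
      unfolding st by (simp add: algebra_simps diff_divide_distrib)
  qed
  also have "\<dots> = (1/2) * contour_integral (rect X1 Y1) (\<lambda>s. f s * vp s) + (- (1/2)) * contour_integral (rect X1 Y1) (\<lambda>s. f s * (H s * rr s))"
  proof -
    have ia: "(\<lambda>s. f s * vp s) contour_integrable_on rect X1 Y1"
      by (rule contour_integrable_holomorphic_simple[OF _ S(1)]) (use im1 f vp in \<open>auto intro!: holomorphic_intros\<close>)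
    have ib: "(\<lambda>s. f s * (H s * rr s)) contour_integrable_on rect X1 Y1"
      by (rule contour_integrable_holomorphic_simple[OF _ op _ im1]) (auto intro!: holomorphic_intros holo2 holomorphic_on_subset[OF f])
    show ?thesis
      by (simp only: contour_integral_add[OF contour_integrable_lmul[OF ia] contour_integrable_lmul[OF ib]]
          contour_integral_lmul[OF ia] contour_integral_lmul[OF ib])
  qed
  \<comment> \<open>\<open>f * vp\<close> is holomorphic inside the contour, so only the part that
    jumps across the support remains.\<close>
  also have "contour_integral (rect X1 Y1) (\<lambda>s. f s * vp s) = 0"
    by (rule contour_integral_unique[OF Cauchy_theorem_convex_simple[OF _ S(2)]])
       (use im1 f vp in \<open>auto intro!: holomorphic_intros\<close>)
  finally have main: "2 * pi * \<i> * of_real (\<integral>y. fr y \<partial>\<nu>) = - (1/2) * contour_integral (rect X1 Y1) (\<lambda>s. f s * (H s * rr s))"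
    by simp
  have "contour_integral (rect X1 Y1) (\<lambda>z. f z * rr z * contour_integral (rect X2 Y2) (\<lambda>s. vp s / (rr s * (s - z))))
     = contour_integral (rect X1 Y1) (\<lambda>z. (2 * pi * \<i>) * (f z * (H z * rr z)))"
  proof (rule contour_integral_cong[OF refl])
    fix z assume "z \<in> path_image (rect X1 Y1)"
    then have "z \<in> crect X1 Y1" using path_image_rect_subset[of X1 Y1] X Y by auto
    then show "f z * rr z * contour_integral (rect X2 Y2) (\<lambda>s. vp s / (rr s * (s - z))) = (2 * pi * \<i>) * (f z * (H z * rr z))"
      by (simp add: Hz)
  qed
  also have "\<dots> = (2 * pi * \<i>) * contour_integral (rect X1 Y1) (\<lambda>z. f z * (H z * rr z))"
    by (rule contour_integral_lmul[OF contour_integrable_holomorphic_simple[OF _ op _ im1]])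
       (auto intro!: holomorphic_intros holo2 holomorphic_on_subset[OF f])
  also have "contour_integral (rect X1 Y1) (\<lambda>z. f z * (H z * rr z)) = - 2 * (2 * pi * \<i> * of_real (\<integral>y. fr y \<partial>\<nu>))"
    using main by simp
  finally show ?thesis by (simp add: power2_eq_square field_simps)
qed

end

section \<open>Holomorphic dependence of the contour integrals on the parameter\<close>

lemma rect_gap:
  assumes z: "z \<in> path_image (rect X Y)" and w: "w \<in> crect X' Y'" and X: "0 \<le> X'" "X' + d \<le> X" and Y: "0 \<le> Y'" "Y' + d \<le> Y" and d: "d \<ge> 0"
  shows "d \<le> norm (z - w)"
proof -
  have "\<bar>Re z\<bar> = X \<or> \<bar>Im z\<bar> = Y" using z X Y d by (auto simp: path_image_rect)
  moreover have "\<bar>Re w\<bar> \<le> X'" "\<bar>Im w\<bar> \<le> Y'" using w by (auto simp: crect_def)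
  moreover have "\<bar>Re z - Re w\<bar> \<le> norm (z - w)" "\<bar>Im z - Im w\<bar> \<le> norm (z - w)"
    using abs_Re_le_cmod[of "z - w"] abs_Im_le_cmod[of "z - w"] by auto
  ultimately show ?thesis using X Y by linarith
qed

lemma holomorphic_on_cauchy_integral_rect:
  assumes X: "X \<ge> 0" "Y \<ge> 0" and f: "continuous_on (path_image (rect X Y)) f"
  shows "(\<lambda>z. contour_integral (rect X Y) (\<lambda>s. f s / (s - z))) holomorphic_on - path_image (rect X Y)"
proof -
  have cl: "closed (path_image (rect X Y))" by (intro closed_path_image) simp
  obtain B where B: "\<And>s. s \<in> path_image (rect X Y) \<Longrightarrow> norm (f s) \<le> B"
    using compact_imp_bounded[OF compact_continuous_image[OF f compact_path_image]] unfolding bounded_iff by (metis imageI rect_simps(2))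
  show ?thesis
    unfolding rect_def
  proof (rule holomorphic_on_contour_integral_param_rectpath, fold rect_def)
    show "open (- path_image (rect X Y))" using cl by auto
    show "continuous_on (path_image (rect X Y)) (\<lambda>s. f s / (s - w))" if "w \<in> - path_image (rect X Y)" for w
      using that by (intro continuous_intros f) auto
    show "(\<lambda>w. f s / (s - w)) holomorphic_on - path_image (rect X Y)" if "s \<in> path_image (rect X Y)" for s
      using that by (intro holomorphic_intros) auto
    fix w assume w: "w \<in> - path_image (rect X Y)"
    obtain e where e: "e > 0" "ball w e \<subseteq> - path_image (rect X Y)"
      using cl w by (metis open_Compl open_contains_ball)
    have "norm (f s / (s - w')) \<le> \<bar>B\<bar> / (e / 2)" if "w' \<in> ball w (e/2)" "s \<in> path_image (rect X Y)" for w' s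
    proof -
      have "s \<notin> ball w e" using e that by auto
      then have "e \<le> dist w w' + dist w' s" using dist_triangle[of w s w'] by simp
      then have "e / 2 \<le> norm (s - w')" using that by (simp add: dist_norm norm_minus_commute)
      then show ?thesis unfolding norm_divide using B[OF that(2)] e by (intro frac_le) auto
    qed
    moreover have "ball w (e/2) \<subseteq> - path_image (rect X Y)"
      by (rule order_trans[OF subset_ball e(2)]) (use e in simp)
    moreover have "e/2 > 0" using e by simp
    ultimately show "\<exists>r>0. \<exists>C. ball w r \<subseteq> - path_image (rect X Y) \<and> (\<forall>w'\<in>ball w r. \<forall>s\<in>path_image (rect X Y). norm (f s / (s - w')) \<le> C)"
      by blast
  qed
qed

text \<open>The contours are fixed while the end points move inside the smallest rectangle. The gap
  \<open>d\<close> keeps \<open>norm (s - z)\<close> and each \<open>seg_sqrt\<close> away from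
  zero, and \<open>L\<close> bounds the latter from above, uniformly in the parameter. Bounded
  integrands that are holomorphic in \<open>\<tau>\<close> then have holomorphic integrals.\<close>

lemma contour_family_holomorphic:
  fixes q :: nat and \<alpha> \<beta> :: "nat \<Rightarrow> complex \<Rightarrow> complex" and u v :: "complex \<Rightarrow> complex \<Rightarrow> complex"
  defines "R \<equiv> \<lambda>\<tau> z. \<Prod>i<q. seg_sqrt (\<alpha> i \<tau>) (\<beta> i \<tau>) z"
  assumes U: "open U" and d: "d > 0" and X: "0 \<le> X0" "X0 + d \<le> X1" "X1 + d \<le> X2" and Y: "0 \<le> Y0" "Y0 + d \<le> Y1" "Y1 + d \<le> Y2"
    and \<alpha>: "\<And>i. i < q \<Longrightarrow> \<alpha> i holomorphic_on U" "\<And>i \<tau>. i < q \<Longrightarrow> \<tau> \<in> U \<Longrightarrow> \<alpha> i \<tau> \<in> crect X0 Y0"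
    and \<beta>: "\<And>i. i < q \<Longrightarrow> \<beta> i holomorphic_on U" "\<And>i \<tau>. i < q \<Longrightarrow> \<tau> \<in> U \<Longrightarrow> \<beta> i \<tau> \<in> crect X0 Y0"
    and u: "\<And>z. z \<in> path_image (rect X1 Y1) \<Longrightarrow> (\<lambda>\<tau>. u \<tau> z) holomorphic_on U"
      "\<And>\<tau>. \<tau> \<in> U \<Longrightarrow> continuous_on (path_image (rect X1 Y1)) (u \<tau>)"
      "\<And>\<tau> z. \<tau> \<in> U \<Longrightarrow> z \<in> path_image (rect X1 Y1) \<Longrightarrow> norm (u \<tau> z) \<le> Bu"
    and v: "\<And>z. z \<in> path_image (rect X2 Y2) \<Longrightarrow> (\<lambda>\<tau>. v \<tau> z) holomorphic_on U"
      "\<And>\<tau>. \<tau> \<in> U \<Longrightarrow> continuous_on (path_image (rect X2 Y2)) (v \<tau>)"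
      "\<And>\<tau> z. \<tau> \<in> U \<Longrightarrow> z \<in> path_image (rect X2 Y2) \<Longrightarrow> norm (v \<tau> z) \<le> Bv"
  shows "(\<lambda>\<tau>. contour_integral (rect X1 Y1) (\<lambda>z. u \<tau> z * R \<tau> z *
     contour_integral (rect X2 Y2) (\<lambda>s. v \<tau> s / (R \<tau> s * (s - z))))) holomorphic_on U"
proof -
  let ?P1 = "path_image (rect X1 Y1)" and ?P2 = "path_image (rect X2 Y2)"
  have P1: "?P1 \<subseteq> crect X1 Y1" and P2: "?P2 \<subseteq> crect X2 Y2" using X Y d by (auto intro!: path_image_rect_subset[THEN subsetD])
  have far: "d \<le> norm (z - w)" if "z \<in> ?P1 \<union> ?P2" "w \<in> crect X0 Y0" for z w
    using that rect_gap[of z X1 Y1 w X0 Y0 d] rect_gap[of z X2 Y2 w X0 Y0 d] X Y d by auto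
  have far2: "d \<le> norm (s - z)" if "s \<in> ?P2" "z \<in> ?P1" for s z
    using that rect_gap[of s X2 Y2 z X1 Y1 d] X Y d P1 by auto
  define L where "L = 4 * (X2 + Y2) + 1"
  have near: "norm (z - w) \<le> L" if "z \<in> ?P1 \<union> ?P2" "w \<in> crect X0 Y0" for z w
  proof -
    have "\<bar>Re z\<bar> \<le> X2" "\<bar>Im z\<bar> \<le> Y2" using that(1) P1 P2 X Y d by (auto simp: crect_def)
    moreover have "\<bar>Re w\<bar> \<le> X2" "\<bar>Im w\<bar> \<le> Y2" using that(2) X Y d by (auto simp: crect_def)
    moreover have "norm (z - w) \<le> \<bar>Re (z - w)\<bar> + \<bar>Im (z - w)\<bar>" by (rule cmod_le)
    ultimately show ?thesis unfolding L_def by simp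
  qed
  have outside: "z \<notin> closed_segment (\<alpha> i \<tau>) (\<beta> i \<tau>)" if "i < q" "\<tau> \<in> U" "z \<in> - crect X0 Y0" for i \<tau> z
    using closed_segment_subset[OF \<alpha>(2)[OF that(1,2)] \<beta>(2)[OF that(1,2)] convex_crect] that(3) by blast
  have out: "z \<in> - crect X0 Y0" if "z \<in> ?P1 \<union> ?P2" for z using far[OF that, of z] d by auto
  have sqb: "d \<le> norm (seg_sqrt (\<alpha> i \<tau>) (\<beta> i \<tau>) z) \<and> norm (seg_sqrt (\<alpha> i \<tau>) (\<beta> i \<tau>) z) \<le> L"
    if "i < q" "\<tau> \<in> U" "z \<in> ?P1 \<union> ?P2" for i \<tau> z
  proof -
    have "z \<noteq> \<beta> i \<tau>" using outside[OF that(1,2) out[OF that(3)]] by auto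
    then have sq: "norm (seg_sqrt (\<alpha> i \<tau>) (\<beta> i \<tau>) z) ^ 2 = norm (z - \<alpha> i \<tau>) * norm (z - \<beta> i \<tau>)" by (rule norm_seg_sqrt)
    have b: "d \<le> norm (z - \<alpha> i \<tau>)" "d \<le> norm (z - \<beta> i \<tau>)" "norm (z - \<alpha> i \<tau>) \<le> L" "norm (z - \<beta> i \<tau>) \<le> L"
      using that \<alpha>(2) \<beta>(2) by (auto intro: far near)
    then have L0: "0 \<le> L" using d by linarith
    have "d^2 \<le> norm (z - \<alpha> i \<tau>) * norm (z - \<beta> i \<tau>)"
      unfolding power2_eq_square using b d by (intro mult_mono) auto
    moreover have "norm (z - \<alpha> i \<tau>) * norm (z - \<beta> i \<tau>) \<le> L^2"
      unfolding power2_eq_square using b L0 by (intro mult_mono) auto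
    ultimately have "d^2 \<le> norm (seg_sqrt (\<alpha> i \<tau>) (\<beta> i \<tau>) z) ^ 2" "norm (seg_sqrt (\<alpha> i \<tau>) (\<beta> i \<tau>) z) ^ 2 \<le> L^2"
      unfolding sq by simp_all
    then show ?thesis using L0 by (auto intro: power2_le_imp_le)
  qed
  have Rb: "d ^ q \<le> norm (R \<tau> z)" "norm (R \<tau> z) \<le> L ^ q" if "\<tau> \<in> U" "z \<in> ?P1 \<union> ?P2" for \<tau> z
  proof -
    have "(\<Prod>i<q. d) \<le> (\<Prod>i<q. norm (seg_sqrt (\<alpha> i \<tau>) (\<beta> i \<tau>) z))"
      using sqb[OF _ that] d by (intro prod_mono) auto
    then show "d ^ q \<le> norm (R \<tau> z)" by (simp add: R_def prod_norm)
    have "(\<Prod>i<q. norm (seg_sqrt (\<alpha> i \<tau>) (\<beta> i \<tau>) z)) \<le> (\<Prod>i<q. L)"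
      using sqb[OF _ that] by (intro prod_mono) auto
    then show "norm (R \<tau> z) \<le> L ^ q" by (simp add: R_def prod_norm)
  qed
  have dq: "d ^ q > 0" using d by simp
  have R0: "R \<tau> z \<noteq> 0" if "\<tau> \<in> U" "z \<in> ?P1 \<union> ?P2" for \<tau> z using Rb(1)[OF that] dq by auto
  have Rt: "(\<lambda>\<tau>. R \<tau> z) holomorphic_on U" if "z \<in> ?P1 \<union> ?P2" for z
    unfolding R_def
  proof (rule holomorphic_on_prod)
    fix i assume "i \<in> {..<q}"
    then show "(\<lambda>\<tau>. seg_sqrt (\<alpha> i \<tau>) (\<beta> i \<tau>) z) holomorphic_on U"
      using outside out[OF that] \<alpha>(1) \<beta>(1) by (intro seg_sqrt_holomorphic[of "\<alpha> i" U "\<beta> i" "\<lambda>_. z"]) auto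
  qed
  have Rz: "R \<tau> holomorphic_on - crect X0 Y0" if "\<tau> \<in> U" for \<tau>
    unfolding R_def
  proof (rule holomorphic_on_prod)
    fix i assume "i \<in> {..<q}"
    then show "(\<lambda>z. seg_sqrt (\<alpha> i \<tau>) (\<beta> i \<tau>) z) holomorphic_on - crect X0 Y0"
      using outside that by (intro seg_sqrt_holomorphic[of "\<lambda>_. \<alpha> i \<tau>" _ "\<lambda>_. \<beta> i \<tau>" "\<lambda>z. z"]) auto
  qed
  have Rc: "continuous_on P (R \<tau>)" if "\<tau> \<in> U" "P \<subseteq> ?P1 \<union> ?P2" for \<tau> P
    using that out by (intro continuous_on_subset[OF holomorphic_on_imp_continuous_on[OF Rz]]) auto
  define CC where "CC \<tau> z = contour_integral (rect X2 Y2) (\<lambda>s. v \<tau> s / (R \<tau> s * (s - z)))" for \<tau> z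
  have cont2: "continuous_on ?P2 (\<lambda>s. v \<tau> s / (R \<tau> s * (s - z)))" if "\<tau> \<in> U" "z \<in> ?P1" for \<tau> z
    using that R0 far2 d by (intro continuous_intros v(2) Rc) fastforce+
  have Bv0: "0 \<le> \<bar>Bv\<bar> / (d ^ q * d)" using dq d by simp
  have bnd2: "norm (v \<tau> s / (R \<tau> s * (s - z))) \<le> \<bar>Bv\<bar> / (d ^ q * d)" if "\<tau> \<in> U" "s \<in> ?P2" "z \<in> ?P1" for \<tau> s z
    unfolding norm_divide norm_mult using v(3)[OF that(1,2)] Rb(1)[OF that(1)] far2[OF that(2,3)] that dq d
    by (intro frac_le mult_mono) auto
  have ball: "\<exists>r>0. ball w r \<subseteq> U" if "w \<in> U" for w using U that open_contains_ball by blast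
  have CCt: "(\<lambda>\<tau>. CC \<tau> z) holomorphic_on U" if z: "z \<in> ?P1" for z
    unfolding CC_def rect_def
  proof (rule holomorphic_on_contour_integral_param_rectpath[OF U], fold rect_def)
    show "continuous_on ?P2 (\<lambda>s. v w s / (R w s * (s - z)))" if "w \<in> U" for w by (rule cont2[OF that z])
    fix s assume s: "s \<in> ?P2"
    have "s - z \<noteq> 0" using far2[OF s z] d by auto
    then show "(\<lambda>w. v w s / (R w s * (s - z))) holomorphic_on U"
      using s R0 by (intro holomorphic_intros v(1) Rt) auto
  next
    fix w assume "w \<in> U"
    then show "\<exists>r>0. \<exists>C. ball w r \<subseteq> U \<and> (\<forall>w'\<in>ball w r. \<forall>s\<in>?P2. norm (v w' s / (R w' s * (s - z))) \<le> C)"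
      using ball bnd2 z by (meson subsetD)
  qed
  have CCc: "continuous_on ?P1 (CC \<tau>)" if "\<tau> \<in> U" for \<tau>
  proof -
    \<comment> \<open>As a Cauchy-type integral the inner contour integral is holomorphic in
      \<open>z\<close> off the outer rectangle, which gives its continuity on the inner one.\<close>
    have "(\<lambda>z. contour_integral (rect X2 Y2) (\<lambda>s. (v \<tau> s / R \<tau> s) / (s - z))) holomorphic_on - ?P2"
      using that R0 X Y d by (intro holomorphic_on_cauchy_integral_rect continuous_intros v(2) Rc) auto
    then have "CC \<tau> holomorphic_on - ?P2" by (simp add: CC_def[abs_def])
    moreover have "?P1 \<subseteq> - ?P2" using far2 d by fastforce
    ultimately show ?thesis using holomorphic_on_imp_continuous_on holomorphic_on_subset by blast
  qed
  have CCb: "norm (CC \<tau> z) \<le> \<bar>Bv\<bar> / (d ^ q * d) * (4 * (X2 + Y2))" if "\<tau> \<in> U" "z \<in> ?P1" for \<tau> z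
    unfolding CC_def using that X Y d
    by (intro contour_integral_rect_bound cont2 Bv0 bnd2) auto
  show ?thesis
    unfolding CC_def[symmetric] unfolding rect_def[of X1]
  proof (rule holomorphic_on_contour_integral_param_rectpath[OF U], fold rect_def)
    show "continuous_on ?P1 (\<lambda>z. u w z * R w z * CC w z)" if "w \<in> U" for w
      using that by (intro continuous_intros u(2) Rc CCc) auto
    show "(\<lambda>w. u w z * R w z * CC w z) holomorphic_on U" if "z \<in> ?P1" for z
      using that by (intro holomorphic_intros u(1) Rt CCt) auto
    fix w assume "w \<in> U"
    then obtain r where r: "r > 0" "ball w r \<subseteq> U" using ball by blast
    have "norm (u w' z * R w' z * CC w' z) \<le> \<bar>Bu\<bar> * L ^ q * (\<bar>Bv\<bar> / (d ^ q * d) * (4 * (X2 + Y2)))"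
      if "w' \<in> ball w r" "z \<in> ?P1" for w' z
    proof -
      have w': "w' \<in> U" using that r by auto
      have "norm (u w' z) \<le> \<bar>Bu\<bar>" using u(3)[OF w' that(2)] by linarith
      moreover have "0 \<le> L ^ q" using Rb(2)[OF w', of z] that(2) norm_ge_zero order_trans by blast
      ultimately show ?thesis unfolding norm_mult using Rb(2)[OF w', of z] CCb[OF w' that(2)] that(2)
        by (intro mult_mono) auto
    qed
    then show "\<exists>r>0. \<exists>C. ball w r \<subseteq> U \<and> (\<forall>w'\<in>ball w r. \<forall>s\<in>?P1. norm (u w' s * R w' s * CC w' s) \<le> C)"
      using r by blast
  qed
qed

text \<open>The difference quotients in \<open>z\<close> are holomorphic in \<open>\<tau>\<close>,
  and the second-order bound makes their convergence uniform in \<open>\<tau>\<close>. So holomorphy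
  passes to the derivative from holomorphy in each variable and a common bound.\<close>

lemma deriv_family_holomorphic:
  fixes W :: "complex \<Rightarrow> complex \<Rightarrow> complex"
  assumes U: "open U" and r: "r > 0"
    and hz: "\<And>\<tau>. \<tau> \<in> U \<Longrightarrow> (\<lambda>z. W z \<tau>) holomorphic_on ball z0 (3 * r)"
    and ht: "\<And>z. z \<in> ball z0 (3 * r) \<Longrightarrow> (\<lambda>\<tau>. W z \<tau>) holomorphic_on U"
    and B: "\<And>z \<tau>. z \<in> ball z0 (3 * r) \<Longrightarrow> \<tau> \<in> U \<Longrightarrow> norm (W z \<tau>) \<le> B"
  shows "(\<lambda>\<tau>. deriv (\<lambda>z. W z \<tau>) z0) holomorphic_on U"
proof (rule holomorphic_uniform_sequence[OF U])
  \<comment> \<open>The factor \<open>2\<close> keeps even the first increment strictly inside the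
    radius \<open>r\<close>.\<close>
  define h where "h n = complex_of_real (r / (2 * real (Suc n)))" for n
  have nh: "norm (h n) = r / (2 * real (Suc n))" for n using r unfolding h_def norm_of_real by simp
  have hr: "norm (h n) < r" for n
  proof -
    have "r * 1 < r * (2 * real (Suc n))" using r by (intro mult_strict_left_mono) auto
    then show ?thesis unfolding nh by (simp add: pos_divide_less_eq)
  qed
  have h0: "h n \<noteq> 0" for n using r unfolding h_def by (simp del: of_nat_Suc)
  define F where "F n \<tau> = (W (z0 + h n) \<tau> - W z0 \<tau>) / h n" for n \<tau>
  have inb: "z0 + h n \<in> ball z0 (3 * r)" "z0 \<in> ball z0 (3 * r)" for n
    using hr[of n] r by (auto simp: dist_norm)
  show "F n holomorphic_on U" for n
    unfolding F_def[abs_def] using h0[of n] by (intro holomorphic_intros ht inb) auto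
  have est: "norm (F n \<tau> - deriv (\<lambda>z. W z \<tau>) z0) \<le> 2 * B / r^2 * norm (h n)" if \<tau>: "\<tau> \<in> U" for n \<tau>
  proof -
    have "norm (W (z0 + h n) \<tau> - W z0 \<tau> - deriv (\<lambda>z. W z \<tau>) z0 * (z0 + h n - z0)) \<le> 2 * B / r^2 * norm (z0 + h n - z0)^2"
      by (rule holomorphic_second_order_bound[OF hz[OF \<tau>] r B[OF _ \<tau>]]) (use hr[of n] in \<open>auto simp: dist_norm\<close>)
    then have "norm (W (z0 + h n) \<tau> - W z0 \<tau> - deriv (\<lambda>z. W z \<tau>) z0 * h n) \<le> 2 * B / r^2 * norm (h n)^2" by simp
    moreover have "(F n \<tau> - deriv (\<lambda>z. W z \<tau>) z0) * h n = W (z0 + h n) \<tau> - W z0 \<tau> - deriv (\<lambda>z. W z \<tau>) z0 * h n"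
      unfolding F_def left_diff_distrib using h0[of n] by simp
    ultimately have "norm ((F n \<tau> - deriv (\<lambda>z. W z \<tau>) z0) * h n) \<le> (2 * B / r^2 * norm (h n)) * norm (h n)"
      by (simp only: power2_eq_square mult.assoc)
    then show ?thesis unfolding norm_mult by (rule mult_right_le_imp_le) (use h0[of n] in simp)
  qed
  have hlim: "(\<lambda>n. 2 * B / r^2 * norm (h n)) \<longlonglongrightarrow> 0"
  proof -
    have "(\<lambda>n. (2 * B / r^2 * (r / 2)) / real (Suc n)) \<longlonglongrightarrow> 0" by (rule LIMSEQ_Suc[OF lim_const_over_n])
    moreover have "2 * B / r^2 * (r / (2 * real (Suc n))) = (2 * B / r^2 * (r / 2)) / real (Suc n)" for n
      by (simp add: field_simps del: of_nat_Suc)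
    ultimately show ?thesis unfolding nh by simp
  qed
  fix x assume "x \<in> U"
  then obtain d where d: "d > 0" "cball x d \<subseteq> U" using U open_contains_cball by blast
  have "uniform_limit (cball x d) F (\<lambda>\<tau>. deriv (\<lambda>z. W z \<tau>) z0) sequentially"
  proof (rule uniform_limitI)
    fix e :: real assume "e > 0"
    then have "\<forall>\<^sub>F n in sequentially. 2 * B / r^2 * norm (h n) < e" using hlim by (auto dest: order_tendstoD)
    then show "\<forall>\<^sub>F n in sequentially. \<forall>\<tau>\<in>cball x d. dist (F n \<tau>) (deriv (\<lambda>z. W z \<tau>) z0) < e"
    proof eventually_elim
      case (elim n)
      show ?case
      proof
        fix \<tau> assume "\<tau> \<in> cball x d"
        then have "\<tau> \<in> U" using d by auto
        then show "dist (F n \<tau>) (deriv (\<lambda>z. W z \<tau>) z0) < e" using est[of \<tau> n] elim by (simp add: dist_norm)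
      qed
    qed
  qed
  then show "\<exists>d>0. cball x d \<subseteq> U \<and> uniform_limit (cball x d) F (\<lambda>\<tau>. deriv (\<lambda>z. W z \<tau>) z0) sequentially"
    using d by blast
qed

section \<open>Dependence on the parameter\<close>

text \<open>Testing the derivative along a one-sided real sequence covers the end points of a real interval.\<close>
lemma deriv_real_on_reals:
  assumes f: "(f has_field_derivative D) (at (of_real x))" and r: "r \<noteq> 0"
    and real: "\<And>n. Im (f (of_real (x + r / real (Suc n)))) = 0" "Im (f (of_real x)) = 0"
  shows "Im D = 0"
proof -
  have "((\<lambda>h. (f (of_real x + h) - f (of_real x)) / h) \<longlongrightarrow> D) (at 0)"
    using f by (simp add: DERIV_def)
  moreover have "filterlim (\<lambda>n. complex_of_real (r / real (Suc n))) (at 0) sequentially"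
  proof (rule filterlim_atI)
    have "(\<lambda>n. r / real (Suc n)) \<longlonglongrightarrow> 0" by (rule LIMSEQ_Suc[OF lim_const_over_n])
    then show "(\<lambda>n. complex_of_real (r / real (Suc n))) \<longlonglongrightarrow> 0" using tendsto_of_real[where 'a=complex, of _ 0 sequentially] by (simp only: of_real_0)
    show "\<forall>\<^sub>F n in sequentially. complex_of_real (r / real (Suc n)) \<noteq> 0"
      using r by (intro always_eventually allI) (simp del: of_nat_Suc)
  qed
  ultimately have "(\<lambda>n. (f (of_real x + of_real (r / real (Suc n))) - f (of_real x)) / of_real (r / real (Suc n))) \<longlonglongrightarrow> D"
    by (rule filterlim_compose)
  then have "(\<lambda>n. Im ((f (of_real x + of_real (r / real (Suc n))) - f (of_real x)) / of_real (r / real (Suc n)))) \<longlonglongrightarrow> Im D"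
    by (rule tendsto_Im)
  moreover have "Im ((f (of_real x + of_real (r / real (Suc n))) - f (of_real x)) / of_real (r / real (Suc n))) = 0" for n
    unfolding Im_divide_of_real minus_complex.sel of_real_add[symmetric] real by simp
  ultimately have "(\<lambda>n::nat. 0) \<longlonglongrightarrow> Im D" by (simp only:)
  then show ?thesis using LIMSEQ_unique tendsto_const by blast
qed

text \<open>A one-sided second-order estimate for all pairs of base points is two-sided, since the roles of
  the points can be exchanged.\<close>
lemma real_analytic_on_one_sided:
  fixes F g :: "real \<Rightarrow> real"
  assumes T: "convex T" and U: "open U" "convex U" "of_real ` T \<subseteq> U" and G: "G holomorphic_on U"
    and Gg: "\<And>t. t \<in> T \<Longrightarrow> G (of_real t) = of_real (g t)" and r: "r > 0"
    and est: "\<And>t t'. t \<in> T \<Longrightarrow> t' \<in> T \<Longrightarrow> \<bar>t' - t\<bar> < r \<Longrightarrow> F t' - F t \<le> (t' - t) * g t + C * (t' - t)^2"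
  shows "real_analytic_on F T"
proof -
  obtain \<Gamma> where \<Gamma>: "\<And>z. z \<in> U \<Longrightarrow> (\<Gamma> has_field_derivative G z) (at z within U)"
    using holomorphic_convex_primitive'[OF U(2,1) G] by blast
  have gc: "continuous_on T g"
  proof -
    have "continuous_on T (\<lambda>t. Re (G (of_real t)))"
      by (intro continuous_intros continuous_on_compose2[OF holomorphic_on_imp_continuous_on[OF G]]) (use U in auto)
    then show ?thesis by (rule continuous_on_eq) (simp add: Gg)
  qed
  have Fd: "(F has_real_derivative g t) (at t within T)" if t: "t \<in> T" for t
    unfolding has_field_derivative_iff
  proof (subst LIM_zero_iff[symmetric], rule Lim_null_comparison)
    show "\<forall>\<^sub>F y in at t within T. norm ((F y - F t) / (y - t) - g t) \<le> \<bar>g y - g t\<bar> + \<bar>C\<bar> * \<bar>y - t\<bar>"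
      unfolding eventually_at
    proof (intro exI[of _ r] conjI r ballI impI)
      fix y assume y: "y \<in> T" "y \<noteq> t \<and> dist y t < r"
      define e where "e = y - t"
      have e: "e \<noteq> 0" "\<bar>e\<bar> < r" using y by (auto simp: e_def dist_real_def)
      have up: "F y - F t - e * g t \<le> C * e^2" using est[OF t y(1)] e by (simp add: e_def)
      \<comment> \<open>The estimate with exchanged points bounds the increment from below, with
        slope \<open>g y\<close>; continuity of \<open>g\<close> lets this be replaced by
        \<open>g t\<close>.\<close>
      have "F t - F y \<le> (t - y) * g y + C * (t - y)^2" using est[OF y(1) t] e by (simp add: e_def abs_minus_commute)
      then have lo: "e * (g y - g t) - C * e^2 \<le> F y - F t - e * g t" by (simp add: e_def power2_eq_square algebra_simps)
      have "C * e^2 \<le> \<bar>C\<bar> * \<bar>e\<bar> * \<bar>e\<bar>" by (simp add: power2_eq_square abs_mult_self_eq mult_right_mono mult.assoc)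
      moreover have "- (\<bar>e\<bar> * \<bar>g y - g t\<bar>) \<le> e * (g y - g t)" using abs_ge_minus_self[of "e * (g y - g t)"] by (simp add: abs_mult)
      moreover have "0 \<le> \<bar>e\<bar> * \<bar>g y - g t\<bar>" by simp
      ultimately have "\<bar>F y - F t - e * g t\<bar> \<le> \<bar>e\<bar> * \<bar>g y - g t\<bar> + \<bar>C\<bar> * \<bar>e\<bar> * \<bar>e\<bar>" using up lo by linarith
      also have "\<dots> = (\<bar>g y - g t\<bar> + \<bar>C\<bar> * \<bar>e\<bar>) * \<bar>e\<bar>" by (simp add: algebra_simps)
      finally have "\<bar>F y - F t - e * g t\<bar> / \<bar>e\<bar> \<le> \<bar>g y - g t\<bar> + \<bar>C\<bar> * \<bar>e\<bar>" using e by (simp add: pos_divide_le_eq)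
      moreover have "(F y - F t) / e - g t = (F y - F t - e * g t) / e" using e by (simp add: diff_divide_distrib)
      ultimately show "norm ((F y - F t) / (y - t) - g t) \<le> \<bar>g y - g t\<bar> + \<bar>C\<bar> * \<bar>y - t\<bar>"
        by (simp add: e_def[symmetric] abs_divide)
    qed
    have "(g \<longlongrightarrow> g t) (at t within T)" using gc t by (auto simp: continuous_on_def)
    then have "((\<lambda>y. \<bar>g y - g t\<bar> + \<bar>C\<bar> * \<bar>y - t\<bar>) \<longlongrightarrow> \<bar>g t - g t\<bar> + \<bar>C\<bar> * \<bar>t - t\<bar>) (at t within T)"
      by (intro tendsto_intros)
    then show "((\<lambda>y. \<bar>g y - g t\<bar> + \<bar>C\<bar> * \<bar>y - t\<bar>) \<longlongrightarrow> 0) (at t within T)" by simp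
  qed
  \<comment> \<open>\<open>F\<close> and the primitive of \<open>G\<close> have the same derivative
    along \<open>T\<close>; since \<open>T\<close> is convex, their difference is constant.\<close>
  have zero: "((\<lambda>t. \<Gamma> (of_real t) - of_real (F t)) has_vector_derivative 0) (at t within T)" if t: "t \<in> T" for t
    proof -
      have "of_real t \<in> U" using t U by auto
      then have "(\<Gamma> has_field_derivative G (of_real t)) (at (of_real t))" using \<Gamma> U(1) at_within_open by metis
      then have 1: "((\<lambda>t. \<Gamma> (of_real t)) has_vector_derivative G (of_real t)) (at t within T)"
        by (rule has_vector_derivative_real_field)
      have "((\<lambda>t. complex_of_real (F t)) has_vector_derivative of_real (g t)) (at t within T)"
        using Fd[OF t] by (intro has_vector_derivative_of_real) (simp add: has_real_derivative_iff_has_vector_derivative)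
      from has_vector_derivative_diff[OF 1 this] show ?thesis by (simp add: Gg[OF t])
    qed
  obtain c where c: "\<And>t. t \<in> T \<Longrightarrow> \<Gamma> (of_real t) - of_real (F t) = c"
  proof (rule has_vector_derivative_zero_constant[OF T zero])
    fix c assume c: "\<And>t. t \<in> T \<Longrightarrow> \<Gamma> (of_real t) - of_real (F t) = c"
    show thesis by (rule that) (rule c)
  qed
  have "(\<lambda>z. \<Gamma> z - c) holomorphic_on U"
    using \<Gamma> by (intro holomorphic_intros) (auto simp: holomorphic_on_def field_differentiable_def)
  moreover have "\<Gamma> (of_real t) - c = of_real (F t)" if "t \<in> T" for t using c[OF that] by (simp add: algebra_simps)
  ultimately show ?thesis unfolding real_analytic_on_def using U by (intro exI[of _ U] exI[of _ "\<lambda>z. \<Gamma> z - c"]) auto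
qed

text \<open>The energy is affine in the potential, as the interaction is unaffected. This evaluates
  the equilibrium measure of one parameter value as a competitor at another.\<close>

lemma (in equilibrium_gas) energy_change_potential:
  assumes Q2: "continuous_on UNIV Q2"
  shows "energy Q2 \<nu> = ereal (min_energy + (\<integral>x. Q2 x - Q x \<partial>\<nu>))"
proof -
  define f where "f x = Q2 x - Q x" for x
  have fc: "continuous_on UNIV f" unfolding f_def[abs_def] by (intro continuous_intros Q2 Q_cont)
  have fi: "integrable \<nu> f" by (rule integrable_continuous[OF fc])
  have d: "distr (\<nu> \<Otimes>\<^sub>M \<nu>) \<nu> fst = \<nu>" by (rule distr_pair_fst)
  have f1: "(\<integral>q. f (fst q) \<partial>(\<nu> \<Otimes>\<^sub>M \<nu>)) = (\<integral>x. f x \<partial>\<nu>)" "integrable (\<nu> \<Otimes>\<^sub>M \<nu>) (\<lambda>q. f (fst q))"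
    using integral_distr[of fst "\<nu> \<Otimes>\<^sub>M \<nu>" \<nu> f] integrable_distr_eq[of fst "\<nu> \<Otimes>\<^sub>M \<nu>" \<nu> f] fi d by simp_all
  have m: "(\<lambda>q. f (fst q)) \<in> borel_measurable (\<nu> \<Otimes>\<^sub>M \<nu>)" using f1(2) by auto
  have f2: "(\<integral>q. f (snd q) \<partial>(\<nu> \<Otimes>\<^sub>M \<nu>)) = (\<integral>x. f x \<partial>\<nu>)" "integrable (\<nu> \<Otimes>\<^sub>M \<nu>) (\<lambda>q. f (snd q))"
    using pair.integral_product_swap[OF m] pair.integrable_product_swap[OF f1(2)] f1(1) by (simp_all add: case_prod_unfold)
  have "pair_energy Q2 = (\<lambda>q. pair_energy Q q + (f (fst q) / 2 + f (snd q) / 2))"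
    by (auto simp: fun_eq_iff pair_energy_def f_def add_divide_distrib diff_divide_distrib)
  then have "(\<integral>q. pair_energy Q2 q \<partial>(\<nu> \<Otimes>\<^sub>M \<nu>)) = min_energy + (\<integral>x. f x \<partial>\<nu>)"
    using integrable_pair_energy[OF Q_cont] f1 f2 by (simp add: min_energy_def)
  then show ?thesis using energy_law[OF Q2] by (simp add: f_def)
qed

lemma real_analytic_on_imp_continuous_on:
  assumes "real_analytic_on f X" shows "continuous_on X f"
proof -
  obtain U G where G: "G holomorphic_on U" "of_real ` X \<subseteq> U" "\<And>x. x \<in> X \<Longrightarrow> G (of_real x) = of_real (f x)"
    using assms unfolding real_analytic_on_def by blast
  have "continuous_on X (\<lambda>t. Re (G (of_real t)))"
    by (intro continuous_intros continuous_on_compose2[OF holomorphic_on_imp_continuous_on[OF G(1)]]) (use G(2) in auto)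
  then show ?thesis by (rule continuous_on_eq) (simp add: G)
qed

text \<open>The analytic factor \<open>h\<close> is continuous on the compact support, which bounds
  the density.\<close>

lemma regular_with_law:
  assumes reg: "regular_with Q q a b" and J: "J = (\<Union>i<q. {a i..b i})" "J \<subseteq> {-A..A}"
  shows "\<exists>\<mu> h p C. is_eq_measure Q \<mu> \<and> real_analytic_on h J \<and> (\<forall>x\<in>J. h x > 0) \<and>
     p = (\<lambda>x. indicator J x * h x * sqrt \<bar>\<Prod>i<q. (x - a i) * (x - b i)\<bar> / (2 * pi)) \<and> compact_law \<mu> p C A"
proof -
  obtain \<mu> h where \<mu>: "is_eq_measure Q \<mu>" "real_analytic_on h J" "\<And>x. x \<in> J \<Longrightarrow> h x > 0"
    "\<mu> = density lborel (\<lambda>x. ennreal (indicator J x * h x * sqrt \<bar>\<Prod>i<q. (x - a i) * (x - b i)\<bar> / (2 * pi)))"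
    using reg unfolding regular_with_def J(1)[symmetric] by auto
  define p where "p = (\<lambda>x. indicator J x * h x * sqrt \<bar>\<Prod>i<q. (x - a i) * (x - b i)\<bar> / (2 * pi))"
  define k where "k x = h x * sqrt \<bar>\<Prod>i<q. (x - a i) * (x - b i)\<bar> / (2 * pi)" for x
  have Jc: "compact J" unfolding J by (intro compact_UN) auto
  have hc: "continuous_on J h"
    by (rule real_analytic_on_imp_continuous_on[OF \<mu>(2)])
  have kc: "continuous_on J k" unfolding k_def[abs_def] by (intro continuous_intros hc) auto
  have pk: "p = (\<lambda>x. indicator J x *\<^sub>R k x)" by (simp add: p_def k_def fun_eq_iff mult.assoc)
  obtain C where C: "\<And>x. x \<in> J \<Longrightarrow> \<bar>k x\<bar> \<le> C"
    using compact_imp_bounded[OF compact_continuous_image[OF kc Jc]] unfolding bounded_iff by auto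
  have "compact_law \<mu> p \<bar>C\<bar> A"
  proof (intro compact_law.intro compact_law_axioms.intro)
    show "prob_space \<mu>" using \<mu>(1) by (simp add: is_eq_measure_def prob_borel_def)
    show "p \<in> borel_measurable borel" unfolding pk
      using Jc by (intro borel_measurable_continuous_on_indicator kc borel_closed compact_imp_closed)
    show "0 \<le> p x" for x using \<mu>(3)[of x] by (auto simp: p_def indicator_def less_imp_le)
    show "p x \<le> \<bar>C\<bar>" for x
    proof (cases "x \<in> J")
      case True
      then have "p x = k x" by (simp add: pk)
      then show ?thesis using C[OF True] by linarith
    qed (simp add: p_def)
    show "p x = 0" if "A < \<bar>x\<bar>" for x
    proof -
      have "x \<notin> {-A..A}" using that by auto
      then have "x \<notin> J" using J(2) by blast
      then show ?thesis by (simp add: p_def)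
    qed
    show "\<mu> = density lborel (\<lambda>x. ennreal (p x))" unfolding p_def by (rule \<mu>(4))
  qed
  then show ?thesis using \<mu> p_def by blast
qed

definition orect :: "real \<Rightarrow> real \<Rightarrow> complex set" where
  "orect X Y = {z. \<bar>Re z\<bar> < X \<and> \<bar>Im z\<bar> < Y}"

lemma open_orect: "open (orect X Y)" and convex_orect: "convex (orect X Y)"
proof -
  have "orect X Y = box (Complex (-X) (-Y)) (Complex X Y)"
    by (auto simp: orect_def in_box_complex_iff)
  then show "open (orect X Y)" "convex (orect X Y)" by (simp_all add: open_box)
qed

lemma ball_subset_orect:
  assumes "z \<in> crect X Y" "X + d \<le> X'" "Y + d \<le> Y'"
  shows "ball z d \<subseteq> orect X' Y'"
proof
  fix w assume "w \<in> ball z d"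
  then have "norm (w - z) < d" by (simp add: dist_norm norm_minus_commute)
  then have "\<bar>Re w - Re z\<bar> < d" "\<bar>Im w - Im z\<bar> < d"
    using abs_Re_le_cmod[of "w - z"] abs_Im_le_cmod[of "w - z"] by auto
  then show "w \<in> orect X' Y'" using assms by (auto simp: orect_def crect_def)
qed

lemma holo2_holomorphic:
  assumes W: "holo2 W D"
  shows "X \<times> {\<tau>} \<subseteq> D \<Longrightarrow> (\<lambda>z. W z \<tau>) holomorphic_on X" and "{z} \<times> Y \<subseteq> D \<Longrightarrow> (\<lambda>\<tau>. W z \<tau>) holomorphic_on Y"
proof -
  have 1: "(\<lambda>z. W z \<tau>) field_differentiable at z" "(\<lambda>\<tau>. W z \<tau>) field_differentiable at \<tau>" if "(z, \<tau>) \<in> D" for z \<tau>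
    using W that unfolding holo2_def by force+
  show "X \<times> {\<tau>} \<subseteq> D \<Longrightarrow> (\<lambda>z. W z \<tau>) holomorphic_on X" "{z} \<times> Y \<subseteq> D \<Longrightarrow> (\<lambda>\<tau>. W z \<tau>) holomorphic_on Y"
    unfolding holomorphic_on_def by (auto intro!: field_differentiable_at_within 1)
qed

section \<open>Analytic families of potentials\<close>

locale potential_family =
  fixes V :: "real \<Rightarrow> real \<Rightarrow> real" and t0 t1 :: real and \<Omega> D and W :: "complex \<Rightarrow> complex \<Rightarrow> complex"
  assumes t: "0 < t1" "t1 \<le> t0"
    and \<Omega>: "open \<Omega>" "range complex_of_real \<subseteq> \<Omega>" and D: "\<Omega> \<times> (complex_of_real ` {-t0..t0}) \<subseteq> D"
    and W: "holo2 W D" and WV: "\<And>x t. t \<in> {-t0..t0} \<Longrightarrow> W (of_real x) (of_real t) = of_real (V x t)"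
    and growth: "filterlim (\<lambda>x. Inf ((\<lambda>t. V x t) ` {-t0..t0}) / ln \<bar>x\<bar>) at_top at_infinity"
begin

lemma real_in_domain: "complex_of_real x \<in> \<Omega>"
  using \<Omega>(2) by (simp add: image_subset_iff)

lemma in_joint_domain: "z \<in> \<Omega> \<Longrightarrow> s \<in> {-t0..t0} \<Longrightarrow> (z, of_real s) \<in> D"
  by (rule subsetD[OF D]) auto

lemma W_holomorphic_line: "s \<in> {-t0..t0} \<Longrightarrow> (\<lambda>z. W z (of_real s)) holomorphic_on \<Omega>"
  by (rule holo2_holomorphic(1)[OF W]) (auto simp: in_joint_domain)

lemma V_continuous:
  assumes "s \<in> {-t0..t0}" shows "continuous_on UNIV (\<lambda>x. V x s)"
proof -
  have "continuous_on UNIV (\<lambda>x. Re (W (of_real x) (of_real s)))"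
    by (intro continuous_on_Re continuous_on_compose2[OF holomorphic_on_imp_continuous_on[OF W_holomorphic_line[OF assms]]] continuous_on_of_real continuous_on_id)
       (auto simp: real_in_domain)
  then show ?thesis by (rule continuous_on_eq) (simp add: WV[OF assms])
qed

lemma V_growth:
  assumes s: "s \<in> {-t0..t0}" shows "\<exists>R\<ge>1. \<forall>x. R \<le> \<bar>x\<bar> \<longrightarrow> 3 * ln \<bar>x\<bar> \<le> V x s"
proof -
  have "\<forall>\<^sub>F x in at_infinity. 3 \<le> Inf ((\<lambda>t. V x t) ` {-t0..t0}) / ln \<bar>x\<bar>"
    using growth unfolding filterlim_at_top by blast
  then obtain R where R: "\<And>x. R \<le> norm x \<Longrightarrow> 3 \<le> Inf ((\<lambda>t. V x t) ` {-t0..t0}) / ln \<bar>x\<bar>"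
    unfolding eventually_at_infinity by blast
  \<comment> \<open>The \<open>2\<close> in the witness makes the logarithm positive, so the
    quotient can be multiplied out.\<close>
  show ?thesis
  proof (intro exI[of _ "max 2 R"] conjI allI impI)
    fix x assume x: "max 2 R \<le> \<bar>x\<bar>"
    then have l: "ln \<bar>x\<bar> > 0" by (intro ln_gt_zero) auto
    have "3 * ln \<bar>x\<bar> \<le> Inf ((\<lambda>t. V x t) ` {-t0..t0})"
      using R[of x] x l by (simp add: pos_le_divide_eq)
    also have "\<dots> \<le> V x s"
    proof (rule cInf_lower)
      \<comment> \<open>Continuity in \<open>t\<close> on a compact interval bounds the values from
        below; without such a bound \<open>Inf\<close> would carry no information.\<close>
      have hol: "(\<lambda>\<tau>. W (of_real x) \<tau>) holomorphic_on of_real ` {-t0..t0}"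
        by (rule holo2_holomorphic(2)[OF W]) (use in_joint_domain[OF real_in_domain] in auto)
      then have "continuous_on {-t0..t0} (\<lambda>t. Re (W (of_real x) (of_real t)))"
        by (intro continuous_on_Re continuous_on_compose2[OF holomorphic_on_imp_continuous_on[OF hol]] continuous_on_of_real continuous_on_id) auto
      then have "continuous_on {-t0..t0} (\<lambda>t. V x t)" by (rule continuous_on_eq) (simp add: WV)
      then show "bdd_below ((\<lambda>t. V x t) ` {-t0..t0})"
        by (intro bounded_imp_bdd_below compact_imp_bounded compact_continuous_image) auto
    qed (use s in auto)
    finally show "3 * ln \<bar>x\<bar> \<le> V x s" .
  qed auto
qed

definition V' :: "real \<Rightarrow> real \<Rightarrow> real" where
  "V' s x = Re (deriv (\<lambda>z. W z (of_real s)) (of_real x))"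

lemma V'_continuous:
  assumes "s \<in> {-t0..t0}" shows "continuous_on UNIV (V' s)"
proof -
  have "deriv (\<lambda>z. W z (of_real s)) holomorphic_on \<Omega>"
    by (rule holomorphic_deriv[OF W_holomorphic_line[OF assms] \<Omega>(1)])
  from holomorphic_on_imp_continuous_on[OF this]
  have "continuous_on UNIV (\<lambda>x. deriv (\<lambda>z. W z (of_real s)) (of_real x))"
    by (rule continuous_on_compose2) (auto simp: real_in_domain intro!: continuous_on_of_real continuous_on_id)
  then show ?thesis unfolding V'_def[abs_def] by (rule continuous_on_Re)
qed

lemma V'_eq:
  assumes s: "s \<in> {-t0..t0}"
  shows "deriv (\<lambda>z. W z (of_real s)) (of_real x) = of_real (V' s x)"
proof -
  have "Im (deriv (\<lambda>z. W z (of_real s)) (of_real x)) = 0"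
  proof (rule deriv_real_on_reals[of "\<lambda>z. W z (of_real s)" _ x 1])
    show "((\<lambda>z. W z (of_real s)) has_field_derivative deriv (\<lambda>z. W z (of_real s)) (of_real x)) (at (of_real x))"
      using \<Omega> by (intro holomorphic_derivI[OF W_holomorphic_line[OF s] \<Omega>(1)]) auto
    show "(1::real) \<noteq> 0" by simp
    show "Im (W (of_real (x + 1 / real (Suc n))) (of_real s)) = 0" for n by (simp only: WV[OF s] Im_complex_of_real)
    show "Im (W (of_real x) (of_real s)) = 0" by (simp only: WV[OF s] Im_complex_of_real)
  qed
  then show ?thesis by (simp add: V'_def complex_eq_iff)
qed

definition Vt :: "real \<Rightarrow> real \<Rightarrow> real" where
  "Vt s x = Re (deriv (\<lambda>\<tau>. W (of_real x) \<tau>) (of_real s))"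

lemma Vt_eq:
  assumes s: "s \<in> {-t1..t1}"
  shows "deriv (\<lambda>\<tau>. W (of_real x) \<tau>) (of_real s) = of_real (Vt s x)"
proof -
  \<comment> \<open>Directed towards the centre, so that the sequence of real parameters stays
    inside the interval even at an end point with \<open>t1 = t0\<close>.\<close>
  define r where "r = (if s \<le> 0 then t1 else - t1)"
  have in0: "s + r / real (Suc n) \<in> {-t0..t0}" for n
  proof -
    define e where "e = t1 / real (Suc n)"
    have "0 \<le> e" "e \<le> t1" using t by (auto simp: e_def divide_le_eq)
    moreover have "r / real (Suc n) = (if s \<le> 0 then e else - e)" by (simp add: r_def e_def)
    ultimately show ?thesis using s t by auto
  qed
  have s0: "s \<in> {-t0..t0}" using s t by auto
  have "Im (deriv (\<lambda>\<tau>. W (of_real x) \<tau>) (of_real s)) = 0"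
  proof (rule deriv_real_on_reals[of "\<lambda>\<tau>. W (of_real x) \<tau>" _ s r])
    have "(of_real x, of_real s) \<in> D" by (rule in_joint_domain[OF real_in_domain s0])
    then have "(\<lambda>\<tau>. W (of_real x) \<tau>) field_differentiable at (of_real s)" using W unfolding holo2_def by force
    then show "((\<lambda>\<tau>. W (of_real x) \<tau>) has_field_derivative deriv (\<lambda>\<tau>. W (of_real x) \<tau>) (of_real s)) (at (of_real s))"
      by (simp add: DERIV_deriv_iff_field_differentiable)
    show "r \<noteq> 0" using t by (simp add: r_def)
    show "Im (W (of_real x) (of_real (s + r / real (Suc n)))) = 0" for n by (simp only: WV[OF in0] Im_complex_of_real)
    show "Im (W (of_real x) (of_real s)) = 0" by (simp only: WV[OF s0] Im_complex_of_real)
  qed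
  then show ?thesis by (simp add: Vt_def complex_eq_iff)
qed

end

text \<open>Nested rectangles around the supports, at mutual distance d, over which all contour integrals are taken.\<close>
locale regular_family = potential_family V t0 t1 \<Omega> D W for V t0 t1 \<Omega> D W +
  fixes q :: nat and a b :: "nat \<Rightarrow> real \<Rightarrow> real" and \<alpha> \<beta> :: "nat \<Rightarrow> complex \<Rightarrow> complex"
    and A \<eta> \<delta> BW :: real and U U2 :: "complex set"
  assumes reg: "\<And>t. t \<in> {-t1..t1} \<Longrightarrow> regular_with (\<lambda>x. V x t) q (\<lambda>i. a i t) (\<lambda>i. b i t)"
    and A: "A \<ge> 1" "\<And>i t. i < q \<Longrightarrow> t \<in> {-t1..t1} \<Longrightarrow> \<bar>a i t\<bar> \<le> A" "\<And>i t. i < q \<Longrightarrow> t \<in> {-t1..t1} \<Longrightarrow> \<bar>b i t\<bar> \<le> A"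
    and \<eta>: "\<eta> > 0" and \<delta>: "\<delta> > 0"
    and U: "open U" "convex U" "of_real ` {-t1..t1} \<subseteq> U" and U2: "open U2" "\<And>\<tau>. \<tau> \<in> U \<Longrightarrow> ball \<tau> \<delta> \<subseteq> U2"
    and \<alpha>: "\<And>i. i < q \<Longrightarrow> \<alpha> i holomorphic_on U" "\<And>i \<tau>. i < q \<Longrightarrow> \<tau> \<in> U \<Longrightarrow> \<alpha> i \<tau> \<in> crect (A + 1) \<eta>"
      "\<And>i t. i < q \<Longrightarrow> t \<in> {-t1..t1} \<Longrightarrow> \<alpha> i (of_real t) = of_real (a i t)"
    and \<beta>: "\<And>i. i < q \<Longrightarrow> \<beta> i holomorphic_on U" "\<And>i \<tau>. i < q \<Longrightarrow> \<tau> \<in> U \<Longrightarrow> \<beta> i \<tau> \<in> crect (A + 1) \<eta>"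
      "\<And>i t. i < q \<Longrightarrow> t \<in> {-t1..t1} \<Longrightarrow> \<beta> i (of_real t) = of_real (b i t)"
    and BW: "\<And>z \<tau>. z \<in> orect (A + 6) (6 * \<eta>) \<Longrightarrow> \<tau> \<in> U2 \<Longrightarrow> (z, \<tau>) \<in> D \<and> norm (W z \<tau>) \<le> BW"
begin

text \<open>Consecutive rectangles differ by \<open>1\<close> horizontally and by
  \<open>\<eta>\<close> vertically; this is their common gap, also used as a radius for Cauchy
  estimates.\<close>

definition d where "d = min 1 \<eta>"

lemma d: "d > 0" "d \<le> 1" "d \<le> \<eta>" using \<eta> by (auto simp: d_def)

lemma U_sub: "\<tau> \<in> U \<Longrightarrow> \<tau> \<in> U2" using U2(2)[of \<tau>] \<delta> by auto

lemma hz: "\<tau> \<in> U2 \<Longrightarrow> (\<lambda>z. W z \<tau>) holomorphic_on orect (A + 6) (6 * \<eta>)"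
  using BW by (intro holo2_holomorphic(1)[OF W]) auto

lemma ht: "z \<in> orect (A + 6) (6 * \<eta>) \<Longrightarrow> (\<lambda>\<tau>. W z \<tau>) holomorphic_on U2"
  using BW by (intro holo2_holomorphic(2)[OF W]) auto

text \<open>Complex derivative in space, continuing the force in the loop equation; its companion
  \<open>uf\<close>, the derivative in the parameter, continues the integrand of the derivative of
  the free energy.\<close>

definition vf where "vf \<tau> z = deriv (\<lambda>z. W z \<tau>) z"

definition uf where "uf \<tau> z = deriv (\<lambda>\<tau>. W z \<tau>) \<tau>"

lemma inner_ball: "z \<in> crect (A + 5) (5 * \<eta>) \<Longrightarrow> ball z d \<subseteq> orect (A + 6) (6 * \<eta>)"
  using d by (intro ball_subset_orect[where X="A + 5" and Y="5 * \<eta>"]) auto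

lemma crect_in_orect: "X < X' \<Longrightarrow> Y < Y' \<Longrightarrow> crect X Y \<subseteq> orect X' Y'"
  by (auto simp: crect_def orect_def)

lemma vf_holo_t: "z \<in> crect (A + 5) (5 * \<eta>) \<Longrightarrow> (\<lambda>\<tau>. vf \<tau> z) holomorphic_on U2"
  unfolding vf_def using inner_ball[of z] d BW
  by (intro deriv_family_holomorphic[where r="d/3" and B=BW] U2) (auto intro: hz[THEN holomorphic_on_subset] ht)

lemma vf_holo_z: "\<tau> \<in> U2 \<Longrightarrow> vf \<tau> holomorphic_on orect (A + 6) (6 * \<eta>)"
  unfolding vf_def[abs_def] by (intro holomorphic_deriv hz open_orect)

lemma vf_bound: "z \<in> crect (A + 5) (5 * \<eta>) \<Longrightarrow> \<tau> \<in> U2 \<Longrightarrow> norm (vf \<tau> z) \<le> BW / (d/2)"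
  unfolding vf_def using inner_ball[of z] d BW
  by (intro Cauchy_deriv_bound[where R=d]) (auto intro: hz[THEN holomorphic_on_subset])

lemma uf_holo_t: "z \<in> orect (A + 6) (6 * \<eta>) \<Longrightarrow> (\<lambda>\<tau>. uf \<tau> z) holomorphic_on U"
  unfolding uf_def using U_sub
  by (intro holomorphic_on_subset[OF holomorphic_deriv[OF ht U2(1)]]) auto

lemma uf_holo_z: "\<tau> \<in> U \<Longrightarrow> uf \<tau> holomorphic_on orect (A + 6) (6 * \<eta>)"
  unfolding uf_def[abs_def] using U2(2)[of \<tau>] \<delta> BW
  by (intro deriv_family_holomorphic[where r="\<delta>/3" and B=BW and W="\<lambda>\<tau> z. W z \<tau>"] open_orect)
     (auto intro: ht[THEN holomorphic_on_subset] hz)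

lemma uf_bound: "z \<in> orect (A + 6) (6 * \<eta>) \<Longrightarrow> \<tau> \<in> U \<Longrightarrow> norm (uf \<tau> z) \<le> BW / (\<delta>/2)"
  unfolding uf_def using U2(2)[of \<tau>] \<delta> BW
  by (intro Cauchy_deriv_bound[where R=\<delta>]) (auto intro: ht[THEN holomorphic_on_subset])

definition RR where "RR \<tau> z = (\<Prod>i<q. seg_sqrt (\<alpha> i \<tau>) (\<beta> i \<tau>) z)"

text \<open>The right-hand side of \<open>moment_formula\<close> with potential and end points at a
  complex parameter. At real parameters it is the integral of the parameter derivative of the
  potential against the equilibrium measure.\<close>

definition moment :: "complex \<Rightarrow> complex" where
  "moment \<tau> = contour_integral (rect (A + 2) (2 * \<eta>)) (\<lambda>z. uf \<tau> z * RR \<tau> z *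
     contour_integral (rect (A + 3) (3 * \<eta>)) (\<lambda>s. vf \<tau> s / (RR \<tau> s * (s - z)))) / of_real (8 * pi^2)"

lemma moment_holomorphic: "moment holomorphic_on U"
proof -
  have P1: "path_image (rect (A + 2) (2 * \<eta>)) \<subseteq> crect (A + 5) (5 * \<eta>)"
    using A \<eta> path_image_rect_subset[of "A + 2" "2 * \<eta>"] by (auto simp: crect_def)
  have P2: "path_image (rect (A + 3) (3 * \<eta>)) \<subseteq> crect (A + 5) (5 * \<eta>)"
    using A \<eta> path_image_rect_subset[of "A + 3" "3 * \<eta>"] by (auto simp: crect_def)
  have cr: "crect (A + 5) (5 * \<eta>) \<subseteq> orect (A + 6) (6 * \<eta>)" using \<eta> by (intro crect_in_orect) auto
  have "(\<lambda>\<tau>. contour_integral (rect (A + 2) (2 * \<eta>)) (\<lambda>z. uf \<tau> z * RR \<tau> z *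
     contour_integral (rect (A + 3) (3 * \<eta>)) (\<lambda>s. vf \<tau> s / (RR \<tau> s * (s - z))))) holomorphic_on U"
    unfolding RR_def
  proof (rule contour_family_holomorphic[OF U(1) d(1), where ?X0.0="A + 1" and ?Y0.0=\<eta> and Bu="BW / (\<delta>/2)" and Bv="BW / (d/2)"])
    show "(\<lambda>\<tau>. uf \<tau> z) holomorphic_on U" if "z \<in> path_image (rect (A + 2) (2 * \<eta>))" for z
      using that P1 cr by (intro uf_holo_t) auto
    show "continuous_on (path_image (rect (A + 2) (2 * \<eta>))) (uf \<tau>)" if "\<tau> \<in> U" for \<tau>
      using that P1 cr by (intro holomorphic_on_imp_continuous_on holomorphic_on_subset[OF uf_holo_z]) auto
    show "norm (uf \<tau> z) \<le> BW / (\<delta>/2)" if "\<tau> \<in> U" "z \<in> path_image (rect (A + 2) (2 * \<eta>))" for \<tau> z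
      using that P1 cr by (intro uf_bound) auto
    show "(\<lambda>\<tau>. vf \<tau> z) holomorphic_on U" if "z \<in> path_image (rect (A + 3) (3 * \<eta>))" for z
      using that P2 U_sub by (intro holomorphic_on_subset[OF vf_holo_t]) auto
    show "continuous_on (path_image (rect (A + 3) (3 * \<eta>))) (vf \<tau>)" if "\<tau> \<in> U" for \<tau>
      using that P2 cr U_sub by (intro holomorphic_on_imp_continuous_on holomorphic_on_subset[OF vf_holo_z]) auto
    show "norm (vf \<tau> z) \<le> BW / (d/2)" if "\<tau> \<in> U" "z \<in> path_image (rect (A + 3) (3 * \<eta>))" for \<tau> z
      using that P2 U_sub by (intro vf_bound) auto
  qed (use A d \<eta> \<alpha> \<beta> in auto)
  then show ?thesis unfolding moment_def[abs_def] by (intro holomorphic_intros) auto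
qed

definition clamp :: "real \<Rightarrow> real" where "clamp x = max (-A) (min A x)"

text \<open>The clamp makes this integrand continuous on the whole line without changing it on the supports.\<close>
definition dV :: "real \<Rightarrow> real \<Rightarrow> real" where "dV t x = Vt t (clamp x)"

lemma real_in_crect: "\<bar>x\<bar> \<le> A \<Longrightarrow> of_real x \<in> crect (A + 5) (5 * \<eta>)" "\<bar>x\<bar> \<le> A \<Longrightarrow> of_real x \<in> orect (A + 6) (6 * \<eta>)"
  using \<eta> by (auto simp: crect_def orect_def)

text \<open>Collects, for one parameter value, the facts needed to compare two values. The locales
  of a gas fix a single potential, so these facts are exported with \<open>I\<close> and
  \<open>\<nu>\<close> quantified and can then be chosen for all \<open>t\<close>.\<close>

lemma gas:
  assumes t: "t \<in> {-t1..t1}"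
  shows "\<exists>I \<nu>. prob_borel \<nu> \<and> (\<lambda>N. - ln (partition_fn V N t) / (real N)^2) \<longlonglongrightarrow> I \<and>
    (\<forall>\<mu>. prob_borel \<mu> \<longrightarrow> ereal I \<le> energy (\<lambda>x. V x t) \<mu>) \<and>
    (\<forall>Q. continuous_on UNIV Q \<longrightarrow> energy Q \<nu> = ereal (I + (\<integral>x. Q x - V x t \<partial>\<nu>))) \<and>
    (\<forall>f :: real \<Rightarrow> real. continuous_on UNIV f \<longrightarrow> integrable \<nu> f) \<and> (AE x in \<nu>. \<bar>x\<bar> \<le> A) \<and>
    continuous_on UNIV (dV t) \<and> of_real (\<integral>x. dV t x \<partial>\<nu>) = moment (of_real t)"
proof -
  have t0: "t \<in> {-t0..t0}" using t potential_family_axioms by (auto simp: potential_family_def)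
  have tU: "of_real t \<in> U" using t U by auto
  note tU2 = U_sub[OF tU]
  let ?Q = "\<lambda>x. V x t"
  define J where "J = (\<Union>i<q. {a i t..b i t})"
  have JA: "J \<subseteq> {-A..A}" unfolding J_def using A(2,3)[OF _ t] by (fastforce simp: abs_le_iff)
  obtain \<mu> h p C where \<mu>: "is_eq_measure ?Q \<mu>" "real_analytic_on h J" "\<And>x. x \<in> J \<Longrightarrow> h x > 0"
    "p = (\<lambda>x. indicator J x * h x * sqrt \<bar>\<Prod>i<q. (x - a i t) * (x - b i t)\<bar> / (2 * pi))" "compact_law \<mu> p C A"
    using regular_with_law[OF reg[OF t] J_def JA] by blast
  interpret G0: compact_law \<mu> p C A by (rule \<mu>(5))
  interpret G1: log_gas ?Q by unfold_locales (rule V_continuous[OF t0], rule V_growth[OF t0])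
  interpret G2: equilibrium_gas ?Q \<mu> p C A by unfold_locales (rule \<mu>(1))
  have or6: "orect (A + 4) (4 * \<eta>) \<subseteq> orect (A + 6) (6 * \<eta>)" using \<eta> by (auto simp: orect_def)
  \<comment> \<open>The constants are Cauchy estimates from the bound \<open>BW\<close>: radius
    \<open>d/3\<close> for the Taylor remainder, with \<open>d/6\<close> strictly below it, and two
    successive derivative estimates of radius \<open>d/2\<close> for the bound on
    \<open>deriv vp\<close>.\<close>
  interpret G3: interval_gas ?Q \<mu> p C A J "V' t" "d/6" "2 * BW / (d/3)^2" "(BW / (d/2)) / (d/2)" "orect (A + 4) (4 * \<eta>)" "vf (of_real t)"
     q "\<lambda>i. a i t" "\<lambda>i. b i t" h
  proof
    show "compact J" unfolding J_def by (intro compact_UN) auto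
    show "J \<subseteq> {-A..A}" by (rule JA)
    show "p x = 0" if "x \<notin> J" for x using that by (simp add: \<mu>(4))
    show "0 < d / 6" using d by simp
    show "\<bar>V (x + k) t - V x t - k * V' t x\<bar> \<le> 2 * BW / (d/3)^2 * k^2" if x: "\<bar>x\<bar> \<le> A" and k: "\<bar>k\<bar> \<le> d/6" for x k
    proof -
      let ?f = "\<lambda>z. W z (of_real t)"
      have "norm (?f (of_real (x + k)) - ?f (of_real x) - deriv ?f (of_real x) * (of_real (x + k) - of_real x)) \<le> 2 * BW / (d/3)^2 * norm (complex_of_real (x + k) - of_real x)^2"
      proof (rule holomorphic_second_order_bound)
        have sub: "ball (complex_of_real x) (3 * (d/3)) \<subseteq> orect (A + 6) (6 * \<eta>)" using inner_ball[OF real_in_crect(1)[OF x]] by simp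
        show "?f holomorphic_on ball (of_real x) (3 * (d/3))" by (rule holomorphic_on_subset[OF hz[OF tU2] sub])
        show "norm (?f w) \<le> BW" if "w \<in> ball (of_real x) (3 * (d/3))" for w using BW[of w "of_real t"] sub that tU2 by auto
        have "dist (complex_of_real x) (of_real (x + k)) = \<bar>k\<bar>" unfolding dist_of_real by (simp add: dist_real_def)
        then show "complex_of_real (x + k) \<in> ball (of_real x) (d/3)" using k d by simp
      qed (use d in simp)
      moreover have "?f (of_real (x + k)) - ?f (of_real x) - deriv ?f (of_real x) * (of_real (x + k) - of_real x) = of_real (V (x + k) t - V x t - k * V' t x)"
        unfolding V'_eq[OF t0] WV[OF t0] by (simp add: mult.commute)
      moreover have "norm (complex_of_real (x + k) - of_real x)^2 = k^2" by simp
      ultimately show ?thesis by (simp only: norm_of_real)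
    qed
    show "continuous_on UNIV (V' t)" by (rule V'_continuous[OF t0])
    show "open (orect (A + 4) (4 * \<eta>))" "convex (orect (A + 4) (4 * \<eta>))" by (rule open_orect, rule convex_orect)
    show "complex_of_real ` {-A..A} \<subseteq> orect (A + 4) (4 * \<eta>)" using \<eta> by (auto simp: orect_def)
    show "vf (of_real t) holomorphic_on orect (A + 4) (4 * \<eta>)" by (rule holomorphic_on_subset[OF vf_holo_z[OF tU2] or6])
    show "norm (deriv (vf (of_real t)) z) \<le> (BW / (d/2)) / (d/2)" if z: "z \<in> orect (A + 4) (4 * \<eta>)" for z
    proof (rule Cauchy_deriv_bound[where R=d])
      have "z \<in> crect (A + 4) (4 * \<eta>)" using z by (auto simp: orect_def crect_def)
      then have "ball z d \<subseteq> orect (A + 5) (5 * \<eta>)" using d by (intro ball_subset_orect[where X="A + 4" and Y="4 * \<eta>"]) auto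
      then have zb: "ball z d \<subseteq> crect (A + 5) (5 * \<eta>)" by (auto simp: orect_def crect_def)
      moreover have "crect (A + 5) (5 * \<eta>) \<subseteq> orect (A + 6) (6 * \<eta>)" using \<eta> by (intro crect_in_orect) auto
      ultimately show "vf (of_real t) holomorphic_on ball z d" by (intro holomorphic_on_subset[OF vf_holo_z[OF tU2]]) auto
      show "norm (vf (of_real t) w) \<le> BW / (d/2)" if "w \<in> ball z d" for w using that zb by (intro vf_bound tU2) auto
    qed (use d in auto)
    show "vf (of_real t) (of_real x) = of_real (V' t x)" for x unfolding vf_def by (rule V'_eq[OF t0])
    show "a i t < b i t" if "i < q" for i using reg[OF t] that unfolding regular_with_def by blast
    show "b i t < a (Suc i) t" if "Suc i < q" for i using reg[OF t] that unfolding regular_with_def by blast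
    show "q \<ge> 1" using reg[OF t] unfolding regular_with_def by blast
    show "J = (\<Union>i<q. {a i t..b i t})" by (rule J_def)
    show "real_analytic_on h J" by (rule \<mu>(2))
    show "h x > 0" if "x \<in> J" for x by (rule \<mu>(3)[OF that])
    show "p = (\<lambda>x. indicator J x * h x * sqrt \<bar>\<Prod>i<q. (x - a i t) * (x - b i t)\<bar> / (2 * pi))" by (rule \<mu>(4))
  qed
  have Vt_uf: "uf (of_real t) (of_real x) = of_real (Vt t x)" for x unfolding uf_def by (rule Vt_eq[OF t])
  have clamp: "\<bar>clamp x\<bar> \<le> A" "\<bar>x\<bar> \<le> A \<Longrightarrow> clamp x = x" for x using A(1) by (auto simp: clamp_def)
  have dVc: "continuous_on UNIV (dV t)"
  proof -
    have "continuous_on UNIV (\<lambda>x. uf (of_real t) (of_real (clamp x)))"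
    proof (rule continuous_on_compose2[OF holomorphic_on_imp_continuous_on[OF uf_holo_z[OF tU]]])
      show "continuous_on UNIV (\<lambda>x. complex_of_real (clamp x))" unfolding clamp_def by (intro continuous_intros)
      show "range (\<lambda>x. complex_of_real (clamp x)) \<subseteq> orect (A + 6) (6 * \<eta>)" using clamp(1) real_in_crect(2) by blast
    qed
    then have "continuous_on UNIV (\<lambda>x. Re (uf (of_real t) (of_real (clamp x))))" by (rule continuous_on_Re)
    then show ?thesis by (simp add: Vt_uf dV_def[abs_def])
  qed
  have rr: "G3.rr = RR (of_real t)"
    unfolding G3.rr_def RR_def fun_eq_iff using \<alpha>(3)[OF _ t] \<beta>(3)[OF _ t] by (auto intro!: prod.cong)
  have "of_real (\<integral>x. dV t x \<partial>\<mu>) = moment (of_real t)"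
    unfolding moment_def rr[symmetric]
  proof (rule G3.moment_formula)
    show "crect (A + 3) (3 * \<eta>) \<subseteq> orect (A + 4) (4 * \<eta>)" using \<eta> by (intro crect_in_orect) auto
    show "uf (of_real t) holomorphic_on orect (A + 4) (4 * \<eta>)" by (rule holomorphic_on_subset[OF uf_holo_z[OF tU] or6])
    show "uf (of_real t) (of_real y) = of_real (dV t y)" if "\<bar>y\<bar> \<le> A" for y by (simp add: Vt_uf dV_def clamp that)
  qed (use A \<eta> dVc in auto)
  moreover have "(\<lambda>N. - ln (partition_fn V N t) / (real N)^2) \<longlonglongrightarrow> G2.min_energy"
    using G2.free_energy_limit unfolding G1.weight_def partition_fn_def .
  ultimately show ?thesis
    using G0.prob_borel_law G2.min_energy_le G2.energy_change_potential G0.integrable_continuous G0.AE_bounded dVc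
    by (intro exI[of _ G2.min_energy] exI[of _ \<mu>]) blast
qed

end

lemma (in regular_family) analytic_free_energy:
  "\<exists>F. (\<forall>t\<in>{-t1..t1}. (\<lambda>N. - ln (partition_fn V N t) / (real N)^2) \<longlonglongrightarrow> F t) \<and> real_analytic_on F {-t1..t1}"
proof -
  define Pr where "Pr t I \<nu> \<longleftrightarrow> prob_borel \<nu> \<and> (\<lambda>N. - ln (partition_fn V N t) / (real N)^2) \<longlonglongrightarrow> I \<and>
    (\<forall>\<mu>. prob_borel \<mu> \<longrightarrow> ereal I \<le> energy (\<lambda>x. V x t) \<mu>) \<and>
    (\<forall>Q. continuous_on UNIV Q \<longrightarrow> energy Q \<nu> = ereal (I + (\<integral>x. Q x - V x t \<partial>\<nu>))) \<and>
    (\<forall>f :: real \<Rightarrow> real. continuous_on UNIV f \<longrightarrow> integrable \<nu> f) \<and> (AE x in \<nu>. \<bar>x\<bar> \<le> A) \<and>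
    continuous_on UNIV (dV t) \<and> of_real (\<integral>x. dV t x \<partial>\<nu>) = moment (of_real t)" for t I \<nu>
  have "\<forall>t\<in>{-t1..t1}. \<exists>I \<nu>. Pr t I \<nu>" unfolding Pr_def using gas by blast
  then obtain I where "\<forall>t\<in>{-t1..t1}. \<exists>\<nu>. Pr t (I t) \<nu>" by (rule bchoice[THEN exE])
  then obtain \<nu> where Pr: "\<forall>t\<in>{-t1..t1}. Pr t (I t) (\<nu> t)" by (rule bchoice[THEN exE])
  define g where "g t = (\<integral>x. dV t x \<partial>\<nu> t)" for t
  define C where "C = 2 * BW / (\<delta>/3)^2"
  have "real_analytic_on I {-t1..t1}"
  proof (rule real_analytic_on_one_sided[OF _ U moment_holomorphic, where g=g and r="\<delta>/3" and C=C])
    show "convex {-t1..t1}" by simp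
    show "moment (of_real t) = of_real (g t)" if "t \<in> {-t1..t1}" for t
      using Pr that unfolding Pr_def g_def by simp
    show "\<delta> / 3 > 0" using \<delta> by simp
    fix s s' assume s: "s \<in> {-t1..t1}" and s': "s' \<in> {-t1..t1}" and ss: "\<bar>s' - s\<bar> < \<delta> / 3"
    have s0: "s \<in> {-t0..t0}" "s' \<in> {-t0..t0}" using s s' t by auto
    note P = bspec[OF Pr s, unfolded Pr_def]
    note P2 = P[THEN conjunct2, THEN conjunct2, THEN conjunct2]
    note min = bspec[OF Pr s', unfolded Pr_def, THEN conjunct2, THEN conjunct2, THEN conjunct1, rule_format]
    note energy = P2[THEN conjunct1, rule_format]
    note P3 = P2[THEN conjunct2]
    note int = P3[THEN conjunct1, rule_format]
    note P4 = P3[THEN conjunct2]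
    note supp = P4[THEN conjunct1]
    note dVc = P4[THEN conjunct2, THEN conjunct1]
    have pb: "prob_borel (\<nu> s)" by (rule P[THEN conjunct1])
    interpret prob_space "\<nu> s" by (rule pb[unfolded prob_borel_def, THEN conjunct1])
    have Vc: "continuous_on UNIV (\<lambda>x. V x s)" "continuous_on UNIV (\<lambda>x. V x s')" by (rule V_continuous[OF s0(1)], rule V_continuous[OF s0(2)])
    have di: "integrable (\<nu> s) (\<lambda>x. V x s' - V x s)" by (rule int[OF continuous_on_diff[OF Vc(2) Vc(1)]])
    have gi: "integrable (\<nu> s) (dV s)" by (rule int[OF dVc])
    \<comment> \<open>The equilibrium measure at \<open>s\<close> is tested in the minimum problem
      at \<open>s'\<close>.\<close>
    have "ereal (I s') \<le> energy (\<lambda>x. V x s') (\<nu> s)" by (rule min[OF pb])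
    also have "\<dots> = ereal (I s + (\<integral>x. V x s' - V x s \<partial>\<nu> s))" by (rule energy[OF Vc(2)])
    finally have "I s' - I s \<le> (\<integral>x. V x s' - V x s \<partial>\<nu> s)" by simp
    \<comment> \<open>On the support the Taylor remainder in the parameter is uniform in
      \<open>x\<close>; \<open>C\<close> stems from the bound \<open>BW\<close> on the ball of
      radius \<open>\<delta>\<close> around \<open>s\<close>.\<close>
    also have "\<dots> \<le> (\<integral>x. (s' - s) * dV s x + C * (s' - s)^2 \<partial>\<nu> s)"
    proof (rule integral_mono_AE[OF di])
      show "integrable (\<nu> s) (\<lambda>x. (s' - s) * dV s x + C * (s' - s)^2)"
        by (intro Bochner_Integration.integrable_add integrable_mult_right gi integrable_const)
      show "AE x in \<nu> s. V x s' - V x s \<le> (s' - s) * dV s x + C * (s' - s)^2"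
        using supp
      proof eventually_elim
        case (elim x)
        let ?f = "\<lambda>\<tau>. W (of_real x) \<tau>"
        have xo: "complex_of_real x \<in> orect (A + 6) (6 * \<eta>)" by (rule real_in_crect(2)[OF elim])
        have sub: "ball (complex_of_real s) (3 * (\<delta>/3)) \<subseteq> U2" using U2(2)[OF subsetD[OF U(3) imageI[OF s]]] by simp
        have "norm (?f (of_real s') - ?f (of_real s) - deriv ?f (of_real s) * (of_real s' - of_real s)) \<le> C * norm (complex_of_real s' - of_real s)^2"
          unfolding C_def
        proof (rule holomorphic_second_order_bound)
          show "?f holomorphic_on ball (of_real s) (3 * (\<delta>/3))" by (rule holomorphic_on_subset[OF ht[OF xo] sub])
          show "norm (?f w) \<le> BW" if "w \<in> ball (of_real s) (3 * (\<delta>/3))" for w by (rule BW[OF xo subsetD[OF sub that], THEN conjunct2])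
          have "dist (complex_of_real s) (of_real s') = \<bar>s' - s\<bar>" unfolding dist_of_real by (simp add: dist_real_def abs_minus_commute)
          then show "complex_of_real s' \<in> ball (of_real s) (\<delta>/3)" using ss by simp
        qed (use \<delta> in simp)
        moreover have "?f (of_real s') - ?f (of_real s) - deriv ?f (of_real s) * (of_real s' - of_real s) = of_real (V x s' - V x s - (s' - s) * Vt s x)"
          unfolding Vt_eq[OF s] WV[OF s0(1)] WV[OF s0(2)] by (simp add: mult.commute)
        moreover have "norm (complex_of_real s' - of_real s)^2 = (s' - s)^2" unfolding of_real_diff[symmetric] norm_of_real by simp
        ultimately have "\<bar>V x s' - V x s - (s' - s) * Vt s x\<bar> \<le> C * (s' - s)^2" by (simp only: norm_of_real)
        moreover have "dV s x = Vt s x" using elim A(1) by (auto simp: dV_def clamp_def)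
        ultimately show ?case by (simp add: abs_le_iff)
      qed
    qed
    also have "\<dots> = (s' - s) * g s + C * (s' - s)^2"
      using gi by (simp add: g_def prob_space)
    finally show "I s' - I s \<le> (s' - s) * g s + C * (s' - s)^2" .
  qed
  moreover have "\<forall>t\<in>{-t1..t1}. (\<lambda>N. - ln (partition_fn V N t) / (real N)^2) \<longlonglongrightarrow> I t"
    using Pr unfolding Pr_def by blast
  ultimately show ?thesis by blast
qed

section \<open>Choice of uniform neighbourhoods and conclusion\<close>

lemma compact_of_real_interval: "compact (complex_of_real ` {x..y})"
  by (rule compact_continuous_image[OF linear_continuous_on[OF bounded_linear_of_real] compact_Icc])

theorem theorem4p3:
  fixes V :: "real \<Rightarrow> real \<Rightarrow> real" and t0 t1 :: real
  assumes t0_pos: "t0 > 0"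
    and analytic: "\<exists>\<Omega> D W. open \<Omega> \<and> connected \<Omega> \<and> range complex_of_real \<subseteq> \<Omega> \<and>
          \<Omega> \<times> (complex_of_real ` {-t0..t0}) \<subseteq> D \<and> holo2 W D \<and>
          (\<forall>x t. t \<in> {-t0..t0} \<longrightarrow> W (complex_of_real x) (complex_of_real t) = complex_of_real (V x t))"
    and growth: "filterlim (\<lambda>x. Inf ((\<lambda>t. V x t) ` {-t0..t0}) / ln \<bar>x\<bar>) at_top at_infinity"
    and reg0: "regular (\<lambda>x. V x 0)"
    and t1: "t1 > 0" "t1 \<le> t0"
    and reg_family: "\<exists>q a b. (\<forall>t\<in>{-t1..t1}. regular_with (\<lambda>x. V x t) q (\<lambda>i. a i t) (\<lambda>i. b i t)) \<and>
          (\<forall>i<q. real_analytic_on (a i) {-t1..t1} \<and> real_analytic_on (b i) {-t1..t1})"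
  shows "\<exists>F. (\<forall>t\<in>{-t1..t1}. (\<lambda>N. - ln (partition_fn V N t) / (real N)^2) \<longlonglongrightarrow> F t) \<and>
             real_analytic_on F {-t1..t1}"
proof -
  obtain \<Omega> D W where \<Omega>: "open \<Omega>" "range complex_of_real \<subseteq> \<Omega>" and D: "\<Omega> \<times> (complex_of_real ` {-t0..t0}) \<subseteq> D"
    and W: "holo2 W D" and WV: "\<And>x t. t \<in> {-t0..t0} \<Longrightarrow> W (complex_of_real x) (complex_of_real t) = complex_of_real (V x t)"
    using analytic by blast
  interpret potential_family V t0 t1 \<Omega> D W
    by (rule potential_family.intro[OF t1 \<Omega> D W _ growth]) (rule WV)
  obtain q a b where reg: "\<And>t. t \<in> {-t1..t1} \<Longrightarrow> regular_with (\<lambda>x. V x t) q (\<lambda>i. a i t) (\<lambda>i. b i t)"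
    and an: "\<And>i. i < q \<Longrightarrow> real_analytic_on (a i) {-t1..t1}" "\<And>i. i < q \<Longrightarrow> real_analytic_on (b i) {-t1..t1}"
    using reg_family by blast
  define T where "T = complex_of_real ` {-t1..t1}"
  have Tc: "compact T" unfolding T_def by (rule compact_of_real_interval)
  have Tcv: "convex T" unfolding T_def using t1 by (simp add: of_real_interval)
  have ext: "\<exists>X G. open X \<and> T \<subseteq> X \<and> G holomorphic_on X \<and> (\<forall>x\<in>{-t1..t1}. G (complex_of_real x) = complex_of_real (f x))"
    if "real_analytic_on f {-t1..t1}" for f using that unfolding real_analytic_on_def T_def .
  have "\<forall>i\<in>{..<q}. \<exists>X G. open X \<and> T \<subseteq> X \<and> G holomorphic_on X \<and> (\<forall>x\<in>{-t1..t1}. G (complex_of_real x) = complex_of_real (a i x))"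
    using ext an(1) by blast
  then obtain Ua where "\<forall>i\<in>{..<q}. \<exists>G. open (Ua i) \<and> T \<subseteq> Ua i \<and> G holomorphic_on Ua i \<and> (\<forall>x\<in>{-t1..t1}. G (complex_of_real x) = complex_of_real (a i x))"
    by (rule bchoice[THEN exE])
  then obtain \<alpha> where \<alpha>: "\<forall>i\<in>{..<q}. open (Ua i) \<and> T \<subseteq> Ua i \<and> \<alpha> i holomorphic_on Ua i \<and> (\<forall>x\<in>{-t1..t1}. \<alpha> i (complex_of_real x) = complex_of_real (a i x))"
    by (rule bchoice[THEN exE])
  have "\<forall>i\<in>{..<q}. \<exists>X G. open X \<and> T \<subseteq> X \<and> G holomorphic_on X \<and> (\<forall>x\<in>{-t1..t1}. G (complex_of_real x) = complex_of_real (b i x))"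
    using ext an(2) by blast
  then obtain Ub where "\<forall>i\<in>{..<q}. \<exists>G. open (Ub i) \<and> T \<subseteq> Ub i \<and> G holomorphic_on Ub i \<and> (\<forall>x\<in>{-t1..t1}. G (complex_of_real x) = complex_of_real (b i x))"
    by (rule bchoice[THEN exE])
  then obtain \<beta> where \<beta>: "\<forall>i\<in>{..<q}. open (Ub i) \<and> T \<subseteq> Ub i \<and> \<beta> i holomorphic_on Ub i \<and> (\<forall>x\<in>{-t1..t1}. \<beta> i (complex_of_real x) = complex_of_real (b i x))"
    by (rule bchoice[THEN exE])
  have "bounded (\<Union>i\<in>{..<q}. a i ` {-t1..t1} \<union> b i ` {-t1..t1})"
    using an by (intro bounded_UN finite_lessThan ballI bounded_Un[THEN iffD2] conjI compact_imp_bounded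
        compact_continuous_image real_analytic_on_imp_continuous_on) auto
  then obtain A0 where "\<forall>x\<in>(\<Union>i\<in>{..<q}. a i ` {-t1..t1} \<union> b i ` {-t1..t1}). norm x \<le> A0"
    unfolding bounded_iff by (rule exE)
  note A0 = bspec[OF this]
  \<comment> \<open>The maximum makes \<open>A\<close> positive, as the contour formulas require,
    even if all end points are close to zero.\<close>
  define A where "A = max 1 A0"
  have A: "A \<ge> 1" by (simp add: A_def)
  have Aa: "\<bar>a i t\<bar> \<le> A" "\<bar>b i t\<bar> \<le> A" if "i < q" "t \<in> {-t1..t1}" for i t
  proof -
    have "norm (a i t) \<le> A0" using that by (intro A0 UN_I[of i]) auto
    moreover have "norm (b i t) \<le> A0" using that by (intro A0 UN_I[of i]) auto
    ultimately show "\<bar>a i t\<bar> \<le> A" "\<bar>b i t\<bar> \<le> A" by (auto simp: A_def)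
  qed
  have "complex_of_real ` {-(A+6)..A+6} \<subseteq> \<Omega>" by (rule subset_trans[OF image_mono[OF subset_UNIV] \<Omega>(2)])
  then obtain e where e: "e > 0" "(\<Union>x\<in>complex_of_real ` {-(A+6)..A+6}. ball x e) \<subseteq> \<Omega>"
    by (rule compact_subset_open_imp_ball_epsilon_subset[OF compact_of_real_interval \<Omega>(1)])
  \<comment> \<open>The outermost half height \<open>6 * \<eta>\<close> becomes \<open>e/2\<close>,
    inside the \<open>e\<close>-neighbourhood of the real segment.\<close>
  define \<eta> where "\<eta> = e / 12"
  have \<eta>: "\<eta> > 0" using e by (simp add: \<eta>_def)
  have C\<Omega>: "crect (A + 6) (6 * \<eta>) \<subseteq> \<Omega>"
  proof
    fix z assume z: "z \<in> crect (A + 6) (6 * \<eta>)"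
    have "z - of_real (Re z) = \<i> * of_real (Im z)" by (simp add: complex_eq_iff)
    then have "dist (complex_of_real (Re z)) z = \<bar>Im z\<bar>" by (simp add: dist_norm norm_minus_commute norm_mult)
    then have "z \<in> ball (complex_of_real (Re z)) e" using z e by (simp add: crect_def \<eta>_def)
    moreover have "Re z \<in> {-(A+6)..A+6}" using z by (auto simp: crect_def abs_le_iff)
    ultimately show "z \<in> \<Omega>" by (intro subsetD[OF e(2)] UN_I[OF imageI])
  qed
  have oD: "open D" using W unfolding holo2_def by (rule conjunct1)
  have "T \<subseteq> complex_of_real ` {-t0..t0}" unfolding T_def by (rule image_mono) (use t1 in auto)
  then have "crect (A + 6) (6 * \<eta>) \<times> T \<subseteq> D" by (rule subset_trans[OF Sigma_mono[OF C\<Omega>] D])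
  then obtain e2 where e2: "e2 > 0" "(\<Union>x\<in>crect (A + 6) (6 * \<eta>) \<times> T. ball x e2) \<subseteq> D"
    by (rule compact_subset_open_imp_ball_epsilon_subset[OF compact_Times[OF compact_crect Tc] oD])
  define O0 where "O0 = orect (A + 1) \<eta>"
  \<comment> \<open>Parameters for which all continued end points lie in the innermost
    rectangle.\<close>
  define N where "N = (\<Inter>i\<in>{..<q}. (Ua i \<inter> \<alpha> i -` O0) \<inter> (Ub i \<inter> \<beta> i -` O0))"
  have "open N" unfolding N_def
  proof (intro open_INT finite_lessThan ballI open_Int[of "Ua _ \<inter> _"])
    fix i assume i: "i \<in> {..<q}"
    show "open (Ua i \<inter> \<alpha> i -` O0)" using \<alpha> i unfolding O0_def
      by (intro continuous_open_preimage open_orect holomorphic_on_imp_continuous_on) auto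
    show "open (Ub i \<inter> \<beta> i -` O0)" using \<beta> i unfolding O0_def
      by (intro continuous_open_preimage open_orect holomorphic_on_imp_continuous_on) auto
  qed
  moreover have "T \<subseteq> N"
  proof
    fix \<tau> assume "\<tau> \<in> T"
    then obtain s where s: "s \<in> {-t1..t1}" "\<tau> = of_real s" by (auto simp: T_def)
    show "\<tau> \<in> N" unfolding N_def
    proof (intro INT_I IntI vimageI2)
      fix i assume i: "i \<in> {..<q}"
      show "\<tau> \<in> Ua i" "\<tau> \<in> Ub i" using \<alpha> \<beta> i \<open>\<tau> \<in> T\<close> by auto
      have "\<bar>a i s\<bar> < A + 1" "\<bar>b i s\<bar> < A + 1" using Aa[of i s] i s by auto
      moreover have "\<alpha> i \<tau> = of_real (a i s)" "\<beta> i \<tau> = of_real (b i s)" using \<alpha> \<beta> i s by auto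
      ultimately show "\<alpha> i \<tau> \<in> O0" "\<beta> i \<tau> \<in> O0" using \<eta> by (auto simp: O0_def orect_def)
    qed
  qed
  ultimately obtain e3 where e3: "e3 > 0" "(\<Union>x\<in>T. ball x e3) \<subseteq> N"
    by (metis compact_subset_open_imp_ball_epsilon_subset[OF Tc])
  \<comment> \<open>A quarter leaves room for two steps: \<open>U\<close> is the
    \<open>\<delta>\<close>-neighbourhood of the real parameters, and discs of radius
    \<open>\<delta>\<close> around its points stay in \<open>U2\<close>, whose radius
    \<open>2 * \<delta>\<close> is below both margins.\<close>
  define \<delta> where "\<delta> = min e2 e3 / 4"
  have \<delta>: "\<delta> > 0" "2 * \<delta> < e2" "2 * \<delta> < e3" using e2 e3 by (auto simp: \<delta>_def)
  define U where "U = (\<Union>x\<in>T. ball x \<delta>)"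
  define U2 where "U2 = (\<Union>x\<in>T. ball x (2 * \<delta>))"
  \<comment> \<open>A compact subset of \<open>D\<close> containing the product of the largest
    rectangle and \<open>U2\<close>; continuity of \<open>W\<close> on it supplies the bound
    \<open>BW\<close>.\<close>
  define C2 where "C2 = crect (A + 6) (6 * \<eta>) \<times> {x + y |x y. x \<in> T \<and> y \<in> cball 0 (2 * \<delta>)}"
  have "compact C2" unfolding C2_def by (intro compact_Times compact_crect compact_sums Tc compact_cball)
  have C2D: "C2 \<subseteq> D"
  proof
    fix p assume "p \<in> C2"
    then obtain z x y where p: "p = (z, x + y)" "z \<in> crect (A + 6) (6 * \<eta>)" "x \<in> T" "norm y \<le> 2 * \<delta>" by (auto simp: C2_def)
    have "dist (z, x) p = norm y" by (simp add: p(1) dist_Pair_Pair dist_norm)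
    then have "p \<in> ball (z, x) e2" using p(4) \<delta> by simp
    then show "p \<in> D" by (intro subsetD[OF e2(2)] UN_I[OF SigmaI[OF p(2,3)]])
  qed
  have "continuous_on C2 (\<lambda>p. W (fst p) (snd p))"
    by (rule continuous_on_subset[OF W[unfolded holo2_def, THEN conjunct2, THEN conjunct1] C2D])
  then have "bounded ((\<lambda>p. W (fst p) (snd p)) ` C2)" by (intro compact_imp_bounded compact_continuous_image \<open>compact C2\<close>)
  then obtain BW where "\<forall>w\<in>(\<lambda>p. W (fst p) (snd p)) ` C2. norm w \<le> BW" unfolding bounded_iff by (rule exE)
  note BW = bspec[OF this imageI]
  have inC2: "(z, \<tau>) \<in> C2" if zt: "z \<in> orect (A + 6) (6 * \<eta>)" "\<tau> \<in> U2" for z \<tau>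
  proof -
    obtain x where x: "x \<in> T" "dist x \<tau> < 2 * \<delta>" using zt(2) by (auto simp: U2_def)
    have "\<tau> = x + (\<tau> - x)" by simp
    moreover have "\<tau> - x \<in> cball 0 (2 * \<delta>)" using x(2) by (simp add: dist_norm norm_minus_commute)
    moreover have "z \<in> crect (A + 6) (6 * \<eta>)" using zt(1) by (auto simp: orect_def crect_def)
    ultimately show ?thesis using x(1) unfolding C2_def
      by (intro SigmaI CollectI exI[of _ x] exI[of _ "\<tau> - x"]) simp_all
  qed
  have UN: "U \<subseteq> N"
  proof -
    have "U \<subseteq> (\<Union>x\<in>T. ball x e3)" unfolding U_def using \<delta> by (intro UN_mono subset_ball) auto
    then show ?thesis using e3(2) by (rule subset_trans)
  qed
  have inN: "\<tau> \<in> Ua i \<and> \<alpha> i \<tau> \<in> O0 \<and> \<tau> \<in> Ub i \<and> \<beta> i \<tau> \<in> O0" if "i < q" "\<tau> \<in> U" for i \<tau>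
    using subsetD[OF UN that(2)] that(1) unfolding N_def by simp
  have O0c: "O0 \<subseteq> crect (A + 1) \<eta>" by (auto simp: O0_def orect_def crect_def)
  interpret regular_family V t0 t1 \<Omega> D W q a b \<alpha> \<beta> A \<eta> \<delta> BW U U2
  proof (intro regular_family.intro regular_family_axioms.intro)
    show "potential_family V t0 t1 \<Omega> D W" by (rule potential_family_axioms)
    show "open U" "open U2" unfolding U_def U2_def by auto
    show "convex U" unfolding U_def by (rule convex_thickening[OF Tcv])
    show "of_real ` {-t1..t1} \<subseteq> U" unfolding U_def T_def[symmetric]
      by (rule subsetI, erule UN_I) (use \<delta> in simp)
    show "ball \<tau> \<delta> \<subseteq> U2" if "\<tau> \<in> U" for \<tau>
    proof
      fix w assume w: "w \<in> ball \<tau> \<delta>"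
      obtain x where x: "x \<in> T" "dist x \<tau> < \<delta>" using \<open>\<tau> \<in> U\<close> by (auto simp: U_def)
      have "dist x w \<le> dist x \<tau> + dist \<tau> w" by (rule dist_triangle)
      then have "dist x w < 2 * \<delta>" using x w by simp
      then show "w \<in> U2" using x by (auto simp: U2_def)
    qed
    show "\<alpha> i holomorphic_on U" "\<beta> i holomorphic_on U" if "i < q" for i
    proof -
      have "U \<subseteq> Ua i" "U \<subseteq> Ub i" using inN[OF that] by (simp_all add: subset_iff)
      moreover have "\<alpha> i holomorphic_on Ua i" "\<beta> i holomorphic_on Ub i" using \<alpha> \<beta> that by simp_all
      ultimately show "\<alpha> i holomorphic_on U" "\<beta> i holomorphic_on U" by (simp_all add: holomorphic_on_subset)
    qed
    show "\<alpha> i \<tau> \<in> crect (A + 1) \<eta>" "\<beta> i \<tau> \<in> crect (A + 1) \<eta>" if "i < q" "\<tau> \<in> U" for i \<tau>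
      using inN[OF that] O0c by auto
    show "\<alpha> i (of_real t) = of_real (a i t)" "\<beta> i (of_real t) = of_real (b i t)" if "i < q" "t \<in> {-t1..t1}" for i t
      using \<alpha> \<beta> that by auto
    show "(z, \<tau>) \<in> D \<and> norm (W z \<tau>) \<le> BW" if "z \<in> orect (A + 6) (6 * \<eta>)" "\<tau> \<in> U2" for z \<tau>
      using subsetD[OF C2D inC2[OF that]] BW[OF inC2[OF that]] unfolding fst_conv snd_conv by (rule conjI)
  qed (fact reg A Aa \<eta> \<delta>(1))+
  show ?thesis by (rule analytic_free_energy)
qed

end
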